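(* Let $G$ be algorithmically stackable over the finite symmetric generating set $A$, and let $\Phi$ be a bounded flow function on $\Gamma(G,A)$ for which $S_\Phi$ is recursive. Then the stacking recursion associated to $\Phi$ is an inductive algorithm which, upon input of a word $w\in A^*$ that represents the identity in $G$, will construct a van Kampen diagram for $w$ over the stacking presentation.
   Context: Conventions. A finite generating set $A$ of a group $G$ is symmetric if it is closed under inversion; for $a\in A$, $a^{-1}\in A$ denotes the inverse letter. Standing assumption: no element of $A$ represents the identity $\epsilon$ of $G$. $A^*$ is the set of words over $A$, and $\rho:A^*\to G$ is the canonical monoid homomorphism. Let $\Gamma=\Gamma(G,A)$ be the Cayley graph, $\vec E$ its set of directed edges, and $\vec P$ its set of directed edge paths; $\lambda:\vec P\to A^*$ maps each path to the word labeling it. For $g\in G$, $a\in A$, let $e_{g,a}\in\vec E$ be the directed edge with initial vertex $g$, terminal vertex $ga$ and label $a$. The directed edges $e_{g,a}$ and $e_{ga,a^{-1}}$ are viewed as having a single underlying undirected edge. The edges lying on a directed path are taken with the direction in which the path traverses them. Flow function. A flow function associated to a maximal tree $T$ in $\Gamma$ is a function $\Phi:\vec E\to\vec P$ such that: (F1) for each $e\in\vec E$, the path $\Phi(e)$ has the same initial and terminal vertices as $e$; (F2d) if the undirected edge underlying $e$ lies in $T$, then $\Phi(e)=e$; (F2r) the transitive closure $<_\Phi$ of the relation $<$ on $\vec E$ defined by "$e'<e$ whenever $e'$ lies on the path $\Phi(e)$ and the undirected edges underlying both $e$ and $e'$ do not lie in $T$" is a well-founded strict partial ordering. It is bounded if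 the lengths of the paths $\Phi(e)$ are bounded by a constant. $G$ is algorithmically stackable over $A$ if there is a bounded flow function $\Phi$ on $\Gamma(G,A)$ such that $$S_\Phi:=\{(w,a,\lambda(\Phi(e_{\rho(w),a})))\mid w\in A^*,\ a\in A\}\subset A^*\times A\times A^*$$ is recursive (computable). Let $\mathcal N=\{y_g\mid g\in G\}$ be the set of normal forms labeling the non-backtracking paths in $T$ from $\epsilon$ (with $y_g$ labeling the path ending at $g$), $\vec E_d$ the set of directed edges whose underlying edge lies in $T$ (degenerate edges), and $\vec E_r=\vec E\setminus\vec E_d$ (recursive edges). Stacking presentation. This is $\langle A\mid R\rangle$, where $R$ is the closure of the set of words $\{\lambda(\Phi(e_{g,a}))a^{-1}\mid e_{g,a}\in\vec E_r\}$ under inversion, cyclic conjugation and free reduction (except the empty word); it is a finite presentation of $G$. Van Kampen diagram. For a word $w$ representing $\epsilon$, a van Kampen diagram for $w$ over $\langle A\mid R\rangle$ is a finite, planar, contractible combinatorial 2-complex with edges directed and labeled by elements of $A$, whose boundary is an edge path labeled $w$ starting at a basepoint vertex $*$ and reading counterclockwise, and each of whose 2-cells has boundary labeled by an element of $R$. Diagrams need not be reduced. Stacking recursion. For each directed edge $e$ from $g$ to $h$ labeled $a$, a van Kampen diagram $\Delta_e$ for $y_gay_h^{-1}$ is constructed as follows. If $e\in\vec E_d$, then $y_gay_h^{-1}$ freely reduces to the empty word and $\Delta_e$ is a line segment of edges with no 2-cells. If $e\in\vec E_r$, use Noetherian induction on $<_\Phi$: write $\lambda(\Phi(e))=a_1\cdots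 a_n$ with $a_i\in A$, let $e_i=e_{ga_1\cdots a_{i-1},a_i}$ (so $e_i\in\vec E_d$, or $e_i\in\vec E_r$ and $e_i<_\Phi e$), glue the previously constructed diagrams $\Delta_{e_1},\dots,\Delta_{e_n}$ successively, starting at basepoints, along the common boundary paths labeled $y_{ga_1\cdots a_i}$ of $\Delta_{e_i}$ and $\Delta_{e_{i+1}}$, to obtain a diagram with boundary word $y_g\lambda(\Phi(e))y_h^{-1}$, and then glue a polygonal 2-cell with boundary label $\lambda(\Phi(e))a^{-1}$ along the boundary subpath labeled $\lambda(\Phi(e))$. For each undirected edge, choose the diagram $\Delta_e$ for one of its two orientations. Finally, given $w=b_1\cdots b_n$ (each $b_i\in A$) representing $\epsilon$, take for each $i$ the chosen diagram for the undirected edge between $\rho(b_1\cdots b_{i-1})$ and $\rho(b_1\cdots b_i)$, replaced by its mirror image if necessary so that its counterclockwise boundary word is $y_{b_1\cdots b_{i-1}}b_iy_{b_1\cdots b_i}^{-1}$ (where $y_v$ denotes the normal form of $\rho(v)$), and glue these $n$ diagrams successively along the common boundary paths labeled $y_{b_1\cdots b_i}$ (the "seashell" method); the resulting diagram is the output for $w$. *)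

theory Defs
  imports "HOL-Algebra.Generated_Groups" "HOL-Library.Nat_Bijection"
begin

section \<open>Partial recursive functions\<close>

datatype recf =
    Zero
  | Succ
  | Proj nat
  | Comp recf "recf list"
  | PrimRec recf recf
  | Mu recf

text \<open>\<open>evaluates p xs y\<close>: the program \<open>p\<close> halts on the argument tuple \<open>xs\<close> with value \<open>y\<close>
  (Kleene's schemes; there is no value if an unbounded search does not end).\<close>

inductive evaluates :: "recf \<Rightarrow> nat list \<Rightarrow> nat \<Rightarrow> bool" where
  zero: "evaluates Zero xs 0"
| succ: "evaluates Succ [x] (Suc x)"
| proj: "i < length xs \<Longrightarrow> evaluates (Proj i) xs (xs ! i)"
| comp: "\<lbrakk>list_all2 (\<lambda>g y. evaluates g xs y) gs ys; evaluates f ys z\<rbrakk>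
    \<Longrightarrow> evaluates (Comp f gs) xs z"
| prim0: "evaluates f xs y \<Longrightarrow> evaluates (PrimRec f g) (0 # xs) y"
| primS: "\<lbrakk>evaluates (PrimRec f g) (n # xs) r; evaluates g (n # r # xs) y\<rbrakk>
    \<Longrightarrow> evaluates (PrimRec f g) (Suc n # xs) y"
| mu: "\<lbrakk>evaluates f (n # xs) 0; \<forall>m<n. \<exists>y. evaluates f (m # xs) (Suc y)\<rbrakk>
    \<Longrightarrow> evaluates (Mu f) xs n"

lemma evaluates_deterministic:
  "evaluates p xs y \<Longrightarrow> evaluates p xs z \<Longrightarrow> z = y"
proof (induction arbitrary: z rule: evaluates.induct)
  case (zero xs)
  then show ?case by cases auto
next
  case (succ x)
  then show ?case by cases auto
next
  case (proj i xs)
  from proj(2) show ?case by cases auto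
next
  case (comp xs gs ys f y)
  from comp.prems obtain ys' where 1: "list_all2 (\<lambda>g y. evaluates g xs y) gs ys'"
    and 2: "evaluates f ys' z" by cases auto
  have "ys' = ys"
    using comp(1) 1 by (intro nth_equalityI) (auto simp: list_all2_conv_all_nth)
  with 2 comp.IH show ?case by blast
next
  case (prim0 f xs y g)
  from prim0.prems show ?case by cases (auto intro: prim0.IH)
next
  case (primS f g n xs r y)
  from primS.prems obtain r' where "evaluates (PrimRec f g) (n # xs) r'"
    "evaluates g (n # r' # xs) z" by cases auto
  with primS.IH show ?case by blast
next
  case (mu f n xs)
  from mu.prems have 1: "evaluates f (z # xs) 0"
    and 2: "\<forall>m<z. \<exists>y. evaluates f (m # xs) (Suc y)" by (cases; blast)+
  have "\<not> z < n" using mu.IH(2) 1 by fastforce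
  moreover have "\<not> n < z"
  proof
    assume "n < z"
    with 2 obtain y where "evaluates f (n # xs) (Suc y)" by blast
    with mu.IH(1) show False by blast
  qed
  ultimately show ?case by simp
qed

section \<open>Words and the Cayley graph\<close>

definition symmetric_generating_set :: "('g, 'm) monoid_scheme \<Rightarrow> 'g set \<Rightarrow> bool" where
  "symmetric_generating_set G A \<longleftrightarrow>
     finite A \<and> A \<subseteq> carrier G \<and> generate G A = carrier G \<and>
     (\<forall>a\<in>A. inv\<^bsub>G\<^esub> a \<in> A) \<and> \<one>\<^bsub>G\<^esub> \<notin> A"

definition word_val :: "('g, 'm) monoid_scheme \<Rightarrow> 'g list \<Rightarrow> 'g" where
  "word_val G w = foldr (\<otimes>\<^bsub>G\<^esub>) w \<one>\<^bsub>G\<^esub>"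

definition inv_word :: "('g, 'm) monoid_scheme \<Rightarrow> 'g list \<Rightarrow> 'g list" where
  "inv_word G w = rev (map (\<lambda>a. inv\<^bsub>G\<^esub> a) w)"

text \<open>The pair \<open>(g, a)\<close> is the directed edge $e_{g,a}$. A set of undirected edges is represented by
  the set of all its directed edges, hence by a set closed under \<open>reverse_edge\<close>.\<close>

type_synonym 'g edge = "'g \<times> 'g"

definition cayley_edges :: "('g, 'm) monoid_scheme \<Rightarrow> 'g set \<Rightarrow> 'g edge set" where
  "cayley_edges G A = carrier G \<times> A"

definition terminal :: "('g, 'm) monoid_scheme \<Rightarrow> 'g edge \<Rightarrow> 'g" where
  "terminal G e = fst e \<otimes>\<^bsub>G\<^esub> snd e"

definition reverse_edge :: "('g, 'm) monoid_scheme \<Rightarrow> 'g edge \<Rightarrow> 'g edge" where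
  "reverse_edge G e = (terminal G e, inv\<^bsub>G\<^esub> (snd e))"

text \<open>\<open>edge_path G E g p h\<close>: \<open>p\<close> is a directed edge path from \<open>g\<close> to \<open>h\<close> with all edges in \<open>E\<close>.
  Its label is \<open>map snd p\<close>.\<close>

fun edge_path :: "('g, 'm) monoid_scheme \<Rightarrow> 'g edge set \<Rightarrow> 'g \<Rightarrow> 'g edge list \<Rightarrow> 'g \<Rightarrow> bool" where
  "edge_path G E g [] h \<longleftrightarrow> g \<in> carrier G \<and> g = h"
| "edge_path G E g (e # p) h \<longleftrightarrow> e \<in> E \<and> fst e = g \<and> edge_path G E (terminal G e) p h"

definition non_backtracking :: "('g, 'm) monoid_scheme \<Rightarrow> 'g edge list \<Rightarrow> bool" where
  "non_backtracking G p \<longleftrightarrow> successively (\<lambda>e e'. e' \<noteq> reverse_edge G e) p"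

text \<open>A subtree containing all vertices: a connected spanning subgraph without nontrivial closed
  non-backtracking paths.\<close>

definition maximal_tree :: "('g, 'm) monoid_scheme \<Rightarrow> 'g set \<Rightarrow> 'g edge set \<Rightarrow> bool" where
  "maximal_tree G A T \<longleftrightarrow>
     T \<subseteq> cayley_edges G A \<and> (\<forall>e\<in>T. reverse_edge G e \<in> T) \<and>
     (\<forall>g\<in>carrier G. \<forall>h\<in>carrier G. \<exists>p. edge_path G T g p h) \<and>
     (\<forall>g p. edge_path G T g p g \<and> non_backtracking G p \<longrightarrow> p = [])"

definition normal_form :: "('g, 'm) monoid_scheme \<Rightarrow> 'g edge set \<Rightarrow> 'g \<Rightarrow> 'g list" where
  "normal_form G T g =
     map snd (THE p. edge_path G T \<one>\<^bsub>G\<^esub> p g \<and> non_backtracking G p)"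

section \<open>Flow functions and stackability\<close>

definition flow_less ::
  "('g, 'm) monoid_scheme \<Rightarrow> 'g set \<Rightarrow> 'g edge set \<Rightarrow> ('g edge \<Rightarrow> 'g edge list) \<Rightarrow> 'g edge rel" where
  "flow_less G A T \<Phi> =
     {(e', e). e \<in> cayley_edges G A \<and> e' \<in> set (\<Phi> e) \<and> e' \<notin> T \<and> e \<notin> T}\<^sup>+"

definition flow_function ::
  "('g, 'm) monoid_scheme \<Rightarrow> 'g set \<Rightarrow> 'g edge set \<Rightarrow> ('g edge \<Rightarrow> 'g edge list) \<Rightarrow> bool" where
  "flow_function G A T \<Phi> \<longleftrightarrow>
     (\<forall>e\<in>cayley_edges G A. edge_path G (cayley_edges G A) (fst e) (\<Phi> e) (terminal G e)) \<and>
     (\<forall>e\<in>T. \<Phi> e = [e]) \<and>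
     irrefl (flow_less G A T \<Phi>) \<and> trans (flow_less G A T \<Phi>) \<and> wf (flow_less G A T \<Phi>)"

definition bounded_flow_function ::
  "('g, 'm) monoid_scheme \<Rightarrow> 'g set \<Rightarrow> 'g edge set \<Rightarrow> ('g edge \<Rightarrow> 'g edge list) \<Rightarrow> bool" where
  "bounded_flow_function G A T \<Phi> \<longleftrightarrow>
     flow_function G A T \<Phi> \<and> (\<exists>k. \<forall>e\<in>cayley_edges G A. length (\<Phi> e) \<le> k)"

definition flow_set ::
  "('g, 'm) monoid_scheme \<Rightarrow> 'g set \<Rightarrow> ('g edge \<Rightarrow> 'g edge list) \<Rightarrow> ('g list \<times> 'g \<times> 'g list) set" where
  "flow_set G A \<Phi> = {(w, a, map snd (\<Phi> (word_val G w, a))) | w a. w \<in> lists A \<and> a \<in> A}"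

text \<open>Letters are numbered by a map \<open>\<nu>\<close> that is injective on the finite set \<open>A\<close>. Any two such
  numberings differ by a finite table, so computability does not depend on the choice.\<close>

definition word_code :: "('g \<Rightarrow> nat) \<Rightarrow> 'g list \<Rightarrow> nat" where
  "word_code \<nu> w = list_encode (map \<nu> w)"

definition recursive_flow_set :: "('g \<Rightarrow> nat) \<Rightarrow> 'g set \<Rightarrow> ('g list \<times> 'g \<times> 'g list) set \<Rightarrow> bool" where
  "recursive_flow_set \<nu> A S \<longleftrightarrow>
     (\<exists>p. \<forall>w\<in>lists A. \<forall>a\<in>A. \<forall>u\<in>lists A.
        evaluates p [word_code \<nu> w, \<nu> a, word_code \<nu> u] (if (w, a, u) \<in> S then 1 else 0))"

definition algorithmically_stackable :: "('g, 'm) monoid_scheme \<Rightarrow> 'g set \<Rightarrow> bool" where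
  "algorithmically_stackable G A \<longleftrightarrow>
     (\<exists>T \<Phi> \<nu>. maximal_tree G A T \<and> bounded_flow_function G A T \<Phi> \<and>
        inj_on \<nu> A \<and> recursive_flow_set \<nu> A (flow_set G A \<Phi>))"

section \<open>The stacking presentation\<close>

definition cancels :: "('g, 'm) monoid_scheme \<Rightarrow> 'g list \<Rightarrow> 'g list \<Rightarrow> bool" where
  "cancels G w v \<longleftrightarrow> (\<exists>x y a. w = x @ [a, inv\<^bsub>G\<^esub> a] @ y \<and> v = x @ y)"

definition free_reduction :: "('g, 'm) monoid_scheme \<Rightarrow> 'g list \<Rightarrow> 'g list \<Rightarrow> bool" where
  "free_reduction G w v \<longleftrightarrow> (cancels G)\<^sup>*\<^sup>* w v \<and> (\<nexists>u. cancels G v u)"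

inductive_set stacking_relators ::
  "('g, 'm) monoid_scheme \<Rightarrow> 'g set \<Rightarrow> 'g edge set \<Rightarrow> ('g edge \<Rightarrow> 'g edge list) \<Rightarrow> 'g list set"
  for G A T \<Phi> where
  flow: "(g, a) \<in> cayley_edges G A - T
    \<Longrightarrow> map snd (\<Phi> (g, a)) @ [inv\<^bsub>G\<^esub> a] \<in> stacking_relators G A T \<Phi>"
| inverse: "w \<in> stacking_relators G A T \<Phi> \<Longrightarrow> inv_word G w \<in> stacking_relators G A T \<Phi>"
| conjugate: "w \<in> stacking_relators G A T \<Phi> \<Longrightarrow> rotate1 w \<in> stacking_relators G A T \<Phi>"
| reduction: "\<lbrakk>w \<in> stacking_relators G A T \<Phi>; free_reduction G w v; v \<noteq> []\<rbrakk>
    \<Longrightarrow> v \<in> stacking_relators G A T \<Phi>"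

section \<open>Van Kampen diagrams\<close>

text \<open>A connected 2-complex drawn in the plane is encoded as a combinatorial map. A dart
  \<open>(k, b, a)\<close> is one of the two orientations \<open>b\<close> of the edge with identifier \<open>k\<close>, and \<open>a\<close> is the
  letter read when the edge is traversed in that orientation. Every dart has exactly one face on
  its right-hand side. The list \<open>boundary\<close> consists of the darts with the unbounded face on their
  right, that is, it is the boundary walk of the complex, traversed counterclockwise from the
  basepoint. Each element of \<open>cells\<close> is the walk around a 2-cell with the cell on the right, that
  is, clockwise. The diagram without darts is a single vertex.\<close>

type_synonym 'g dart = "nat \<times> bool \<times> 'g"

datatype 'g diagram = Diagram (boundary: "'g dart list") (cells: "'g dart list list")

definition label :: "'g dart \<Rightarrow> 'g" where
  "label d = snd (snd d)"

definition opposite :: "('g, 'm) monoid_scheme \<Rightarrow> 'g dart \<Rightarrow> 'g dart" where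
  "opposite G d = (case d of (k, b, a) \<Rightarrow> (k, \<not> b, inv\<^bsub>G\<^esub> a))"

definition face_walks :: "'g diagram \<Rightarrow> 'g dart list list" where
  "face_walks D = boundary D # cells D"

definition darts :: "'g diagram \<Rightarrow> 'g dart set" where
  "darts D = set (concat (face_walks D))"

definition dart_edges :: "('g, 'm) monoid_scheme \<Rightarrow> 'g diagram \<Rightarrow> 'g dart set set" where
  "dart_edges G D = (\<lambda>d. {d, opposite G d}) ` darts D"

text \<open>\<open>(d, d') \<in> face_next D\<close>: on the closed walk around some face, \<open>d'\<close> comes right after \<open>d\<close>.\<close>

definition face_next :: "'g diagram \<Rightarrow> 'g dart rel" where
  "face_next D = (\<Union>c\<in>set (face_walks D). set (zip c (rotate1 c)))"

text \<open>If \<open>d'\<close> comes after \<open>opposite d\<close> on a face, then \<open>d\<close> and \<open>d'\<close> start at the same vertex. A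
  vertex is the class of the darts that start there, i.e. an orbit of this rotation of darts.\<close>

definition same_origin :: "('g, 'm) monoid_scheme \<Rightarrow> 'g diagram \<Rightarrow> 'g dart rel" where
  "same_origin G D =
     (let r = {(d, d'). d \<in> darts D \<and> (opposite G d, d') \<in> face_next D} in (r \<union> r\<inverse>)\<^sup>*)"

definition vertices :: "('g, 'm) monoid_scheme \<Rightarrow> 'g diagram \<Rightarrow> 'g dart set set" where
  "vertices G D = darts D // same_origin G D"

definition num_vertices :: "('g, 'm) monoid_scheme \<Rightarrow> 'g diagram \<Rightarrow> nat" where
  "num_vertices G D = (if darts D = {} then 1 else card (vertices G D))"

text \<open>Each dart and its opposite lie on exactly one face walk, once; so the faces, including the
  unbounded one, form a closed oriented surface.\<close>

definition combinatorial_map :: "('g, 'm) monoid_scheme \<Rightarrow> 'g diagram \<Rightarrow> bool" where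
  "combinatorial_map G D \<longleftrightarrow>
     distinct (concat (face_walks D)) \<and> [] \<notin> set (cells D) \<and>
     (\<forall>d\<in>darts D. opposite G d \<in> darts D \<and> opposite G (opposite G d) = d)"

definition connected_map :: "('g, 'm) monoid_scheme \<Rightarrow> 'g diagram \<Rightarrow> bool" where
  "connected_map G D \<longleftrightarrow>
     (\<forall>d\<in>darts D. \<forall>d'\<in>darts D.
        (d, d') \<in> (face_next D \<union> {(x, opposite G x) | x. x \<in> darts D})\<^sup>*)"

text \<open>For a connected map, the Euler formula $V - E + (C + 1) = 2$, where $C$ is the number of
  2-cells, says that the surface is the sphere. Removing the unbounded face leaves a planar
  complex which is contractible, all its bounded faces being cells.\<close>

definition planar_map :: "('g, 'm) monoid_scheme \<Rightarrow> 'g diagram \<Rightarrow> bool" where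
  "planar_map G D \<longleftrightarrow>
     int (num_vertices G D) - int (card (dart_edges G D)) + int (length (face_walks D)) = 2"

definition van_kampen_diagram ::
  "('g, 'm) monoid_scheme \<Rightarrow> 'g set \<Rightarrow> 'g list set \<Rightarrow> 'g list \<Rightarrow> 'g diagram \<Rightarrow> bool" where
  "van_kampen_diagram G A R w D \<longleftrightarrow>
     combinatorial_map G D \<and> connected_map G D \<and> planar_map G D \<and>
     label ` darts D \<subseteq> A \<and>
     map label (boundary D) = w \<and>
     (\<forall>c\<in>set (cells D). map label c \<in> R)"

section \<open>Operations on diagrams\<close>

text \<open>A line segment labeled \<open>x\<close>; its boundary runs from the basepoint to the other end and back.\<close>

definition segment :: "('g, 'm) monoid_scheme \<Rightarrow> 'g list \<Rightarrow> 'g diagram" where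
  "segment G x =
     (let p = map (\<lambda>i. (i, True, x ! i)) [0..<length x]
      in Diagram (p @ rev (map (opposite G) p)) [])"

definition mirror :: "('g, 'm) monoid_scheme \<Rightarrow> 'g diagram \<Rightarrow> 'g diagram" where
  "mirror G D =
     Diagram (rev (map (opposite G) (boundary D)))
             (map (\<lambda>c. rev (map (opposite G) c)) (cells D))"

definition map_darts :: "('g dart \<Rightarrow> 'g dart) \<Rightarrow> 'g diagram \<Rightarrow> 'g diagram" where
  "map_darts f D = Diagram (map f (boundary D)) (map (map f) (cells D))"

text \<open>An edge identifier larger than all those in use.\<close>

definition fresh :: "'g diagram \<Rightarrow> nat" where
  "fresh D = foldr (\<lambda>d m. max (Suc (fst d)) m) (concat (face_walks D)) 0"

text \<open>\<open>glue G n D D'\<close>: the last \<open>n\<close> darts of the boundary of \<open>D\<close>, reversed, form a path \<open>p\<close> that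
  starts at the basepoint. It is identified, edge by edge, with the path \<open>p'\<close> formed by the first
  \<open>n\<close> darts of the boundary of a disjoint copy \<open>D''\<close> of \<open>D'\<close>.\<close>

definition glue :: "('g, 'm) monoid_scheme \<Rightarrow> nat \<Rightarrow> 'g diagram \<Rightarrow> 'g diagram \<Rightarrow> 'g diagram" where
  "glue G n D D' =
     (let m = length (boundary D) - n;
          D'' = map_darts (\<lambda>(k, b, a). (fresh D + k, b, a)) D';
          p = rev (map (opposite G) (drop m (boundary D)));
          p' = take n (boundary D'');
          ident = map_of (zip p' p @ zip (map (opposite G) p') (map (opposite G) p));
          s = (\<lambda>d. case ident d of None \<Rightarrow> d | Some d' \<Rightarrow> d')
      in Diagram (take m (boundary D) @ map s (drop n (boundary D'')))
                 (cells D @ map (map s) (cells D'')))"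

text \<open>\<open>attach_cell G n l a D\<close>: a 2-cell is glued to the outside of \<open>D\<close> along the boundary subpath
  \<open>q\<close> consisting of the \<open>l\<close> darts after the first \<open>n\<close>; a new edge labeled \<open>a\<close> joins the ends of
  \<open>q\<close> and takes its place in the boundary.\<close>

definition attach_cell ::
  "('g, 'm) monoid_scheme \<Rightarrow> nat \<Rightarrow> nat \<Rightarrow> 'g \<Rightarrow> 'g diagram \<Rightarrow> 'g diagram" where
  "attach_cell G n l a D =
     (let d = (fresh D, True, a); q = take l (drop n (boundary D))
      in Diagram (take n (boundary D) @ [d] @ drop (n + l) (boundary D))
                 (cells D @ [q @ [opposite G d]]))"

section \<open>The stacking recursion\<close>

text \<open>Given an edge path and for each of its edges \<open>e\<close>, from \<open>g\<close> to \<open>h\<close> labeled \<open>a\<close>, a diagram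
  with boundary word $y_g a y_h^{-1}$, successive diagrams are glued along the paths labeled by the
  normal forms of the intermediate vertices.\<close>

fun glue_along :: "('g, 'm) monoid_scheme \<Rightarrow> 'g edge set \<Rightarrow> 'g edge list \<Rightarrow> 'g diagram list \<Rightarrow> 'g diagram"
  where
  "glue_along G T (e # es) (D # Ds) =
     foldl (\<lambda>D1 (e', D2). glue G (length (normal_form G T (fst e'))) D1 D2) D (zip es Ds)"
| "glue_along G T _ _ = Diagram [] []"

text \<open>\<open>stacking G A T \<Phi> e D\<close>: the recursion on \<open>e\<close> terminates with the diagram \<open>D\<close>. For an edge
  of \<open>T\<close>, the longer one of $y_g$ and $y_h$ labels the line segment.\<close>

inductive stacking ::
  "('g, 'm) monoid_scheme \<Rightarrow> 'g set \<Rightarrow> 'g edge set \<Rightarrow> ('g edge \<Rightarrow> 'g edge list) \<Rightarrow>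
   'g edge \<Rightarrow> 'g diagram \<Rightarrow> bool"
  for G A T \<Phi> where
  degenerate: "\<lbrakk>e \<in> T; y = normal_form G T (fst e); z = normal_form G T (terminal G e)\<rbrakk>
    \<Longrightarrow> stacking G A T \<Phi> e (segment G (if length y < length z then z else y))"
| recursive: "\<lbrakk>e \<in> cayley_edges G A - T; list_all2 (stacking G A T \<Phi>) (\<Phi> e) Ds\<rbrakk>
    \<Longrightarrow> stacking G A T \<Phi> e
      (attach_cell G (length (normal_form G T (fst e))) (length (\<Phi> e)) (snd e)
        (glue_along G T (\<Phi> e) Ds))"

definition edge_diagram ::
  "('g, 'm) monoid_scheme \<Rightarrow> 'g set \<Rightarrow> 'g edge set \<Rightarrow> ('g edge \<Rightarrow> 'g edge list) \<Rightarrow>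
   'g edge \<Rightarrow> 'g diagram" where
  "edge_diagram G A T \<Phi> e = (THE D. stacking G A T \<Phi> e D)"

text \<open>A choice of one orientation of every undirected edge: \<open>c e\<close> says that \<open>e\<close> is chosen.\<close>

definition orientation_choice :: "('g, 'm) monoid_scheme \<Rightarrow> 'g set \<Rightarrow> ('g edge \<Rightarrow> bool) \<Rightarrow> bool" where
  "orientation_choice G A c \<longleftrightarrow> (\<forall>e\<in>cayley_edges G A. c (reverse_edge G e) \<longleftrightarrow> \<not> c e)"

definition recursive_choice ::
  "('g \<Rightarrow> nat) \<Rightarrow> ('g, 'm) monoid_scheme \<Rightarrow> 'g set \<Rightarrow> ('g edge \<Rightarrow> bool) \<Rightarrow> bool" where
  "recursive_choice \<nu> G A c \<longleftrightarrow>
     (\<exists>p. \<forall>w\<in>lists A. \<forall>a\<in>A.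
        evaluates p [word_code \<nu> w, \<nu> a] (if c (word_val G w, a) then 1 else 0))"

definition oriented_diagram ::
  "('g, 'm) monoid_scheme \<Rightarrow> 'g set \<Rightarrow> 'g edge set \<Rightarrow> ('g edge \<Rightarrow> 'g edge list) \<Rightarrow>
   ('g edge \<Rightarrow> bool) \<Rightarrow> 'g edge \<Rightarrow> 'g diagram" where
  "oriented_diagram G A T \<Phi> c e =
     (if c e then edge_diagram G A T \<Phi> e
      else mirror G (edge_diagram G A T \<Phi> (reverse_edge G e)))"

definition word_path :: "('g, 'm) monoid_scheme \<Rightarrow> 'g list \<Rightarrow> 'g edge list" where
  "word_path G w = map (\<lambda>i. (word_val G (take i w), w ! i)) [0..<length w]"

text \<open>The seashell method; for the empty word the output is a single vertex.\<close>

definition stacking_output ::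
  "('g, 'm) monoid_scheme \<Rightarrow> 'g set \<Rightarrow> 'g edge set \<Rightarrow> ('g edge \<Rightarrow> 'g edge list) \<Rightarrow>
   ('g edge \<Rightarrow> bool) \<Rightarrow> 'g list \<Rightarrow> 'g diagram" where
  "stacking_output G A T \<Phi> c w =
     glue_along G T (word_path G w) (map (oriented_diagram G A T \<Phi> c) (word_path G w))"

definition dart_code :: "('g \<Rightarrow> nat) \<Rightarrow> 'g dart \<Rightarrow> nat" where
  "dart_code \<nu> d = (case d of (k, b, a) \<Rightarrow> prod_encode (k, prod_encode (of_bool b, \<nu> a)))"

definition diagram_code :: "('g \<Rightarrow> nat) \<Rightarrow> 'g diagram \<Rightarrow> nat" where
  "diagram_code \<nu> D =
     list_encode (map (\<lambda>c. list_encode (map (dart_code \<nu>) c)) (face_walks D))"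

end

theory Submission
  imports Defs "HOL-Library.Multiset"
begin

text \<open>
  The theorem has a geometric half (the recursion yields van Kampen diagrams) and a computational half
  (it can be carried out by a program).

  Geometry. A diagram is a combinatorial map, and what has to be shown after every gluing is the Euler
  formula. Gluing along a path is not harmless in general: if the path were closed on both sides,
  then a sphere could be pinched off. The proof therefore does not compute the Euler characteristic
  of a glued diagram but rebuilds the diagram. Two moves, attaching a spur and attaching a cell along
  a boundary path, change the numbers of vertices, edges and faces in an obvious way and preserve
  planarity and connectedness (\<open>spherical_spur\<close>, \<open>spherical_cell\<close>). If a diagram arises by such moves
  from a line segment labeled \<open>p\<close>, then the same moves can be replayed on any other diagram that shows
  the path \<open>p\<close> on its boundary, and the outcome is exactly the diagram glued along \<open>p\<close>
  (\<open>grows_replay\<close>, \<open>grown_from_amalgamate\<close>). The invariant \<open>strip\<close> of the recursion says that a diagram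
  with boundary $y v z^{-1}$ can be rebuilt from the arc labeled $y$ and, read backwards, from the arc
  labeled $z$; it is preserved by gluing, attaching a cell and taking mirror images. For an edge of
  the tree it holds because one of the two normal forms extends the other by a letter
  (\<open>nf_tree_edge\<close>). Termination and uniqueness of the recursion are Noetherian induction along the
  flow (\<open>stacking_unique\<close>).

  Computation. Functions on words and diagrams are shown to be computable by closure properties: codes
  for pairs and lists reduce everything to primitive recursion. A group element is represented by its
  normal form. The label of $\Phi(e)$ can be found among the finitely many words below the bound on
  the flow function by means of the decision procedure for $S_\Phi$ (\<open>computable_flow_labels\<close>), and it
  tells whether \<open>e\<close> is an edge of the tree (\<open>tree_iff_flow_label\<close>). With this, one step of a stack machine
  that follows the recursion is computable. That the machine halts, with the right diagrams on its
  stack, is proved by induction over the recursion (\<open>reaches_edge\<close>), and unbounded minimization finds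
  the halting time (\<open>program_by_iteration\<close>). The same machine computes normal forms and hence decides
  a choice of orientations (\<open>letter_choice_recursive\<close>).
\<close>

section \<open>Cyclic lists\<close>

definition adjacent :: "'a list \<Rightarrow> 'a rel" where
  "adjacent xs = set (zip xs (tl xs))"

definition cyclic_next :: "'a list \<Rightarrow> 'a rel" where
  "cyclic_next xs = set (zip xs (rotate1 xs))"

lemma adjacent_Nil [simp]: "adjacent [] = {}"
  by (simp add: adjacent_def)

lemma adjacent_single [simp]: "adjacent [x] = {}"
  by (simp add: adjacent_def)

lemma adjacent_Cons2 [simp]: "adjacent (x # y # xs) = insert (x, y) (adjacent (y # xs))"
  by (simp add: adjacent_def)

lemma adjacent_append: "adjacent (xs @ y # ys) = adjacent (xs @ [y]) \<union> adjacent (y # ys)"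
  by (induction xs rule: induct_list012) auto

lemma cyclic_next_Nil [simp]: "cyclic_next [] = {}"
  by (simp add: cyclic_next_def)

lemma cyclic_next_Cons: "cyclic_next (x # xs) = adjacent (x # xs @ [x])"
proof -
  have "zip ((x # xs) @ [x]) (xs @ [x]) = zip (x # xs) (xs @ [x])"
    by (subst zip_append1) auto
  then show ?thesis by (simp add: cyclic_next_def adjacent_def)
qed

text \<open>Face walks are cyclic, so the place on the boundary where a diagram is changed can be rotated to
  the start of the walk.\<close>

lemma cyclic_next_append_commute: "cyclic_next (xs @ ys) = cyclic_next (ys @ xs)"
proof (cases xs; cases ys)
  fix x xs' y ys' assume "xs = x # xs'" "ys = y # ys'"
  then show ?thesis
    using adjacent_append[of "x # xs'" y "ys' @ [x]"] adjacent_append[of "y # ys'" x "xs' @ [y]"]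
    by (auto simp: cyclic_next_Cons)
qed auto

lemma cyclic_next_subset: "cyclic_next xs \<subseteq> set xs \<times> set xs"
  by (auto simp: cyclic_next_def dest: set_zip_leftD set_zip_rightD)

lemma face_next_eq: "face_next D = cyclic_next (boundary D) \<union> (\<Union>c\<in>set (cells D). cyclic_next c)"
  by (simp add: face_next_def face_walks_def cyclic_next_def)

lemma adjacent_append_nonempty:
  "xs \<noteq> [] \<Longrightarrow> ys \<noteq> [] \<Longrightarrow>
    adjacent (xs @ ys) = adjacent xs \<union> adjacent ys \<union> {(last xs, hd ys)}"
  by (induction xs rule: induct_list012) (auto simp: neq_Nil_conv)

lemma cyclic_next_eq: "xs \<noteq> [] \<Longrightarrow> cyclic_next xs = adjacent xs \<union> {(last xs, hd xs)}"
  by (cases xs) (auto simp: cyclic_next_Cons adjacent_append_nonempty[of "_ # _" "[_]", simplified])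

lemma cyclic_next_append:
  "xs \<noteq> [] \<Longrightarrow> ys \<noteq> [] \<Longrightarrow>
    cyclic_next (xs @ ys) = adjacent xs \<union> adjacent ys \<union> {(last xs, hd ys), (last ys, hd xs)}"
  by (auto simp: cyclic_next_eq adjacent_append_nonempty)

section \<open>Vertices and connectivity of combinatorial maps\<close>

lemma opposite_simps [simp]:
  "fst (opposite G d) = fst d" "label (opposite G d) = inv\<^bsub>G\<^esub> (label d)" "opposite G d \<noteq> d" "d \<noteq> opposite G d"
  by (auto simp: opposite_def label_def split: prod.splits)

lemma darts_eq: "darts D = set (boundary D) \<union> set (concat (cells D))"
  by (auto simp: darts_def face_walks_def)

lemma finite_darts: "finite (darts D)"
  by (simp add: darts_def)

lemma face_next_subset: "face_next D \<subseteq> darts D \<times> darts D"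
  using cyclic_next_subset by (fastforce simp: face_next_eq darts_eq)

definition link :: "('g, 'm) monoid_scheme \<Rightarrow> 'g diagram \<Rightarrow> 'g dart rel" where
  "link G D = {(d, d'). d \<in> darts D \<and> (opposite G d, d') \<in> face_next D}"

lemma same_origin_eq: "same_origin G D = (link G D \<union> (link G D)\<inverse>)\<^sup>*"
  by (simp add: same_origin_def link_def Let_def)

lemma same_origin_refl [simp]: "(d, d) \<in> same_origin G D"
  by (simp add: same_origin_eq)

lemma same_origin_sym: "(d, d') \<in> same_origin G D \<Longrightarrow> (d', d) \<in> same_origin G D"
  unfolding same_origin_eq using sym_rtrancl[OF sym_Un_converse] by (meson symD)

lemma same_origin_trans:
  "(d, d') \<in> same_origin G D \<Longrightarrow> (d', d'') \<in> same_origin G D \<Longrightarrow> (d, d'') \<in> same_origin G D"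
  unfolding same_origin_eq by (rule rtrancl_trans)

lemma link_same_origin: "(d, d') \<in> link G D \<Longrightarrow> (d, d') \<in> same_origin G D"
  unfolding same_origin_eq by blast

lemma same_origin_mono:
  assumes "\<And>d d'. (d, d') \<in> link G D \<Longrightarrow> (d, d') \<in> same_origin G D'"
    and "(d, d') \<in> same_origin G D"
  shows "(d, d') \<in> same_origin G D'"
  using assms(2) unfolding same_origin_eq[of G D]
proof (induction rule: rtrancl_induct)
  case (step y z)
  then have "(y, z) \<in> same_origin G D'"
    using assms(1) same_origin_sym by blast
  with step.IH show ?case by (rule same_origin_trans)
qed simp

lemma same_origin_respects:
  assumes "\<And>d d'. (d, d') \<in> link G D \<Longrightarrow> f d = f d'"
    and "(d, d') \<in> same_origin G D"
  shows "f d = f d'"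
  using assms(2) unfolding same_origin_eq
  by (induction rule: rtrancl_induct) (use assms(1) in force)+

text \<open>The vertices are equivalence classes, all of which may change as sets when darts are added. A
  numbering of the vertices can instead be extended to the new darts.\<close>

definition vertex_labelling :: "('g, 'm) monoid_scheme \<Rightarrow> 'g diagram \<Rightarrow> ('g dart \<Rightarrow> nat) \<Rightarrow> bool" where
  "vertex_labelling G D f \<longleftrightarrow>
     (\<forall>d\<in>darts D. \<forall>d'\<in>darts D. f d = f d' \<longleftrightarrow> (d, d') \<in> same_origin G D)"

lemma card_image_eqI:
  assumes "\<And>x y. x \<in> S \<Longrightarrow> y \<in> S \<Longrightarrow> f x = f y \<longleftrightarrow> g x = g y"
  shows "card (f ` S) = card (g ` S)"
proof -
  have "bij_betw (\<lambda>z. g (SOME x. x \<in> S \<and> f x = z)) (f ` S) (g ` S)"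
  proof (rule bij_betwI')
    have *: "(SOME y. y \<in> S \<and> f y = f x) \<in> S \<and> f (SOME y. y \<in> S \<and> f y = f x) = f x"
      if "x \<in> S" for x
      using that by (intro someI[of "\<lambda>y. y \<in> S \<and> f y = f x"]) auto
    then have **: "g (SOME y. y \<in> S \<and> f y = f x) = g x" if "x \<in> S" for x
      using that assms by blast
    show "(g (SOME y. y \<in> S \<and> f y = a) = g (SOME y. y \<in> S \<and> f y = b)) = (a = b)"
      if "a \<in> f ` S" "b \<in> f ` S" for a b
      using that ** assms by auto
    show "g (SOME y. y \<in> S \<and> f y = a) \<in> g ` S" if "a \<in> f ` S" for a
      using that ** by auto
    show "\<exists>a\<in>f ` S. b = g (SOME y. y \<in> S \<and> f y = a)" if "b \<in> g ` S" for b
      using that ** by force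
  qed
  then show ?thesis by (rule bij_betw_same_card)
qed

lemma same_origin_class_eq:
  "(d, d') \<in> same_origin G D \<longleftrightarrow> same_origin G D `` {d} = same_origin G D `` {d'}"
  using same_origin_sym same_origin_trans same_origin_refl by fast

lemma num_vertices_labelling:
  assumes "vertex_labelling G D f" "darts D \<noteq> {}"
  shows "num_vertices G D = card (f ` darts D)"
proof -
  have "vertices G D = (\<lambda>d. same_origin G D `` {d}) ` darts D"
    by (auto simp: vertices_def quotient_def)
  moreover have "card ((\<lambda>d. same_origin G D `` {d}) ` darts D) = card (f ` darts D)"
    using assms(1) by (intro card_image_eqI) (auto simp: vertex_labelling_def same_origin_class_eq)
  ultimately show ?thesis using assms(2) by (simp add: num_vertices_def)
qed

lemma vertex_labelling_exists: "\<exists>f. vertex_labelling G D f"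
proof -
  obtain n and h :: "'a dart set \<Rightarrow> nat"
    where h: "inj_on h ((\<lambda>d. same_origin G D `` {d}) ` darts D)"
    using finite_imp_inj_to_nat_seg[of "(\<lambda>d. same_origin G D `` {d}) ` darts D"] finite_darts by blast
  have "vertex_labelling G D (\<lambda>d. h (same_origin G D `` {d}))"
    unfolding vertex_labelling_def same_origin_class_eq using h by (auto simp: inj_on_def)
  then show ?thesis by blast
qed

definition dart_step :: "('g, 'm) monoid_scheme \<Rightarrow> 'g diagram \<Rightarrow> 'g dart rel" where
  "dart_step G D = face_next D \<union> {(x, opposite G x) | x. x \<in> darts D}"

lemma connected_map_eq: "connected_map G D \<longleftrightarrow> darts D \<times> darts D \<subseteq> (dart_step G D)\<^sup>*"
  by (auto simp: connected_map_def dart_step_def)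

text \<open>The last conjunct keeps the boundary nonempty once there are darts, so that a spur has a corner to
  be attached to.\<close>

definition spherical :: "('g, 'm) monoid_scheme \<Rightarrow> 'g set \<Rightarrow> 'g diagram \<Rightarrow> bool" where
  "spherical G A D \<longleftrightarrow> combinatorial_map G D \<and> connected_map G D \<and> planar_map G D \<and>
     label ` darts D \<subseteq> A \<and> (boundary D = [] \<longrightarrow> cells D = [])"

text \<open>A change of the boundary interrupts only the steps from one dart to the next at one or two
  corners. It is enough that these can be made through the new darts.\<close>

lemma connected_extend:
  assumes conn: "connected_map G D"
    and darts: "darts D' = darts D \<union> N"
    and old: "\<And>x y. (x, y) \<in> face_next D \<Longrightarrow> (x, y) \<in> (dart_step G D')\<^sup>*"
    and new: "\<And>x. x \<in> N \<Longrightarrow> \<exists>y\<in>darts D. (x, y) \<in> (dart_step G D')\<^sup>*"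
             "\<And>x. x \<in> N \<Longrightarrow> \<exists>y\<in>darts D. (y, x) \<in> (dart_step G D')\<^sup>*"
  shows "connected_map G D'"
proof -
  have "dart_step G D \<subseteq> (dart_step G D')\<^sup>*"
    using old darts by (auto simp: dart_step_def)
  then have "(dart_step G D)\<^sup>* \<subseteq> (dart_step G D')\<^sup>*"
    by (metis rtrancl_mono rtrancl_idemp)
  with conn have *: "darts D \<times> darts D \<subseteq> (dart_step G D')\<^sup>*"
    by (auto simp: connected_map_eq)
  show ?thesis
    unfolding connected_map_eq
  proof clarify
    fix x y assume "x \<in> darts D'" "y \<in> darts D'"
    then obtain x' y' where "x' \<in> darts D" "y' \<in> darts D" "(x, x') \<in> (dart_step G D')\<^sup>*" "(y', y) \<in> (dart_step G D')\<^sup>*"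
      using new darts by blast
    with * show "(x, y) \<in> (dart_step G D')\<^sup>*"
      by (metis (no_types) mem_Sigma_iff rtrancl_trans subset_iff)
  qed
qed

text \<open>If every new dart \<open>x\<close> starts at the vertex of an old dart \<open>r x\<close>, and the old rotation is respected,
  then vertices are neither created nor merged, and the numbering extends along \<open>r\<close>.\<close>

lemma labelling_extend:
  assumes f: "vertex_labelling G D f"
    and darts: "darts D' \<subseteq> darts D \<union> N"
    and r: "\<And>x. x \<in> N \<Longrightarrow> r x \<in> darts D \<and> (x, r x) \<in> same_origin G D'"
    and link: "\<And>x y. (x, y) \<in> link G D' \<Longrightarrow>
        f (if x \<in> N then r x else x) = f (if y \<in> N then r y else y)"
    and old: "\<And>x y. (x, y) \<in> link G D \<Longrightarrow> (x, y) \<in> same_origin G D'"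
  shows "vertex_labelling G D' (\<lambda>x. f (if x \<in> N then r x else x))"
proof -
  define r' where "r' x = (if x \<in> N then r x else x)" for x
  have r': "r' x \<in> darts D" "(x, r' x) \<in> same_origin G D'" if "x \<in> darts D'" for x
    using that darts r by (auto simp: r'_def)
  have "f (r' x) = f (r' y) \<longleftrightarrow> (x, y) \<in> same_origin G D'" if xy: "x \<in> darts D'" "y \<in> darts D'" for x y
  proof
    assume "f (r' x) = f (r' y)"
    then have "(r' x, r' y) \<in> same_origin G D"
      using f r' xy by (auto simp: vertex_labelling_def)
    then have "(r' x, r' y) \<in> same_origin G D'"
      using same_origin_mono[OF old] by blast
    with r'(2)[OF xy(1)] r'(2)[OF xy(2)] show "(x, y) \<in> same_origin G D'"
      by (meson same_origin_trans same_origin_sym)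
  next
    assume "(x, y) \<in> same_origin G D'"
    moreover have "f (r' x) = f (r' y)" if "(x, y) \<in> link G D'" for x y
      using link[OF that] by (simp add: r'_def)
    ultimately show "f (r' x) = f (r' y)"
      using same_origin_respects[where f = "\<lambda>x. f (r' x)"] by metis
  qed
  then show ?thesis by (simp add: vertex_labelling_def r'_def)
qed

section \<open>Attaching a spur or a cell\<close>

text \<open>The two orientations of an edge determine each other because inversion is an involution of the
  alphabet. The geometry is developed over any alphabet of this kind.\<close>

locale letters =
  fixes G :: "('g, 'm) monoid_scheme" and A :: "'g set"
  assumes inv_in [simp]: "a \<in> A \<Longrightarrow> inv\<^bsub>G\<^esub> a \<in> A"
    and inv_invol [simp]: "a \<in> A \<Longrightarrow> inv\<^bsub>G\<^esub> (inv\<^bsub>G\<^esub> a) = a"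
begin

abbreviation opp :: "'g dart \<Rightarrow> 'g dart" where "opp \<equiv> opposite G"

lemma opp_opp: "label d \<in> A \<Longrightarrow> opp (opp d) = d"
  by (auto simp: opposite_def label_def split: prod.splits)

definition ids :: "'g dart list \<Rightarrow> 'g dart list list \<Rightarrow> nat set" where
  "ids b cs = fst ` (set b \<union> set (concat cs))"

lemma spherical_closed:
  assumes "spherical G A D" "d \<in> darts D"
  shows "opp d \<in> darts D" "opp (opp d) = d" "label d \<in> A"
  using assms by (auto simp: spherical_def combinatorial_map_def)

lemma card_dart_edges_extend:
  assumes d: "fst d \<notin> fst ` darts D" "label d \<in> A"
    and darts: "darts D' = darts D \<union> {d, opp d}"
  shows "card (dart_edges G D') = Suc (card (dart_edges G D))"
proof -
  have "dart_edges G D' = insert {d, opp d} (dart_edges G D)"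
    using d darts by (auto simp: dart_edges_def opp_opp)
  moreover have "{d, opp d} \<notin> dart_edges G D"
  proof
    assume "{d, opp d} \<in> dart_edges G D"
    then obtain e where "e \<in> darts D" "{d, opp d} = {e, opp e}" by (auto simp: dart_edges_def)
    then have "e = d \<or> e = opp d" by (auto simp: doubleton_eq_iff)
    with \<open>e \<in> darts D\<close> d(1) show False by (metis image_eqI opposite_simps(1))
  qed
  moreover have "finite (dart_edges G D)"
    by (simp add: dart_edges_def finite_darts)
  ultimately show ?thesis by simp
qed

text \<open>A new edge \<open>d\<close> that joins the ends of a boundary path \<open>q\<close> closes off one new cell, so $E$ and $F$
  grow by one. The number of vertices is unchanged: \<open>d\<close> starts where \<open>q\<close> starts, \<open>opp d\<close> starts where
  \<open>q\<close> ends, and the corners of the old boundary at these two vertices are each split by the new edge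
  into two corners which the rotation still connects. The new cell may be listed from either end,
  because a mirror image lists it from the other one.\<close>

lemma spherical_cell:
  assumes D: "spherical G A (Diagram (u @ q @ v) cs)" and q: "q \<noteq> []"
    and d: "fst d \<notin> ids (u @ q @ v) cs" "label d \<in> A"
    and c: "c = q @ [opp d] \<or> c = opp d # q"
  shows "spherical G A (Diagram (u @ [d] @ v) (cs @ [c]))"
proof -
  define D0 where "D0 = Diagram (u @ q @ v) cs"
  define D' where "D' = Diagram (u @ [d] @ v) (cs @ [c])"
  define w where "w = v @ u"
  define CS where "CS = (\<Union>c\<in>set cs. cyclic_next c)"
  note D' = D[folded D0_def]
  note cl = spherical_closed[OF D[folded D0_def]]
  have oo: "opp (opp d) = d" using d(2) by (rule opp_opp)
  have "fst d \<notin> fst ` darts D0"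
    using d by (simp add: ids_def darts_eq D0_def)
  then have dd: "d \<notin> darts D0" "opp d \<notin> darts D0" "fst d \<notin> fst ` darts D0"
    using opposite_simps(1)[of G d] by (auto simp: image_iff)
  have c_next: "cyclic_next c = adjacent q \<union> {(last q, opp d), (opp d, hd q)}"
  proof -
    have "cyclic_next c = cyclic_next (q @ [opp d])"
      using c cyclic_next_append_commute[of "[opp d]" q] by (elim disjE) simp_all
    then show ?thesis using q by (auto simp: cyclic_next_append)
  qed
  have old: "face_next D0 = cyclic_next (q @ w) \<union> CS"
    using cyclic_next_append_commute[of u "q @ v"] by (simp add: face_next_eq D0_def w_def CS_def)
  have new: "face_next D' = cyclic_next (d # w) \<union> CS \<union> adjacent q \<union> {(last q, opp d), (opp d, hd q)}"
    using cyclic_next_append_commute[of u "d # v"] by (auto simp: face_next_eq D'_def w_def CS_def c_next)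
  \<comment> \<open>The dart that follows \<open>q\<close> on the old boundary.\<close>
  define nx where "nx = (if w = [] then hd q else hd w)"
  define W where "W = (if w = [] then {} else adjacent w)"
  have old1: "face_next D0 = adjacent q \<union> W \<union> {(last q, nx), (if w = [] then last q else last w, hd q)} \<union> CS"
    using q cyclic_next_eq[of q] cyclic_next_append[of q w]
    by (cases "w = []") (auto simp: old nx_def W_def)
  have new1: "face_next D' = (if w = [] then {(d, d)} else {(d, hd w), (last w, d)}) \<union> W
     \<union> CS \<union> adjacent q \<union> {(last q, opp d), (opp d, hd q)}"
    using q cyclic_next_append[of "[d]" w] by (auto simp: new W_def cyclic_next_Cons)
  have darts': "darts D' = darts D0 \<union> {d, opp d}"
    using c by (auto simp: darts_eq D'_def D0_def)
  have invol: "opp (opp x) = x" if "x \<in> darts D'" for x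
    using that cl(2)[of x] oo unfolding darts' by (elim UnE insertE) simp_all
  have hq: "hd q \<in> darts D0" "last q \<in> darts D0"
    using q by (auto simp: darts_eq D0_def)
  have wD: "w \<noteq> [] \<Longrightarrow> hd w \<in> darts D0 \<and> last w \<in> darts D0"
    using hd_in_set[of w] last_in_set[of w] by (auto simp: darts_eq D0_def w_def)
  have sub0: "face_next D0 \<subseteq> darts D0 \<times> darts D0" by (rule face_next_subset)
  have comb: "combinatorial_map G D'"
  proof -
    have "distinct (u @ q @ v @ concat cs)" "[] \<notin> set cs"
      using D by (auto simp: spherical_def combinatorial_map_def face_walks_def)
    moreover have "set (u @ q @ v @ concat cs) \<inter> {d, opp d} = {}"
      using dd by (auto simp: darts_eq D0_def)
    moreover have "distinct c" "set c = insert (opp d) (set q)"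
      using c calculation by auto
    ultimately have "distinct (concat (face_walks D'))" "[] \<notin> set (cells D')"
      using c by (auto simp: D'_def face_walks_def)
    then show ?thesis
      using cl d(2) by (auto simp: combinatorial_map_def darts' opp_opp)
  qed
  have step1: "(x, y) \<in> dart_step G D'" if "(x, y) \<in> face_next D'" for x y
    using that by (auto simp: dart_step_def)
  have "(x, opp x) \<in> dart_step G D'" if "x \<in> darts D'" for x
    using that unfolding dart_step_def by blast
  from this[of d] this[of "opp d"]
  have dopp: "(d, opp d) \<in> dart_step G D'" "(opp d, d) \<in> dart_step G D'"
    using invol darts' by auto
  have lq: "(last q, opp d) \<in> dart_step G D'" "(opp d, hd q) \<in> dart_step G D'"
    by (auto intro!: step1 simp: new1)
  have conn: "connected_map G D'"
  proof (rule connected_extend[OF _ darts'])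
    show "connected_map G D0" using D' by (simp add: spherical_def)
    fix x y assume "(x, y) \<in> face_next D0"
    then consider "(x, y) \<in> face_next D'" | "x = last q" "y = nx" | "w \<noteq> []" "x = last w" "y = hd q"
      | "w = []" "x = last q" "y = hd q"
      using old1 new1 by (auto split: if_splits)
    then show "(x, y) \<in> (dart_step G D')\<^sup>*"
    proof cases
      case 1 then show ?thesis using step1 by blast
    next
      case 2
      show ?thesis
      proof (cases "w = []")
        case True
        then show ?thesis using 2 lq rtrancl_trans[OF r_into_rtrancl r_into_rtrancl] by (simp add: nx_def)
      next
        case False
        then have "(d, hd w) \<in> dart_step G D'" by (auto intro!: step1 simp: new1)
        with lq(1) dopp(2) have "(last q, hd w) \<in> (dart_step G D')\<^sup>*"
          by (meson r_into_rtrancl rtrancl_trans)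
        with False 2 show ?thesis by (simp add: nx_def)
      qed
    next
      case 3
      then have "(last w, d) \<in> dart_step G D'" by (auto intro!: step1 simp: new1)
      with 3 lq(2) dopp(1) show ?thesis by (meson r_into_rtrancl rtrancl_trans)
    next
      case 4 then show ?thesis using lq by (meson r_into_rtrancl rtrancl_trans)
    qed
  next
    fix x assume "x \<in> {d, opp d}"
    then show "\<exists>y\<in>darts D0. (x, y) \<in> (dart_step G D')\<^sup>*"
      using lq(2) dopp(1) hq by (metis converse_rtrancl_into_rtrancl insertE r_into_rtrancl singletonD)
    from \<open>x \<in> {d, opp d}\<close> show "\<exists>y\<in>darts D0. (y, x) \<in> (dart_step G D')\<^sup>*"
      using lq(1) dopp(2) hq by (metis converse_rtrancl_into_rtrancl insertE r_into_rtrancl singletonD)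
  qed
  obtain f where f: "vertex_labelling G D0 f" using vertex_labelling_exists by blast
  have f_link: "f x = f y" if "x \<in> darts D0" "(opp x, y) \<in> face_next D0" for x y
    using f that sub0 link_same_origin[of x y G D0] by (auto simp: vertex_labelling_def link_def)
  define r where "r x = (if x = d then hd q else opp (last q))" for x
  have link': "(x, y) \<in> same_origin G D'" if "x \<in> darts D'" "(opp x, y) \<in> face_next D'" for x y
    using that link_same_origin[of x y G D'] by (auto simp: link_def)
  have so_d: "(d, hd q) \<in> same_origin G D'"
    by (rule link') (auto simp: darts' new1)
  have so_q: "(opp (last q), opp d) \<in> same_origin G D'"
    by (rule link') (use cl hq in \<open>auto simp: darts' new1\<close>)
  let ?f = "\<lambda>x. f (if x \<in> {d, opp d} then r x else x)"
  have lab: "vertex_labelling G D' ?f"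
  proof (rule labelling_extend[OF f])
    show "darts D' \<subseteq> darts D0 \<union> {d, opp d}" using darts' by simp
    fix x assume "x \<in> {d, opp d}"
    then show "r x \<in> darts D0 \<and> (x, r x) \<in> same_origin G D'"
      using so_d same_origin_sym[OF so_q] hq cl by (auto simp: r_def)
  next
    fix x y assume xy: "(x, y) \<in> link G D'"
    then have xd: "x \<in> darts D'" and xy': "(opp x, y) \<in> face_next D'" by (auto simp: link_def)
    have rd: "r d = hd q" "r (opp d) = opp (last q)" by (auto simp: r_def)
    consider "opp x = d" | "opp x = opp d" | "opp x \<in> darts D0"
      using xd cl(1)[of x] oo unfolding darts' by auto
    then show "f (if x \<in> {d, opp d} then r x else x) = f (if y \<in> {d, opp d} then r y else y)"
    proof cases
      case 1
      then have x: "x = opp d" using invol[OF xd] by simp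
      from xy' 1 have "(w = [] \<and> y = d) \<or> (w \<noteq> [] \<and> y = hd w)"
        using dd sub0 hq by (auto simp: new1 old1 split: if_splits)
      moreover have "f (opp (last q)) = f nx"
        using hq cl by (intro f_link) (auto simp: old1)
      ultimately show ?thesis using x rd wD dd by (auto simp: nx_def)
    next
      case 2
      then have x: "x = d" using invol[OF xd] oo by metis
      from xy' 2 have "y = hd q"
        using dd sub0 hq wD by (auto simp: new1 old1 split: if_splits)
      then show ?thesis using x rd dd hq by auto
    next
      case 3
      then have "x \<in> darts D0" using cl(1)[of "opp x"] invol[OF xd] by simp
      then have x: "x \<in> darts D0" "x \<notin> {d, opp d}" using dd by auto
      consider "y = d" "w \<noteq> []" "opp x = last w" | "y = opp d" "opp x = last q" | "(opp x, y) \<in> face_next D0"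
        using xy' 3 dd by (auto simp: new1 old1 split: if_splits)
      then show ?thesis
      proof cases
        case 1
        then have "f x = f (hd q)" using x by (intro f_link) (auto simp: old1)
        then show ?thesis using 1 x rd by auto
      next
        case 2
        then have "x = opp (last q)" using cl x by metis
        then show ?thesis using 2 x rd by auto
      next
        case 3
        then have "f x = f y" "y \<in> darts D0" using x f_link sub0 by auto
        then show ?thesis using x dd by auto
      qed
    qed
  next
    fix x y assume "(x, y) \<in> link G D0"
    then have x: "x \<in> darts D0" and xy: "(opp x, y) \<in> face_next D0" by (auto simp: link_def)
    consider "opp x = last q" "y = nx" | "w \<noteq> []" "opp x = last w" "y = hd q" | "w = []" "opp x = last q" "y = hd q"
      | "(opp x, y) \<in> face_next D'"
      using xy by (auto simp: new1 old1 split: if_splits)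
    then show "(x, y) \<in> same_origin G D'"
    proof cases
      case 1
      then have "x = opp (last q)" using cl x by metis
      moreover have "(opp d, if w = [] then d else hd w) \<in> same_origin G D'"
        using opp_opp[OF d(2)] by (intro link') (auto simp: darts' new1)
      ultimately show ?thesis
        using same_origin_trans[OF so_q] same_origin_trans[OF _ so_d] 1
        by (cases "w = []") (auto simp: nx_def)
    next
      case 2
      then have "(x, d) \<in> same_origin G D'" using x by (intro link') (auto simp: darts' new1)
      then show ?thesis using so_d 2 same_origin_trans by blast
    next
      case 3
      then have "x = opp (last q)" using cl x by metis
      moreover have "(opp d, d) \<in> same_origin G D'"
        using opp_opp[OF d(2)] 3 by (intro link') (auto simp: darts' new1)
      ultimately show ?thesis using so_d so_q 3 same_origin_trans by blast
    next
      case 4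
      then show ?thesis using x darts' by (intro link') auto
    qed
  qed
  have "?f ` darts D0 = f ` darts D0"
    using dd by (intro image_cong) auto
  moreover have "?f ` {d, opp d} \<subseteq> f ` darts D0"
    using hq(1) cl(1)[OF hq(2)] by (simp add: r_def)
  ultimately have "?f ` darts D' = f ` darts D0"
    unfolding darts' image_Un by blast
  moreover have "darts D' \<noteq> {}" "darts D0 \<noteq> {}"
    using hq darts' by auto
  ultimately have "num_vertices G D' = num_vertices G D0"
    using num_vertices_labelling[OF lab] num_vertices_labelling[OF f] by metis
  moreover have "planar_map G D0" using D' by (simp add: spherical_def)
  ultimately have "planar_map G D'"
    using card_dart_edges_extend[OF dd(3) d(2) darts']
    by (simp add: planar_map_def) (simp add: face_walks_def D0_def D'_def)
  then show ?thesis
    using comb conn cl d(2) unfolding spherical_def D'_def[symmetric] by (auto simp: darts') (auto simp: D'_def)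
qed

text \<open>By convention the diagram without darts has one vertex, so its first edge is counted directly.\<close>

lemma spherical_spur_empty:
  assumes d: "label d \<in> A"
  shows "spherical G A (Diagram [d, opp d] [])"
proof -
  define D where "D = Diagram [d, opp d] []"
  have darts: "darts D = {d, opp d}" by (auto simp: D_def darts_eq)
  have next_D: "face_next D = {(d, opp d), (opp d, d)}"
    by (auto simp: D_def face_next_eq cyclic_next_def)
  have oo: "opp (opp d) = d" using d by (rule opp_opp)
  have "link G D \<subseteq> Id"
    using oo by (auto simp: link_def next_D darts)
  then have "same_origin G D \<subseteq> Id"
    unfolding same_origin_eq using rtrancl_subset_rtrancl[of "link G D \<union> (link G D)\<inverse>" Id] by auto
  then have so: "same_origin G D = Id" by auto
  then have "vertices G D = {{d}, {opp d}}"
    by (auto simp: vertices_def quotient_def darts)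
  then have "num_vertices G D = 2"
    by (simp add: num_vertices_def darts)
  moreover have "dart_edges G D = {{d, opp d}}"
    using oo by (auto simp: dart_edges_def darts)
  ultimately have "planar_map G D"
    by (simp add: planar_map_def) (simp add: D_def face_walks_def)
  moreover have "connected_map G D"
    using r_into_rtrancl[of _ "dart_step G D"] oo
    unfolding connected_map_eq by (auto simp: darts dart_step_def next_D)
  moreover have "combinatorial_map G D"
    using oo by (auto simp: combinatorial_map_def darts) (auto simp: D_def face_walks_def)
  ultimately show ?thesis
    using d unfolding spherical_def D_def[symmetric] by (auto simp: darts) (auto simp: D_def)
qed

text \<open>A spur adds one edge and, at its free end, one vertex, whose only dart is \<open>opp d\<close>.\<close>

lemma spherical_spur:
  assumes D: "spherical G A (Diagram (u @ v) cs)"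
    and d: "fst d \<notin> ids (u @ v) cs" "label d \<in> A"
  shows "spherical G A (Diagram (u @ [d, opp d] @ v) cs)"
proof (cases "u @ v = []")
  case True
  then show ?thesis
    using D spherical_spur_empty[OF d(2)] by (simp add: spherical_def)
next
  case False
  define D0 where "D0 = Diagram (u @ v) cs"
  define D' where "D' = Diagram (u @ [d, opp d] @ v) cs"
  define w where "w = v @ u"
  define CS where "CS = (\<Union>c\<in>set cs. cyclic_next c)"
  note D' = D[folded D0_def]
  note cl = spherical_closed[OF D[folded D0_def]]
  have oo: "opp (opp d) = d" using d(2) by (rule opp_opp)
  have "fst d \<notin> fst ` darts D0"
    using d by (simp add: ids_def darts_eq D0_def)
  then have dd: "d \<notin> darts D0" "opp d \<notin> darts D0" "fst d \<notin> fst ` darts D0"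
    using opposite_simps(1)[of G d] by (auto simp: image_iff)
  have w: "w \<noteq> []" using False by (auto simp: w_def)
  have wD: "hd w \<in> darts D0" "last w \<in> darts D0"
    using hd_in_set[OF w] last_in_set[OF w] by (auto simp: darts_eq D0_def w_def)
  have old: "face_next D0 = adjacent w \<union> {(last w, hd w)} \<union> CS"
    using cyclic_next_append_commute[of u v] cyclic_next_eq[OF w]
    by (simp add: face_next_eq D0_def w_def CS_def)
  have new: "face_next D' = {(d, opp d), (opp d, hd w), (last w, d)} \<union> adjacent w \<union> CS"
    using cyclic_next_append_commute[of u "[d, opp d] @ v"] cyclic_next_append[of "[d, opp d]" w] w
    by (auto simp: face_next_eq D'_def w_def CS_def)
  have darts': "darts D' = darts D0 \<union> {d, opp d}"
    by (auto simp: darts_eq D'_def D0_def)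
  have invol: "opp (opp x) = x" if "x \<in> darts D'" for x
    using that cl(2)[of x] oo unfolding darts' by (elim UnE insertE) simp_all
  have sub0: "face_next D0 \<subseteq> darts D0 \<times> darts D0" by (rule face_next_subset)
  have comb: "combinatorial_map G D'"
  proof -
    have "distinct (u @ v @ concat cs)" "[] \<notin> set cs"
      using D by (auto simp: spherical_def combinatorial_map_def face_walks_def)
    moreover have "set (u @ v @ concat cs) \<inter> {d, opp d} = {}"
      using dd by (auto simp: darts_eq D0_def)
    ultimately have "distinct (concat (face_walks D'))" "[] \<notin> set (cells D')"
      by (auto simp: D'_def face_walks_def)
    then show ?thesis
      using cl oo by (auto simp: combinatorial_map_def darts')
  qed
  have step1: "(x, y) \<in> dart_step G D'" if "(x, y) \<in> face_next D'" for x y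
    using that by (auto simp: dart_step_def)
  have st: "(last w, d) \<in> dart_step G D'" "(d, opp d) \<in> dart_step G D'"
    "(opp d, hd w) \<in> dart_step G D'"
    by (auto intro!: step1 simp: new)
  have conn: "connected_map G D'"
  proof (rule connected_extend[OF _ darts'])
    show "connected_map G D0" using D' by (simp add: spherical_def)
    fix x y assume "(x, y) \<in> face_next D0"
    then consider "(x, y) \<in> face_next D'" | "x = last w" "y = hd w"
      using old new by auto
    then show "(x, y) \<in> (dart_step G D')\<^sup>*"
    proof cases
      case 1 then show ?thesis using step1 by blast
    next
      case 2 then show ?thesis using st by (meson r_into_rtrancl rtrancl_trans)
    qed
  next
    fix x assume x: "x \<in> {d, opp d}"
    have "(d, hd w) \<in> (dart_step G D')\<^sup>*" "(last w, opp d) \<in> (dart_step G D')\<^sup>*"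
      using st by (meson r_into_rtrancl rtrancl_trans)+
    with x st wD show "\<exists>y\<in>darts D0. (x, y) \<in> (dart_step G D')\<^sup>*"
      "\<exists>y\<in>darts D0. (y, x) \<in> (dart_step G D')\<^sup>*" by blast+
  qed
  obtain f where f: "vertex_labelling G D0 f" using vertex_labelling_exists by blast
  obtain n where n: "n \<notin> f ` darts D0"
    using ex_new_if_finite[of "f ` darts D0"] finite_darts infinite_UNIV_nat by blast
  have f_link: "f x = f y" if "x \<in> darts D0" "(opp x, y) \<in> face_next D0" for x y
    using f that sub0 link_same_origin[of x y G D0] by (auto simp: vertex_labelling_def link_def)
  have link': "(x, y) \<in> same_origin G D'" if "x \<in> darts D'" "(opp x, y) \<in> face_next D'" for x y
    using that link_same_origin[of x y G D'] by (auto simp: link_def)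
  have so_d: "(d, hd w) \<in> same_origin G D'"
    by (rule link') (auto simp: darts' new)
  define r where "r x = (if x = d then hd w else x)" for x
  let ?f = "\<lambda>x. if x = opp d then n else f (r x)"
  have r_id: "r x = x" if "x \<in> darts D0" for x using that dd by (auto simp: r_def)
  have r_D: "r x \<in> darts D0" "(x, r x) \<in> same_origin G D'" if "x \<in> darts D'" "x \<noteq> opp d" for x
    using that so_d wD darts' by (auto simp: r_def)
  have link_f: "?f x = ?f y" if xy: "(x, y) \<in> link G D'" for x y
  proof -
    have xd: "x \<in> darts D'" and xy': "(opp x, y) \<in> face_next D'" using xy by (auto simp: link_def)
    consider "opp x = d" | "opp x = opp d" | "opp x \<in> darts D0"
      using xd cl(1)[of x] oo unfolding darts' by auto
    then show ?thesis
    proof cases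
      case 1
      then have "x = opp d" using invol[OF xd] by simp
      moreover have "y = opp d"
      proof -
        have "(d, y) \<notin> face_next D0" using sub0 dd by blast
        moreover have "d \<noteq> last w" using dd wD by metis
        ultimately show ?thesis using xy' 1 by (auto simp: new old)
      qed
      ultimately show ?thesis by simp
    next
      case 2
      then have "x = d" using invol[OF xd] oo by metis
      moreover have "y = hd w"
      proof -
        have "(opp d, y) \<notin> face_next D0" using sub0 dd by blast
        moreover have "opp d \<noteq> last w" using dd wD by metis
        ultimately show ?thesis using xy' 2 by (auto simp: new old)
      qed
      ultimately show ?thesis using wD dd by (auto simp: r_def)
    next
      case 3
      then have "x \<in> darts D0" using cl(1)[of "opp x"] invol[OF xd] by simp
      then have x: "x \<in> darts D0" "x \<noteq> d" "x \<noteq> opp d" using dd by auto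
      consider "y = d" "opp x = last w" | "(opp x, y) \<in> face_next D0"
        using xy' 3 dd by (auto simp: new old)
      then show ?thesis
      proof cases
        case 1
        then have "f x = f (hd w)" using x by (intro f_link) (auto simp: old)
        then show ?thesis using 1 x by (auto simp: r_def)
      next
        case 2
        then have "f x = f y" "y \<in> darts D0" using x f_link sub0 by auto
        then show ?thesis using x dd by (auto simp: r_def)
      qed
    qed
  qed
  have old_so: "(x, y) \<in> same_origin G D'" if "(x, y) \<in> link G D0" for x y
  proof -
    have x: "x \<in> darts D0" and xy: "(opp x, y) \<in> face_next D0" using that by (auto simp: link_def)
    consider "opp x = last w" "y = hd w" | "(opp x, y) \<in> face_next D'"
      using xy by (auto simp: new old)
    then show ?thesis
    proof cases
      case 1
      then have "(x, d) \<in> same_origin G D'" using x by (intro link') (auto simp: darts' new)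
      then show ?thesis using so_d 1 same_origin_trans by blast
    next
      case 2
      then show ?thesis using x darts' by (intro link') auto
    qed
  qed
  have lab: "vertex_labelling G D' ?f"
    unfolding vertex_labelling_def
  proof (intro ballI iffI)
    fix x y assume xy: "x \<in> darts D'" "y \<in> darts D'" and eq: "?f x = ?f y"
    have "x = opp d \<longleftrightarrow> y = opp d"
      using eq n r_D xy by (metis (no_types, lifting) image_eqI)
    then show "(x, y) \<in> same_origin G D'"
    proof (cases "x = opp d")
      case False
      with \<open>x = opp d \<longleftrightarrow> y = opp d\<close> have "y \<noteq> opp d" by simp
      with False eq have "(r x, r y) \<in> same_origin G D0"
        using f r_D xy by (auto simp: vertex_labelling_def)
      then have "(r x, r y) \<in> same_origin G D'"
        using same_origin_mono[OF old_so] by blast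
      then show ?thesis
        using r_D xy False \<open>y \<noteq> opp d\<close> by (meson same_origin_trans same_origin_sym)
    qed simp
  next
    fix x y assume "(x, y) \<in> same_origin G D'"
    then show "?f x = ?f y"
      using same_origin_respects[where f = ?f] link_f by metis
  qed
  have "?f ` darts D' = insert n (f ` darts D0)"
    using wD dd by (auto simp: darts' r_def image_iff)
  then have "card (?f ` darts D') = Suc (card (f ` darts D0))"
    using n by (simp only: card_insert_disjoint finite_imageI finite_darts not_False_eq_True)
  moreover have "darts D' \<noteq> {}" "darts D0 \<noteq> {}"
    using wD darts' by auto
  ultimately have "num_vertices G D' = Suc (num_vertices G D0)"
    using num_vertices_labelling[OF lab] num_vertices_labelling[OF f] by metis
  moreover have "planar_map G D0" using D' by (simp add: spherical_def)
  ultimately have "planar_map G D'"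
    using card_dart_edges_extend[OF dd(3) d(2) darts']
    by (simp add: planar_map_def) (simp add: face_walks_def D0_def D'_def)
  then show ?thesis
    using comb conn cl d(2) unfolding spherical_def D'_def[symmetric] by (auto simp: darts') (auto simp: D'_def)
qed

lemma spherical_empty: "spherical G A (Diagram [] [])"
  by (simp add: spherical_def combinatorial_map_def connected_map_def planar_map_def darts_eq
      face_walks_def num_vertices_def dart_edges_def)

text \<open>The mirror image of a glued diagram lists its cells in another order than the diagram built from
  the mirror images.\<close>

lemma spherical_permute_cells:
  assumes "spherical G A (Diagram b cs)" "mset cs' = mset cs"
  shows "spherical G A (Diagram b cs')"
proof -
  have s: "set cs' = set cs" using assms(2) using mset_eq_setD by blast
  then have d: "darts (Diagram b cs') = darts (Diagram b cs)" by (simp add: darts_eq)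
  have n: "face_next (Diagram b cs') = face_next (Diagram b cs)" by (simp add: face_next_eq s)
  have "mset (concat xs) = \<Sum>\<^sub># (image_mset mset (mset xs))" for xs :: "'g dart list list"
    by (induction xs) auto
  then have "mset (concat (face_walks (Diagram b cs'))) = mset (concat (face_walks (Diagram b cs)))"
    using assms(2) by (simp add: face_walks_def)
  then have "distinct (concat (face_walks (Diagram b cs'))) = distinct (concat (face_walks (Diagram b cs)))"
    by (rule mset_eq_imp_distinct_iff)
  moreover have "length cs' = length cs" using assms(2) by (rule mset_eq_length)
  ultimately show ?thesis
    using assms(1) s
    unfolding spherical_def combinatorial_map_def connected_map_def planar_map_def num_vertices_def
      vertices_def same_origin_def dart_edges_def d n
    by (auto simp: face_walks_def)
qed

end

section \<open>Diagrams grown from an arc\<close>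

context letters
begin

text \<open>The path \<open>p\<close> traversed backwards; \<open>p @ arc p\<close> is the boundary of a line segment.\<close>

definition arc :: "'g dart list \<Rightarrow> 'g dart list" where
  "arc p = rev (map opp p)"

lemma arc_append [simp]: "arc (p @ q) = arc q @ arc p"
  and arc_Nil [simp]: "arc [] = []"
  and arc_Cons: "arc (d # p) = arc p @ [opp d]"
  and set_arc [simp]: "set (arc p) = opp ` set p"
  and length_arc [simp]: "length (arc p) = length p"
  by (auto simp: arc_def)

lemma arc_arc: "label ` set p \<subseteq> A \<Longrightarrow> arc (arc p) = p"
  by (induction p) (auto simp: arc_Cons opp_opp)

lemma ids_append: "ids (b @ b') cs = ids b cs \<union> ids b' cs"
  by (auto simp: ids_def)

lemma ids_arc [simp]: "ids (arc p) cs = ids p cs"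
  by (auto simp: ids_def image_Un image_image)

lemma ids_darts: "ids (boundary D) (cells D) = fst ` darts D"
  by (simp add: ids_def darts_eq)

text \<open>\<open>grows x t0 cs0 t cs\<close>: the diagram with boundary \<open>x @ t\<close> and cells \<open>cs\<close> arises from the one with
  boundary \<open>x @ t0\<close> and cells \<open>cs0\<close> by attaching spurs and cells, all of them behind the boundary
  path \<open>x\<close>. Any unused identifier may be given to a new edge, so that a construction can be repeated
  inside a larger diagram.\<close>

inductive grows :: "'g dart list \<Rightarrow> 'g dart list \<Rightarrow> 'g dart list list \<Rightarrow>
    'g dart list \<Rightarrow> 'g dart list list \<Rightarrow> bool"
  for x t0 cs0 where
  start: "grows x t0 cs0 t0 cs0"
| permute: "grows x t0 cs0 t cs \<Longrightarrow> mset cs' = mset cs \<Longrightarrow> grows x t0 cs0 t cs'"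
| spur: "\<lbrakk>grows x t0 cs0 (u @ v) cs; fst d \<notin> ids (x @ u @ v) cs; label d \<in> A\<rbrakk>
    \<Longrightarrow> grows x t0 cs0 (u @ [d, opp d] @ v) cs"
| cell: "\<lbrakk>grows x t0 cs0 (u @ q @ v) cs; q \<noteq> []; fst d \<notin> ids (x @ u @ q @ v) cs; label d \<in> A;
      c = q @ [opp d] \<or> c = opp d # q\<rbrakk>
    \<Longrightarrow> grows x t0 cs0 (u @ [d] @ v) (cs @ [c])"

lemma mset_concat_set: "mset cs' = mset cs \<Longrightarrow> set (concat cs') = set (concat cs)"
  using mset_eq_setD[of cs' cs] by auto

lemma grows_trans:
  "grows x t cs t' cs' \<Longrightarrow> grows x t0 cs0 t cs \<Longrightarrow> grows x t0 cs0 t' cs'"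
  by (induction rule: grows.induct) (auto intro: grows.intros simp del: append_Cons append_Nil)

lemma grows_shift:
  "grows (x @ y) t0 cs0 t cs \<Longrightarrow> grows x (y @ t0) cs0 (y @ t) cs"
proof (induction rule: grows.induct)
  case (spur u v cs d)
  then show ?case using grows.spur[of x "y @ t0" cs0 "y @ u" v cs d] by simp
next
  case (cell u q v cs d c)
  then show ?case using grows.cell[of x "y @ t0" cs0 "y @ u" q v cs d c] by simp
qed (auto intro: grows.intros)

lemma grows_spherical:
  assumes "grows x t0 cs0 t cs" "spherical G A (Diagram (x @ t0) cs0)"
  shows "spherical G A (Diagram (x @ t) cs)"
  using assms
proof (induction rule: grows.induct)
  case (permute t cs cs')
  then show ?case using spherical_permute_cells by blast
next
  case (spur u v cs d)
  then show ?case using spherical_spur[of "x @ u" v cs d] by simp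
next
  case (cell u q v cs d c)
  then show ?case using spherical_cell[of "x @ u" q v cs d c] by simp
qed

text \<open>A line segment grows out of a single vertex by spurs at its far end.\<close>

lemma spherical_arc:
  "distinct (map fst p) \<Longrightarrow> label ` set p \<subseteq> A \<Longrightarrow> spherical G A (Diagram (p @ arc p) [])"
proof (induction p rule: rev_induct)
  case Nil
  then show ?case by (simp add: spherical_empty)
next
  case (snoc d p)
  then have "spherical G A (Diagram (p @ arc p) [])" "fst d \<notin> ids (p @ arc p) []"
    by (auto simp: ids_append) (auto simp: ids_def)
  with snoc.prems spherical_spur[of p "arc p" "[]" d] show ?case by (simp add: arc_Cons)
qed

text \<open>Each identifier names a single edge, so that an edge is identified as soon as its number is.\<close>

definition coherent :: "'g dart set \<Rightarrow> bool" where
  "coherent X \<longleftrightarrow> (\<forall>d\<in>X. \<forall>d'\<in>X. fst d = fst d' \<longrightarrow> d' = d \<or> d' = opp d)"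

lemma coherent_extend:
  assumes "coherent X" "fst d \<notin> fst ` X" "label d \<in> A"
  shows "coherent (X \<union> {d, opp d})"
proof -
  have "e' = e \<or> e' = opp e" if "e \<in> X \<union> {d, opp d}" "e' \<in> X \<union> {d, opp d}" "fst e = fst e'" for e e'
  proof (cases "e \<in> X")
    case True
    with that assms(2) have "e' \<in> X" by (metis Un_iff imageI insert_iff opposite_simps(1) singletonD)
    with True that(3) assms(1) show ?thesis by (simp add: coherent_def)
  next
    case False
    with that have e: "e = d \<or> e = opp d" by blast
    then have "e' \<notin> X" using that(3) assms(2) by (metis image_eqI opposite_simps(1))
    with that e opp_opp[OF assms(3)] show ?thesis by (metis Un_iff insertE singletonD)
  qed
  then show ?thesis by (auto simp: coherent_def)
qed

lemma coherent_subset: "coherent X \<Longrightarrow> Y \<subseteq> X \<Longrightarrow> coherent Y"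
  by (auto simp: coherent_def)

lemma grows_coherent:
  assumes "grows x t0 cs0 t cs" "coherent (set (x @ t0) \<union> set (concat cs0))"
  shows "coherent (set (x @ t) \<union> set (concat cs))"
  using assms
proof (induction rule: grows.induct)
  case (permute t cs cs')
  then show ?case by (metis mset_concat_set)
next
  case (spur u v cs d)
  then have "coherent (set (x @ u @ v) \<union> set (concat cs) \<union> {d, opp d})"
    by (intro coherent_extend) (simp_all add: ids_def)
  then show ?case by (rule coherent_subset) auto
next
  case (cell u q v cs d c)
  then have "coherent (set (x @ u @ q @ v) \<union> set (concat cs) \<union> {d, opp d})"
    by (intro coherent_extend) (simp_all add: ids_def)
  then show ?case by (rule coherent_subset) (use cell in auto)
qed

lemma coherent_arc:
  "distinct (map fst p) \<Longrightarrow> label ` set p \<subseteq> A \<Longrightarrow> coherent (set (p @ arc p))"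
proof (induction p)
  case Nil
  then show ?case by (simp add: coherent_def)
next
  case (Cons d p)
  then have "coherent (set (p @ arc p) \<union> {d, opp d})"
    by (intro coherent_extend) (auto simp: image_Un image_image)
  then show ?case by (rule coherent_subset) auto
qed

text \<open>The moves that produce a diagram from the arc \<open>p\<close> see nothing of it but its boundary behind \<open>p\<close>,
  which starts out as \<open>arc p\<close>. They can therefore be repeated on any diagram whose boundary ends with
  \<open>arc p\<close>, provided that the identifiers they introduce are unused there. The outcome is the result of
  gluing along \<open>p\<close>. That the glued path is an arc on one side is essential: along two closed paths,
  gluing could pinch off a sphere.\<close>

lemma grows_replay:
  assumes "grows p (arc p) [] t cs"
    and "(ids (p @ t) cs - ids p []) \<inter> ids (x @ arc p) cs0 = {}"
  shows "grows x (arc p) cs0 t (cs0 @ cs)"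
  using assms
proof (induction rule: grows.induct)
  case start
  then show ?case by (simp add: grows.start)
next
  case (permute t cs cs')
  have "ids (p @ t) cs' = ids (p @ t) cs"
    using mset_concat_set[OF permute.hyps(2)] by (simp add: ids_def)
  then have "grows x (arc p) cs0 t (cs0 @ cs)" using permute by simp
  then show ?case by (rule grows.permute) (simp add: permute.hyps)
next
  case (spur u v cs d)
  have sub: "ids (p @ u @ v) cs \<subseteq> ids (p @ (u @ [d, opp d] @ v)) cs"
    "fst d \<in> ids (p @ (u @ [d, opp d] @ v)) cs"
    by (auto simp: ids_def)
  then have "grows x (arc p) cs0 (u @ v) (cs0 @ cs)" using spur by blast
  moreover have "fst d \<notin> ids p []"
    using spur.hyps(2) by (auto simp: ids_def)
  then have "fst d \<notin> ids (x @ arc p) cs0" using spur.prems sub by blast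
  then have "fst d \<notin> ids (x @ u @ v) (cs0 @ cs)" using spur.hyps(2) by (auto simp: ids_def)
  ultimately show ?case using spur.hyps(3) by (rule grows.spur)
next
  case (cell u q v cs d c)
  have sub: "ids (p @ u @ q @ v) cs \<subseteq> ids (p @ (u @ [d] @ v)) (cs @ [c])"
    "fst d \<in> ids (p @ (u @ [d] @ v)) (cs @ [c])"
    using cell.hyps(5) by (auto simp: ids_def)
  then have "grows x (arc p) cs0 (u @ q @ v) (cs0 @ cs)" using cell by blast
  moreover have "fst d \<notin> ids p []"
    using cell.hyps(3) by (auto simp: ids_def)
  then have "fst d \<notin> ids (x @ arc p) cs0" using cell.prems sub by blast
  then have "fst d \<notin> ids (x @ u @ q @ v) (cs0 @ cs)" using cell.hyps(3) by (auto simp: ids_def)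
  ultimately show ?case
    using grows.cell[of x "arc p" cs0 u q v "cs0 @ cs" d c] cell.hyps by simp
qed

text \<open>Injectivity is asked of the identifiers, not of the darts: an identifier that is unused before a
  move has to stay unused after renaming.\<close>

definition relabelling :: "('g dart \<Rightarrow> 'g dart) \<Rightarrow> 'g dart set \<Rightarrow> bool" where
  "relabelling f X \<longleftrightarrow> (\<forall>d\<in>X. label (f d) = label d \<and> f (opp d) = opp (f d)) \<and>
     (\<forall>d\<in>X. \<forall>d'\<in>X. fst (f d) = fst (f d') \<longrightarrow> fst d = fst d')"

lemma relabellingD:
  assumes "relabelling f X" "d \<in> X"
  shows "label (f d) = label d" "f (opp d) = opp (f d)"
    "d' \<in> X \<Longrightarrow> fst (f d) = fst (f d') \<Longrightarrow> fst d = fst d'"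
  using assms unfolding relabelling_def by blast+

lemma relabelling_subset: "relabelling f X \<Longrightarrow> Y \<subseteq> X \<Longrightarrow> relabelling f Y"
  unfolding relabelling_def by blast

lemma relabelling_arc: "relabelling f X \<Longrightarrow> set p \<subseteq> X \<Longrightarrow> map f (arc p) = arc (map f p)"
  by (induction p) (auto simp: arc_Cons relabellingD(2))

lemma relabelling_fresh:
  assumes "relabelling f X" "fst d \<notin> ids b cs" "d \<in> X" "set b \<union> set (concat cs) \<subseteq> X"
  shows "fst (f d) \<notin> ids (map f b) (map (map f) cs)"
proof
  assume "fst (f d) \<in> ids (map f b) (map (map f) cs)"
  then have "fst (f d) \<in> fst ` f ` (set b \<union> set (concat cs))"
    by (simp only: ids_def set_map map_concat[symmetric] image_Un)
  then obtain e where "e \<in> set b \<union> set (concat cs)" "fst (f d) = fst (f e)"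
    by blast
  with assms have "fst d = fst e" using relabellingD(3)[of f X d e] by blast
  with \<open>e \<in> _\<close> assms(2) show False unfolding ids_def by blast
qed

lemma grows_map:
  assumes "grows x t0 cs0 t cs" "relabelling f (set (x @ t) \<union> set (concat cs))"
  shows "grows (map f x) (map f t0) (map (map f) cs0) (map f t) (map (map f) cs)"
  using assms
proof (induction rule: grows.induct)
  case start
  show ?case by (rule grows.start)
next
  case (permute t cs cs')
  then have "grows (map f x) (map f t0) (map (map f) cs0) (map f t) (map (map f) cs)"
    by (metis mset_concat_set)
  then show ?case by (rule grows.permute) (simp add: permute.hyps)
next
  case (spur u v cs d)
  have "grows (map f x) (map f t0) (map (map f) cs0) (map f u @ map f v) (map (map f) cs)"
  proof -
    have "relabelling f (set (x @ u @ v) \<union> set (concat cs))"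
      by (rule relabelling_subset[OF spur.prems]) auto
    then show ?thesis using spur.IH by simp
  qed
  moreover have "fst (f d) \<notin> ids (map f (x @ u @ v)) (map (map f) cs)"
    using spur.hyps by (intro relabelling_fresh[OF spur.prems]) auto
  moreover have "label (f d) = label d" "f (opp d) = opp (f d)"
    using spur.prems by (auto simp: relabelling_def)
  ultimately show ?case
    using grows.spur[of "map f x" "map f t0" "map (map f) cs0" "map f u" "map f v" "map (map f) cs" "f d"] spur.hyps
    by simp
next
  case (cell u q v cs d c)
  have sub: "set (x @ u @ q @ v) \<union> set (concat cs) \<union> {d, opp d} \<subseteq> set (x @ u @ [d] @ v) \<union> set (concat (cs @ [c]))"
    using cell.hyps(5) by auto
  have "relabelling f (set (x @ u @ q @ v) \<union> set (concat cs))"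
    by (rule relabelling_subset[OF cell.prems]) (use sub in blast)
  then have "grows (map f x) (map f t0) (map (map f) cs0) (map f u @ map f q @ map f v) (map (map f) cs)"
    using cell.IH by simp
  moreover have "fst (f d) \<notin> ids (map f (x @ u @ q @ v)) (map (map f) cs)"
    using cell.hyps sub by (intro relabelling_fresh[OF cell.prems]) auto
  moreover have "label (f d) = label d" "f (opp d) = opp (f d)"
    using cell.prems by (auto simp: relabelling_def)
  ultimately show ?case
    using grows.cell[of "map f x" "map f t0" "map (map f) cs0" "map f u" "map f q" "map f v" "map (map f) cs" "f d" "map f c"] cell.hyps
    by auto
qed

text \<open>This certifies that a diagram is planar and contractible, and moreover that it can be glued to any
  diagram along \<open>p\<close>.\<close>

definition grown_from :: "'g dart list \<Rightarrow> 'g diagram \<Rightarrow> bool" where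
  "grown_from p D \<longleftrightarrow> distinct (map fst p) \<and> label ` set p \<subseteq> A \<and>
     (\<exists>t. boundary D = p @ t \<and> grows p (arc p) [] t (cells D))"

lemma grown_from_spherical: "grown_from p D \<Longrightarrow> spherical G A D"
  unfolding grown_from_def using grows_spherical spherical_arc by (metis diagram.collapse)

lemma grown_from_coherent: "grown_from p D \<Longrightarrow> coherent (darts D)"
  unfolding grown_from_def darts_eq using grows_coherent[of p "arc p" "[]"] coherent_arc[of p] by auto

lemma grown_from_permute:
  "grown_from p (Diagram b cs) \<Longrightarrow> mset cs' = mset cs \<Longrightarrow> grown_from p (Diagram b cs')"
  by (auto simp: grown_from_def intro: grows.permute)

lemma grown_from_map:
  assumes "grown_from p D" "relabelling f (darts D)"
  shows "grown_from (map f p) (map_darts f D)"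
proof -
  obtain t where t: "boundary D = p @ t" "grows p (arc p) [] t (cells D)"
    and p: "distinct (map fst p)" "label ` set p \<subseteq> A"
    using assms(1) by (auto simp: grown_from_def)
  have pD: "set p \<subseteq> darts D" using t by (auto simp: darts_eq)
  have "grows (map f p) (map f (arc p)) [] (map f t) (map (map f) (cells D))"
    using grows_map[OF t(2), of f] assms(2) by (simp add: darts_eq t Un_assoc)
  moreover have "map f (arc p) = arc (map f p)" by (rule relabelling_arc[OF assms(2) pD])
  moreover have "label ` set (map f p) \<subseteq> A"
    using p(2) pD assms(2) by (auto simp: relabelling_def subset_iff)
  moreover have "distinct (map fst (map f p))"
  proof -
    have "inj_on fst (set p)" "distinct p" using p(1) by (auto simp: distinct_map)
    then have "inj_on (\<lambda>d. fst (f d)) (set p)"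
      using relabellingD(3)[OF assms(2)] pD by (meson inj_onD inj_onI subset_iff)
    with \<open>distinct p\<close> show "distinct (map fst (map f p))" by (simp add: distinct_map o_def inj_on_def)
  qed
  ultimately show ?thesis by (simp add: grown_from_def map_darts_def t)
qed

text \<open>A replay on \<open>D1\<close> that does not touch its boundary path \<open>x\<close> does not touch \<open>p0\<close> either, so it can be
  appended to the moves that produce \<open>D1\<close> from \<open>p0\<close>.\<close>

lemma grown_from_amalgamate:
  assumes D1: "grown_from p0 D1" "boundary D1 = x @ arc p" "length p0 \<le> length x"
    and D2: "grown_from p D2" "boundary D2 = p @ t"
    and disj: "(ids (boundary D2) (cells D2) - ids p []) \<inter> ids (boundary D1) (cells D1) = {}"
  shows "grown_from p0 (Diagram (x @ t) (cells D1 @ cells D2))"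
proof -
  obtain t1 where t1: "boundary D1 = p0 @ t1" "grows p0 (arc p0) [] t1 (cells D1)"
    and p0: "distinct (map fst p0)" "label ` set p0 \<subseteq> A"
    using D1(1) by (auto simp: grown_from_def)
  obtain x' where x': "x = p0 @ x'" "t1 = x' @ arc p"
    using t1(1) D1(2,3) by (auto simp: append_eq_append_conv2)
  have "grows p (arc p) [] t (cells D2)"
    using D2 by (auto simp: grown_from_def)
  then have "grows x (arc p) (cells D1) t (cells D1 @ cells D2)"
    using disj unfolding D1(2) D2(2) by (rule grows_replay)
  then have "grows p0 t1 (cells D1) (x' @ t) (cells D1 @ cells D2)"
    unfolding x' by (rule grows_shift)
  then have "grows p0 (arc p0) [] (x' @ t) (cells D1 @ cells D2)"
    using t1(2) by (rule grows_trans)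
  then show ?thesis using p0 by (simp add: grown_from_def x')
qed

end

section \<open>Gluing, mirror images and strips\<close>

lemma fresh_greater: "d \<in> darts D \<Longrightarrow> fst d < fresh D"
proof -
  have "d \<in> set xs \<Longrightarrow> fst d < foldr (\<lambda>d m. max (Suc (fst d)) m) xs 0" for xs :: "'a dart list"
    by (induction xs) (auto simp: less_max_iff_disj)
  then show "d \<in> darts D \<Longrightarrow> fst d < fresh D"
    by (simp add: fresh_def darts_def)
qed

context letters
begin

text \<open>The renaming \<open>f\<close> is the shift that makes the second diagram disjoint from the first, followed by
  the identification of \<open>p2\<close> with \<open>p\<close>. It is injective on edges because \<open>p\<close> has no repeated edge and
  all identifiers of the first diagram are smaller than the shifted ones.\<close>

lemma glue_relabelling:
  assumes D1: "boundary D1 = x @ arc p" and p: "distinct (map fst p)" "label ` set p \<subseteq> A"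
    and D2: "boundary D2 = p2 @ t2" "spherical G A D2" "coherent (darts D2)"
    and p2: "distinct (map fst p2)" "map label p2 = map label p"
  obtains f where "relabelling f (darts D2)" "map f p2 = p"
    "\<And>d. d \<in> darts D2 \<Longrightarrow> fst (f d) \<in> ids p [] \<union> {fresh D1..}"
    "\<And>d. d \<in> darts D2 \<Longrightarrow> fst d \<notin> ids p2 [] \<Longrightarrow> fresh D1 \<le> fst (f d)"
    "glue G (length p) D1 D2 = Diagram (x @ map f t2) (cells D1 @ map (map f) (cells D2))"
proof -
  define sh :: "'g dart \<Rightarrow> 'g dart" where "sh = (\<lambda>(k, b, a). (fresh D1 + k, b, a))"
  define p' where "p' = map sh p2"
  define ident where "ident = map_of (zip p' p @ zip (map opp p') (map opp p))"
  define s where "s = (\<lambda>d. case ident d of None \<Rightarrow> d | Some d' \<Rightarrow> d')"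
  define f where "f d = s (sh d)" for d
  have len: "length p2 = length p" using p2(2) map_eq_imp_length_eq by blast
  have sh: "sh (opp d) = opp (sh d)" "label (sh d) = label d" "fst (sh d) = fresh D1 + fst d" for d
    by (auto simp: sh_def opposite_def label_def split: prod.splits)
  have p'_ids: "map fst p' = map ((+) (fresh D1)) (map fst p2)"
    by (simp add: p'_def sh)
  have dist: "distinct (map fst p')"
    unfolding p'_ids using p2(1) by (simp add: distinct_map inj_on_def)
  then have dist': "distinct p'" "distinct (map opp p')"
    by (simp_all add: distinct_map inj_on_def) (metis opposite_simps(1))
  have p_fresh: "fst d < fresh D1" if "d \<in> set p" for d
    using fresh_greater[of "opp d" D1] that D1 by (auto simp: darts_eq)
  have f_in: "f (p2 ! i) = p ! i" if "i < length p" for i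
  proof -
    have "map_of (zip p' p) (p' ! i) = Some (p ! i)"
      using that len dist' by (intro map_of_zip_nth) (auto simp: p'_def)
    then show ?thesis using that len by (simp add: f_def s_def ident_def p'_def map_add_def)
  qed
  have f_opp: "f (opp (p2 ! i)) = opp (p ! i)" if "i < length p" for i
  proof -
    have i: "p' ! i = sh (p2 ! i)" "p' ! i \<in> set p'" using that len by (auto simp: p'_def)
    have "opp (p' ! i) \<notin> set p'"
    proof
      assume "opp (p' ! i) \<in> set p'"
      moreover have "inj_on fst (set p')" using dist by (simp add: distinct_map)
      ultimately show False using i(2) by (metis inj_onD opposite_simps(1,3))
    qed
    then have none: "map_of (zip p' p) (opp (p' ! i)) = None"
      using len by (auto simp: map_of_eq_None_iff p'_def dest: set_zip_leftD)
    have "map_of (zip (map opp p') (map opp p)) (map opp p' ! i) = Some (map opp p ! i)"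
      using that len dist' by (intro map_of_zip_nth) (auto simp: p'_def)
    moreover have "length p' = length p" using len by (simp add: p'_def)
    ultimately have "map_of (zip (map opp p') (map opp p)) (opp (p' ! i)) = Some (opp (p ! i))"
      using that by simp
    with none have "ident (opp (p' ! i)) = Some (opp (p ! i))"
      unfolding ident_def map_of_append map_add_def by (simp only: option.case)
    then show ?thesis by (simp add: f_def s_def sh(1) flip: i(1))
  qed
  have f_out: "f d = sh d" if "fst d \<notin> ids p2 []" for d
  proof -
    have "fst (sh d) \<notin> fst ` set p'"
      using that by (auto simp: p'_def sh ids_def image_iff)
    then have "sh d \<notin> set p'" "sh d \<notin> opp ` set p'"
      using opposite_simps(1)[of G] by (blast, force)
    then have "ident (sh d) = None"
      by (auto simp: ident_def map_of_eq_None_iff dest: set_zip_leftD)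
    then show ?thesis by (simp add: f_def s_def)
  qed
  have p2D: "set p2 \<subseteq> darts D2" using D2(1) by (auto simp: darts_eq)
  have p_ids: "fst (p ! i) \<in> ids p []" if "i < length p" for i using that by (auto simp: ids_def)
  have p_lab: "label (p ! i) \<in> A" "label (p2 ! i) = label (p ! i)" if "i < length p" for i
    using that p(2) nth_mem[OF that] p2(2) len by (auto simp: image_subset_iff) (metis nth_map)
  have lab2: "label (p2 ! i) \<in> A" if "i < length p" for i
    using p_lab[OF that] by simp
  have cases: "fst d \<notin> ids p2 [] \<or> (\<exists>i<length p. d = p2 ! i \<or> d = opp (p2 ! i))" if "d \<in> darts D2" for d
  proof (cases "fst d \<in> ids p2 []")
    case True
    then obtain i where "i < length p" "fst (p2 ! i) = fst d"
      using len by (auto simp: ids_def in_set_conv_nth)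
    moreover from this have "p2 ! i \<in> darts D2" using p2D len by auto
    ultimately have "d = p2 ! i \<or> d = opp (p2 ! i)"
      using D2(3) that unfolding coherent_def by blast
    with \<open>i < length p\<close> show ?thesis by blast
  qed simp
  have rel1: "label (f d) = label d \<and> f (opp d) = opp (f d)" if d: "d \<in> darts D2" for d
  proof -
    consider "fst d \<notin> ids p2 []" | i where "i < length p" "d = p2 ! i" | i where "i < length p" "d = opp (p2 ! i)"
      using cases[OF d] by blast
    then show ?thesis
    proof cases
      case 1 then show ?thesis by (simp add: f_out sh)
    next
      case 2 then show ?thesis by (simp add: f_in f_opp p_lab)
    next
      case 3 then show ?thesis by (simp add: f_in f_opp p_lab lab2 opp_opp)
    qed
  qed
  have f_fst: "(fst d \<notin> ids p2 [] \<and> fst (f d) = fresh D1 + fst d) \<or>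
      (\<exists>i<length p. fst d = fst (p2 ! i) \<and> fst (f d) = fst (p ! i))" if d: "d \<in> darts D2" for d
  proof (cases "fst d \<in> ids p2 []")
    case True
    then obtain i where "i < length p" "d = p2 ! i \<or> d = opp (p2 ! i)" using cases[OF d] by blast
    then have "i < length p \<and> fst d = fst (p2 ! i) \<and> fst (f d) = fst (p ! i)"
      by (auto simp: f_in f_opp)
    then show ?thesis by blast
  qed (simp add: f_out sh)
  have rel2: "fst d = fst d'" if d: "d \<in> darts D2" "d' \<in> darts D2" "fst (f d) = fst (f d')" for d d'
  proof -
    have "i = j" if "i < length p" "j < length p" "fst (p ! i) = fst (p ! j)" for i j
      using that p(1) nth_eq_iff_index_eq[of "map fst p" i j] by simp
    moreover have "fst (p ! i) < fresh D1" if "i < length p" for i using p_fresh that by simp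
    ultimately show ?thesis using f_fst[OF d(1)] f_fst[OF d(2)] d(3)
      by (metis add_left_cancel not_add_less1)
  qed
  show thesis
  proof (rule that[of f])
    show "relabelling f (darts D2)" using rel1 rel2 unfolding relabelling_def by blast
    show "map f p2 = p" using f_in len by (auto intro: nth_equalityI)
    show "fst (f d) \<in> ids p [] \<union> {fresh D1..}" if "d \<in> darts D2" for d
      using f_fst[OF that] p_ids by auto
    show "fresh D1 \<le> fst (f d)" if "d \<in> darts D2" "fst d \<notin> ids p2 []" for d
      using f_out[OF that(2)] by (simp add: sh)
    have m: "length (boundary D1) - length p = length x" by (simp add: D1)
    have pp: "rev (map opp (drop (length x) (boundary D1))) = p"
      using arc_arc[OF p(2)] by (simp add: D1 arc_def)
    have bd: "boundary (map_darts sh D2) = p' @ map sh t2" "cells (map_darts sh D2) = map (map sh) (cells D2)"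
      by (simp_all add: map_darts_def D2(1) p'_def)
    have tk: "take (length p) (boundary (map_darts sh D2)) = p'"
      "drop (length p) (boundary (map_darts sh D2)) = map sh t2"
      using len by (simp_all add: bd(1)) (simp_all add: p'_def)
    have "map s (map sh ds) = map f ds" for ds by (simp add: f_def)
    then show "glue G (length p) D1 D2 = Diagram (x @ map f t2) (cells D1 @ map (map f) (cells D2))"
      unfolding glue_def Let_def m pp sh_def[symmetric] tk ident_def[symmetric] s_def[symmetric] bd(2)
      by (simp add: D1)
  qed
qed

lemma mirror_eq: "mirror G D = Diagram (arc (boundary D)) (map arc (cells D))"
  by (simp add: mirror_def arc_def)

lemma darts_mirror:
  assumes "spherical G A D" shows "darts (mirror G D) = darts D"
proof -
  have "darts (mirror G D) = opp ` darts D"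
    by (auto simp: mirror_eq darts_eq)
  also have "\<dots> = darts D"
    using spherical_closed[OF assms] by (metis image_subset_iff imageI subset_antisym subsetI)
  finally show ?thesis .
qed

lemma mirror_mirror:
  assumes "spherical G A D" shows "mirror G (mirror G D) = D"
proof -
  have "label ` set b \<subseteq> A" if "b = boundary D \<or> b \<in> set (cells D)" for b
    using spherical_closed(3)[OF assms] that by (auto simp: darts_eq)
  then show ?thesis by (intro diagram.expand) (simp add: mirror_eq arc_arc map_idI)
qed

text \<open>The invariant of the recursion. The boundary reads $y v z^{-1}$, and the diagram can be rebuilt from
  the arc labeled \<open>y\<close> at its beginning as well as, seen in a mirror, from the arc labeled \<open>z\<close> at its
  end. The two ends are needed because in the seashell some diagrams are replaced by their mirror
  images, which exchanges the ends.\<close>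

definition strip :: "'g diagram \<Rightarrow> 'g list \<Rightarrow> 'g list \<Rightarrow> 'g list \<Rightarrow> 'g list set \<Rightarrow> bool" where
  "strip D y v z R \<longleftrightarrow> (\<exists>a q b. boundary D = a @ q @ arc b \<and>
     map label a = y \<and> map label q = v \<and> map label b = z \<and>
     grown_from a D \<and> grown_from b (mirror G D) \<and> (\<forall>c\<in>set (cells D). map label c \<in> R))"

lemma stripI:
  assumes "boundary D = a @ q @ arc b" "map label a = y" "map label q = v" "map label b = z"
    "grown_from a D" "grown_from b (mirror G D)" "\<And>c. c \<in> set (cells D) \<Longrightarrow> map label c \<in> R"
  shows "strip D y v z R"
  using assms unfolding strip_def by blast

lemma map_label_arc: "map label (arc p) = inv_word G (map label p)"
  by (simp add: arc_def inv_word_def rev_map)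

lemma strip_van_kampen:
  assumes "strip D y v z R"
  shows "van_kampen_diagram G A R (y @ v @ inv_word G z) D"
  using assms grown_from_spherical
  by (auto simp: strip_def van_kampen_diagram_def spherical_def map_label_arc)

lemma strip_mirror:
  assumes D: "strip D y v z R" and R: "\<And>w. w \<in> R \<Longrightarrow> inv_word G w \<in> R"
  shows "strip (mirror G D) z (inv_word G v) y R"
proof -
  obtain a q b where D': "boundary D = a @ q @ arc b" "map label a = y" "map label q = v"
    "map label b = z" "grown_from a D" "grown_from b (mirror G D)" "\<forall>c\<in>set (cells D). map label c \<in> R"
    using D by (auto simp: strip_def)
  have "spherical G A D" using D'(5) by (rule grown_from_spherical)
  then have m: "mirror G (mirror G D) = D" by (rule mirror_mirror)
  have "label ` set b \<subseteq> A" using D'(6) by (simp add: grown_from_def)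
  then have "boundary (mirror G D) = b @ arc q @ arc a"
    by (simp add: mirror_eq D'(1) arc_arc)
  then show ?thesis
  proof (rule stripI)
    show "grown_from b (mirror G D)" "grown_from a (mirror G (mirror G D))"
      using D' by (simp_all add: m)
  qed (use D' R in \<open>auto simp: map_label_arc mirror_eq\<close>)
qed

text \<open>Along the common arc, each of the two diagrams can be replayed on the other, up to a renaming of
  edges. Replaying the second on the first shows that the glued diagram is grown from its beginning;
  in the mirror, replaying the first on the second shows that it is grown from its end.\<close>

lemma strip_glue:
  assumes "strip D1 y v z R" "strip D2 z w z' R"
  shows "strip (glue G (length z) D1 D2) y (v @ w) z' R"
proof -
  obtain a q p where D1: "boundary D1 = a @ q @ arc p" "map label a = y" "map label q = v"
    "map label p = z" "grown_from a D1" "grown_from p (mirror G D1)" "\<forall>c\<in>set (cells D1). map label c \<in> R"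
    using assms(1) by (auto simp: strip_def)
  obtain p2 q2 b where D2: "boundary D2 = p2 @ q2 @ arc b" "map label p2 = z" "map label q2 = w"
    "map label b = z'" "grown_from p2 D2" "grown_from b (mirror G D2)" "\<forall>c\<in>set (cells D2). map label c \<in> R"
    using assms(2) by (auto simp: strip_def)
  have s1: "spherical G A D1" and s2: "spherical G A D2"
    using D1(5) D2(5) grown_from_spherical by blast+
  have p: "distinct (map fst p)" "label ` set p \<subseteq> A" and p2: "distinct (map fst p2)"
    using D1(6) D2(5) by (auto simp: grown_from_def)
  have lb: "label ` set b \<subseteq> A" using D2(6) by (simp add: grown_from_def)
  have len: "length z = length p" using D1(4) by auto
  obtain f where f: "relabelling f (darts D2)" "map f p2 = p"
    and f_ids: "\<And>d. d \<in> darts D2 \<Longrightarrow> fst (f d) \<in> ids p [] \<union> {fresh D1..}"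
      "\<And>d. d \<in> darts D2 \<Longrightarrow> fst d \<notin> ids p2 [] \<Longrightarrow> fresh D1 \<le> fst (f d)"
    and gl: "glue G (length p) D1 D2 = Diagram ((a @ q) @ map f (q2 @ arc b)) (cells D1 @ map (map f) (cells D2))"
    by (rule glue_relabelling[of D1 "a @ q" p D2 p2 "q2 @ arc b"])
      (use D1(1,4) D2(1,2) p p2 s2 grown_from_coherent[OF D2(5)] in auto)
  define D where "D = glue G (length z) D1 D2"
  have D: "D = Diagram (a @ q @ map f q2 @ map f (arc b)) (cells D1 @ map (map f) (cells D2))"
    using gl len by (simp add: D_def)
  have D2_sub: "set q2 \<subseteq> darts D2" "opp ` set b \<subseteq> darts D2" "\<And>c. c \<in> set (cells D2) \<Longrightarrow> set c \<subseteq> darts D2"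
    "set p2 \<subseteq> darts D2"
    by (auto simp: darts_eq D2(1))
  have b_sub: "set b \<subseteq> darts D2"
  proof
    fix d assume "d \<in> set b"
    then have "opp (opp d) \<in> darts D2" using D2_sub spherical_closed[OF s2] by blast
    with \<open>d \<in> set b\<close> lb show "d \<in> darts D2" using opp_opp by (metis image_subset_iff)
  qed
  have f_arc: "map f (arc r) = arc (map f r)" if "set r \<subseteq> darts D2" for r
    using relabelling_arc[OF f(1) that] .
  have ids1: "ids (boundary D1) (cells D1) \<subseteq> {..<fresh D1}"
    unfolding ids_darts using fresh_greater[of _ D1] by auto
  have p_lt: "ids p [] \<subseteq> ids (boundary D1) (cells D1)"
    using D1(1) by (auto simp: ids_def image_Un image_image)
  have ids2: "fst ` f ` darts D2 \<subseteq> ids p [] \<union> {fresh D1..}"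
    using f_ids(1) by blast
  have disj: False
    if "k \<notin> ids p []" "k \<in> fst ` f ` darts D2" "k \<in> ids (boundary D1) (cells D1)" for k
  proof -
    have "k \<in> {fresh D1..}" "k \<in> {..<fresh D1}" using that ids1 ids2 by blast+
    then show False by simp
  qed
  have lab_f: "map label (map f r) = map label r" if "set r \<subseteq> darts D2" for r
    using that relabellingD(1)[OF f(1)] by auto
  have left: "grown_from a D"
  proof -
    have "grown_from p (map_darts f D2)" using grown_from_map[OF D2(5) f(1)] f(2) by simp
    moreover have "boundary (map_darts f D2) = p @ map f (q2 @ arc b)"
      using D2(1) f(2) by (simp add: map_darts_def)
    moreover have "(ids (boundary (map_darts f D2)) (cells (map_darts f D2)) - ids p []) \<inter> ids (boundary D1) (cells D1) = {}"
    proof -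
      have "darts (map_darts f D2) = f ` darts D2"
        by (auto simp: map_darts_def darts_eq)
      then have "ids (boundary (map_darts f D2)) (cells (map_darts f D2)) = fst ` f ` darts D2"
        by (simp only: ids_darts)
      then show ?thesis using disj by blast
    qed
    ultimately have "grown_from a (Diagram ((a @ q) @ map f (q2 @ arc b)) (cells D1 @ cells (map_darts f D2)))"
      using D1(1,5) by (intro grown_from_amalgamate[where p = p]) auto
    then show ?thesis by (simp add: D map_darts_def)
  qed
  have right: "grown_from (map f b) (mirror G D)"
  proof -
    define M1 where "M1 = mirror G D1"
    define M2 where "M2 = map_darts f (mirror G D2)"
    have rel: "relabelling f (darts (mirror G D2))" using f(1) darts_mirror[OF s2] by simp
    have 1: "grown_from (map f b) M2"
      unfolding M2_def by (rule grown_from_map[OF D2(6) rel])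
    have 2: "boundary M2 = arc (map f (q2 @ arc b)) @ arc p"
      using f_arc[of "p2 @ q2 @ arc b"] D2_sub f(2)
      by (simp add: M2_def map_darts_def mirror_eq D2(1) del: arc_append) (simp flip: arc_append)
    have 3: "boundary M1 = p @ arc (a @ q)"
      using arc_arc[OF p(2)] by (simp add: M1_def mirror_eq D1(1))
    have "ids (boundary M1) (cells M1) = ids (boundary D1) (cells D1)"
      unfolding ids_darts M1_def using darts_mirror[OF s1] by simp
    moreover have "ids (boundary M2) (cells M2) = fst ` f ` darts D2"
      unfolding ids_darts M2_def darts_mirror[OF s2, symmetric] by (auto simp: map_darts_def darts_eq image_iff)
    ultimately have 4: "(ids (boundary M1) (cells M1) - ids p []) \<inter> ids (boundary M2) (cells M2) = {}"
      using disj by blast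
    have 5: "grown_from (map f b) (Diagram (arc (map f (q2 @ arc b)) @ arc (a @ q)) (cells M2 @ cells M1))"
      using 1 2 D1(6)[folded M1_def] 3 4
      by (intro grown_from_amalgamate[where p = p]) auto
    have "map (map f) (map arc (cells D2)) = map arc (map (map f) (cells D2))"
      using f_arc D2_sub by simp
    moreover have "cells M2 = map (map f) (map arc (cells D2))" "cells M1 = map arc (cells D1)"
      "cells D = cells D1 @ map (map f) (cells D2)"
      by (simp_all add: M1_def M2_def map_darts_def mirror_eq D)
    ultimately have "mset (map arc (cells D)) = mset (cells M2 @ cells M1)"
      by (simp only: map_append mset_append add.commute)
    \<comment> \<open>The replay lists the cells of the second diagram first.\<close>
    with 5 have "grown_from (map f b) (Diagram (arc (map f (q2 @ arc b)) @ arc (a @ q)) (map arc (cells D)))"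
      by (rule grown_from_permute)
    then show ?thesis by (simp add: D mirror_eq)
  qed
  have "boundary D = a @ (q @ map f q2) @ arc (map f b)"
    using f_arc[OF b_sub] by (simp add: D)
  moreover have "\<forall>c\<in>set (cells D). map label c \<in> R"
  proof -
    have "map label (map f c) \<in> R" if "c \<in> set (cells D2)" for c
      using that D2(7) lab_f[OF D2_sub(3)[OF that]] by metis
    then show ?thesis using D1(7) unfolding D by auto
  qed
  moreover have "map label (q @ map f q2) = v @ w" "map label (map f b) = z'"
    using lab_f[OF D2_sub(1)] lab_f[OF b_sub] D1(3) D2(3,4) by auto
  ultimately show ?thesis
    unfolding strip_def D_def[symmetric] using left right D1(2) by blast
qed

text \<open>The new edge replaces a path strictly between the two arcs, so the cell is one more move for either
  of the two ways to build the diagram. In the mirror it is listed from its other end.\<close>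

lemma strip_attach_cell:
  assumes "strip D y v z R" "v \<noteq> []" "v @ [inv\<^bsub>G\<^esub> l] \<in> R" "l \<in> A"
  shows "strip (attach_cell G (length y) (length v) l D) y [l] z R"
proof -
  obtain a q b where D: "boundary D = a @ q @ arc b" "map label a = y" "map label q = v"
    "map label b = z" "grown_from a D" "grown_from b (mirror G D)" "\<forall>c\<in>set (cells D). map label c \<in> R"
    using assms(1) by (auto simp: strip_def)
  define d where "d = (fresh D, True, l)"
  have d: "label d = l" "fst d = fresh D" by (auto simp: d_def label_def)
  have oo: "opp (opp d) = d" using d assms(4) opp_opp by metis
  define D' where "D' = Diagram (a @ [d] @ arc b) (cells D @ [q @ [opp d]])"
  have len: "length y = length a" "length v = length q" using D by auto
  have at: "attach_cell G (length y) (length v) l D = D'"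
    by (simp add: attach_cell_def D'_def Let_def D(1) len flip: d_def)
  have new: "fst d \<notin> ids (boundary D) (cells D)"
    unfolding ids_darts d(2) using fresh_greater[of _ D] by (metis imageE less_irrefl)
  have q: "q \<noteq> []" using D(3) assms(2) by auto
  have "grows a (arc a) [] (q @ arc b) (cells D)"
    using D(1,5) by (auto simp: grown_from_def)
  then have "grows a (arc a) [] ([] @ [d] @ arc b) (cells D @ [q @ [opp d]])"
    using q new d assms(4) by (intro grows.cell[where q = q]) (auto simp: D(1))
  then have left: "grown_from a D'"
    using D(5) by (simp add: D'_def grown_from_def)
  have lb: "label ` set b \<subseteq> A" using D(6) by (simp add: grown_from_def)
  have bM: "boundary (mirror G D) = b @ arc q @ arc a"
    using arc_arc[OF lb] by (simp add: mirror_eq D(1))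
  then have "grows b (arc b) [] (arc q @ arc a) (cells (mirror G D))"
    using D(6) by (auto simp: grown_from_def)
  moreover have "fst (opp d) \<notin> ids (b @ [] @ arc q @ arc a) (cells (mirror G D))"
  proof -
    have "ids (boundary (mirror G D)) (cells (mirror G D)) = ids (boundary D) (cells D)"
      unfolding ids_darts using darts_mirror grown_from_spherical[OF D(5)] by metis
    then show ?thesis using new unfolding bM by simp
  qed
  ultimately have "grows b (arc b) [] ([] @ [opp d] @ arc a) (cells (mirror G D) @ [opp (opp d) # arc q])"
    using q d assms(4) by (intro grows.cell[where q = "arc q"]) (auto simp: arc_def)
  moreover have "mirror G D' = Diagram (b @ [opp d] @ arc a) (cells (mirror G D) @ [opp (opp d) # arc q])"
    using arc_arc[OF lb] by (simp add: mirror_eq D'_def arc_Cons)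
  ultimately have right: "grown_from b (mirror G D')"
    using D(6) by (simp add: grown_from_def)
  show ?thesis unfolding at
  proof (rule stripI[of D' a "[d]" b])
    show "grown_from a D'" "grown_from b (mirror G D')" by fact+
  qed (use D assms(3) d in \<open>auto simp: D'_def\<close>)
qed

text \<open>A segment is its own mirror image. It is the arc of its own label, and one spur longer than the
  arc without the last edge.\<close>

lemma strip_segment:
  assumes "set y \<subseteq> A" "a \<in> A"
  shows "strip (segment G (y @ [a])) y [a] (y @ [a]) R"
    and "strip (segment G (y @ [a])) (y @ [a]) [inv\<^bsub>G\<^esub> a] y R"
proof -
  define p where "p = map (\<lambda>i. (i, True, y ! i)) [0..<length y]"
  define d where "d = (length y, True, a)"
  have P: "map (\<lambda>i. (i, True, (y @ [a]) ! i)) [0..<length (y @ [a])] = p @ [d]"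
    by (simp add: p_def d_def nth_append)
  have lab: "map label p = y" "label d = a"
    by (auto simp: p_def d_def label_def o_def map_nth)
  have ids: "map fst (p @ [d]) = [0..<Suc (length y)]"
    by (simp add: p_def d_def o_def)
  have dist: "distinct (map fst (p @ [d]))" unfolding ids by simp
  have A: "label ` set p \<subseteq> A" "label ` set (p @ [d]) \<subseteq> A"
    using assms lab by (auto simp flip: set_map)
  have seg: "segment G (y @ [a]) = Diagram (p @ [d] @ opp d # arc p) []"
    unfolding segment_def P Let_def by (simp add: arc_def)
  have mir: "mirror G (segment G (y @ [a])) = segment G (y @ [a])"
    using A lab assms by (simp add: seg mirror_eq arc_Cons arc_arc opp_opp)
  have 1: "grown_from (p @ [d]) (segment G (y @ [a]))"
    using dist A grows.start by (simp add: grown_from_def seg arc_Cons)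
  have "fst d \<notin> ids (p @ arc p) []"
    using dist by (auto simp: ids_append) (auto simp: ids_def)
  then have "grows p (arc p) [] ([] @ [d, opp d] @ arc p) []"
    using lab assms by (intro grows.spur) (auto intro: grows.start)
  then have 2: "grown_from p (segment G (y @ [a]))"
    using dist A by (simp add: grown_from_def seg)
  show "strip (segment G (y @ [a])) y [a] (y @ [a]) R"
    by (rule stripI[of _ p "[d]" "p @ [d]"]) (use 1 2 lab in \<open>simp_all add: mir\<close>, simp_all add: seg arc_Cons)
  show "strip (segment G (y @ [a])) (y @ [a]) [inv\<^bsub>G\<^esub> a] y R"
    by (rule stripI[of _ "p @ [d]" "[opp d]" p]) (use 1 2 lab in \<open>simp_all add: mir\<close>, simp_all add: seg)
qed

end

section \<open>Paths and normal forms in the Cayley graph\<close>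

locale cayley_group = group G for G :: "('g, 'm) monoid_scheme" (structure) +
  fixes A :: "'g set"
  assumes gens: "symmetric_generating_set G A"
begin

lemma A_sub: "A \<subseteq> carrier G" and A_finite: "finite A" and A_inv: "a \<in> A \<Longrightarrow> inv a \<in> A"
  and one_notin_A: "\<one> \<notin> A"
  using gens by (auto simp: symmetric_generating_set_def)

lemma A_carrier [simp]: "a \<in> A \<Longrightarrow> a \<in> carrier G"
  using A_sub by blast

sublocale letters G A
  by unfold_locales (auto simp: A_inv)

lemma word_val_Nil [simp]: "word_val G [] = \<one>"
  and word_val_Cons [simp]: "word_val G (a # w) = a \<otimes> word_val G w"
  by (simp_all add: word_val_def)

lemma word_val_closed [simp]: "set w \<subseteq> A \<Longrightarrow> word_val G w \<in> carrier G"
  by (induction w) auto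

lemma word_val_append: "set u \<subseteq> A \<Longrightarrow> set v \<subseteq> A \<Longrightarrow> word_val G (u @ v) = word_val G u \<otimes> word_val G v"
  by (induction u) (auto simp: m_assoc)

abbreviation E :: "'g edge set" where "E \<equiv> cayley_edges G A"

lemma E_iff: "e \<in> E \<longleftrightarrow> fst e \<in> carrier G \<and> snd e \<in> A"
  by (cases e) (simp add: cayley_edges_def)

lemma reverse_edge_facts:
  assumes "e \<in> E"
  shows "reverse_edge G e \<in> E" "reverse_edge G (reverse_edge G e) = e"
    "fst (reverse_edge G e) = terminal G e" "terminal G (reverse_edge G e) = fst e"
    "terminal G e \<in> carrier G" "snd (reverse_edge G e) = inv (snd e)" "terminal G e \<noteq> fst e"
proof -
  show "terminal G e \<noteq> fst e"
    using assms one_notin_A by (auto simp: E_iff terminal_def)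
qed (use assms in \<open>auto simp: E_iff reverse_edge_def terminal_def m_assoc prod_eq_iff\<close>)

lemma edge_path_carrier:
  "edge_path G S g p h \<Longrightarrow> S \<subseteq> E \<Longrightarrow> g \<in> carrier G \<and> h \<in> carrier G"
  by (induction p arbitrary: g) (auto simp: E_iff)

lemma edge_path_append:
  "S \<subseteq> E \<Longrightarrow> edge_path G S g (p @ q) k \<longleftrightarrow> (\<exists>h. edge_path G S g p h \<and> edge_path G S h q k)"
  by (induction p arbitrary: g) (auto dest: edge_path_carrier)

lemma edge_path_set: "edge_path G S g p h \<Longrightarrow> set p \<subseteq> S"
  by (induction p arbitrary: g) auto

lemma edge_path_end:
  "edge_path G S g p h \<Longrightarrow> S \<subseteq> E \<Longrightarrow> h = g \<otimes> word_val G (map snd p)"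
proof (induction p arbitrary: g)
  case (Cons e p)
  then have "e \<in> E" "set p \<subseteq> E"
    using edge_path_set[of S "terminal G e" p h] by auto
  then have "snd e \<in> A" "fst e \<in> carrier G" "set (map snd p) \<subseteq> A"
    using E_iff by (auto simp: subset_iff)
  moreover have "h = terminal G e \<otimes> word_val G (map snd p)"
    using Cons by simp
  ultimately show ?case using Cons.prems by (simp add: terminal_def m_assoc)
qed simp

lemma edge_path_reverse:
  assumes "S \<subseteq> E" "\<And>e. e \<in> S \<Longrightarrow> reverse_edge G e \<in> S"
  shows "edge_path G S g p h \<Longrightarrow> edge_path G S h (rev (map (reverse_edge G) p)) g"
proof (induction p arbitrary: g)
  case (Cons e p)
  then have e: "e \<in> E" "reverse_edge G e \<in> S" "fst e = g" using assms by auto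
  have "edge_path G S (terminal G e) [reverse_edge G e] g"
    using e reverse_edge_facts[OF e(1)] by (auto simp: E_iff)
  with Cons show ?case by (auto simp: edge_path_append[OF assms(1)])
qed simp

lemma non_backtracking_append:
  "non_backtracking G (p @ q) \<longleftrightarrow> non_backtracking G p \<and> non_backtracking G q \<and>
     (p = [] \<or> q = [] \<or> hd q \<noteq> reverse_edge G (last p))"
  by (simp add: non_backtracking_def successively_append_iff)

lemma non_backtracking_reverse:
  assumes "set p \<subseteq> E" "non_backtracking G p"
  shows "non_backtracking G (rev (map (reverse_edge G) p))"
  using assms
proof (induction p)
  case (Cons e p)
  then have "non_backtracking G (rev (map (reverse_edge G) p))"
    by (metis append_Cons append_Nil list.set_intros(2) non_backtracking_append subset_iff)
  moreover have "p = [] \<or> reverse_edge G e \<noteq> reverse_edge G (reverse_edge G (hd p))"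
  proof (cases p)
    case (Cons f q)
    then have "f \<in> E" "f \<noteq> reverse_edge G e" using Cons.prems \<open>p = f # q\<close> by (auto simp: non_backtracking_def)
    then show ?thesis using Cons reverse_edge_facts(2)[of f] by simp
  qed simp
  ultimately show ?case
    by (auto simp: non_backtracking_append last_rev hd_map) (auto simp: non_backtracking_def)
qed (simp add: non_backtracking_def)

end

lemma not_successively_split:
  "\<not> successively P xs \<Longrightarrow> \<exists>u a b v. xs = u @ a # b # v \<and> \<not> P a b"
proof (induction xs rule: induct_list012)
  case (3 x y zs)
  then consider "\<not> P x y" | u a b v where "y # zs = u @ a # b # v" "\<not> P a b" by auto
  then show ?case
  proof cases
    case 1 then show ?thesis by (intro exI[of _ "[]"]) simp
  next
    case 2 then show ?thesis by (intro exI[of _ "x # u"]) auto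
  qed
qed auto

locale cayley_tree = cayley_group +
  fixes T :: "'a edge set"
  assumes tree: "maximal_tree G A T"
begin

lemma T_sub: "T \<subseteq> E" and T_reverse: "e \<in> T \<Longrightarrow> reverse_edge G e \<in> T"
  and T_connected: "g \<in> carrier G \<Longrightarrow> h \<in> carrier G \<Longrightarrow> \<exists>p. edge_path G T g p h"
  and T_acyclic: "edge_path G T g p g \<Longrightarrow> non_backtracking G p \<Longrightarrow> p = []"
  using tree by (auto simp: maximal_tree_def)

text \<open>If two non-backtracking paths to the same vertex end with different edges, then the first one
  followed by the reverse of the second one is a closed non-backtracking path.\<close>

lemma tree_path_unique:
  "edge_path G T g p h \<Longrightarrow> non_backtracking G p \<Longrightarrow> edge_path G T g q h \<Longrightarrow> non_backtracking G q \<Longrightarrow> p = q"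
proof (induction "length p" arbitrary: p q h)
  case 0
  then show ?case using T_acyclic[of g q] by simp
next
  case (Suc n)
  show ?case
  proof (cases "q = []")
    case True
    then show ?thesis using Suc.prems T_acyclic[of g p] by simp
  next
    case False
    obtain p' e where p: "p = p' @ [e]" using Suc.hyps(2) by (metis length_Suc_conv_rev)
    obtain q' f where q: "q = q' @ [f]" using False by (metis rev_exhaust)
    have e: "edge_path G T g p' (fst e)" "e \<in> T" "terminal G e = h"
      and f: "edge_path G T g q' (fst f)" "f \<in> T" "terminal G f = h"
      using Suc.prems(1,3) by (auto simp: p q edge_path_append[OF T_sub])
    show ?thesis
    proof (cases "e = f")
      case True
      then show ?thesis
        using Suc.hyps(1)[of p' "fst e" q'] Suc.hyps(2) Suc.prems(2,4) e f
        by (auto simp: p q non_backtracking_append)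
    next
      case False
      then have "reverse_edge G f \<noteq> reverse_edge G e"
        using e(2) f(2) T_sub reverse_edge_facts(2) by (metis subset_iff)
      moreover have "set q \<subseteq> E" using edge_path_set[OF Suc.prems(3)] T_sub by blast
      then have "non_backtracking G (rev (map (reverse_edge G) q))"
        using Suc.prems(4) by (rule non_backtracking_reverse)
      ultimately have "non_backtracking G (p @ rev (map (reverse_edge G) q))"
        using Suc.prems(2) unfolding non_backtracking_append[of p] by (simp add: p q)
      moreover have "edge_path G T g (p @ rev (map (reverse_edge G) q)) g"
        using Suc.prems edge_path_reverse[OF T_sub T_reverse] edge_path_append[OF T_sub] by blast
      ultimately show ?thesis using T_acyclic p by blast
    qed
  qed
qed

text \<open>A shortest path does not backtrack.\<close>

lemma tree_path_exists:
  assumes "g \<in> carrier G" "h \<in> carrier G"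
  shows "\<exists>p. edge_path G T g p h \<and> non_backtracking G p"
proof -
  define p where "p = arg_min length (\<lambda>p. edge_path G T g p h)"
  have p: "edge_path G T g p h" "\<And>q. edge_path G T g q h \<Longrightarrow> length p \<le> length q"
    using T_connected[OF assms] arg_min_natI arg_min_nat_le unfolding p_def by metis+
  have "non_backtracking G p"
  proof (rule ccontr)
    assume "\<not> non_backtracking G p"
    then obtain u e f v where p': "p = u @ e # f # v" and f: "f = reverse_edge G e"
      using not_successively_split[of _ p] unfolding non_backtracking_def by blast
    have "edge_path G T g u (fst e)" "e \<in> E" "edge_path G T (terminal G (reverse_edge G e)) v h"
      using p(1) T_sub by (auto simp: p' f edge_path_append[OF T_sub])
    then have "edge_path G T g (u @ v) h"
      using reverse_edge_facts(4)[of e] by (auto simp: edge_path_append[OF T_sub])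
    then show False using p(2)[of "u @ v"] by (simp add: p')
  qed
  with p(1) show ?thesis by blast
qed

definition tree_path :: "'a \<Rightarrow> 'a edge list" where
  "tree_path g = (THE p. edge_path G T \<one> p g \<and> non_backtracking G p)"

abbreviation nf :: "'a \<Rightarrow> 'a list" where "nf \<equiv> normal_form G T"

lemma nf_eq: "nf g = map snd (tree_path g)"
  by (simp add: normal_form_def tree_path_def)

lemma tree_path_eqI: "edge_path G T \<one> p g \<Longrightarrow> non_backtracking G p \<Longrightarrow> tree_path g = p"
  unfolding tree_path_def using tree_path_unique by (intro the_equality) blast+

lemma tree_path_props:
  assumes "g \<in> carrier G"
  shows "edge_path G T \<one> (tree_path g) g" "non_backtracking G (tree_path g)"
  using tree_path_exists[OF one_closed assms] tree_path_eqI by auto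

lemma nf_one [simp]: "nf \<one> = []"
  using tree_path_eqI[of "[]" \<one>] by (simp add: nf_eq non_backtracking_def)

lemma nf_letters: "g \<in> carrier G \<Longrightarrow> set (nf g) \<subseteq> A"
  using edge_path_set[OF tree_path_props(1)[of g]] T_sub E_iff by (force simp: nf_eq)

lemma word_val_nf: "g \<in> carrier G \<Longrightarrow> word_val G (nf g) = g"
  using edge_path_end[OF tree_path_props(1)[of g] T_sub] nf_letters[of g] by (simp add: nf_eq)

text \<open>Either \<open>e\<close> or its reverse is the last edge of the tree path to one of its ends. In the first case
  the normal form is not shortened by cancelling its last letter; this is what allows to recognize
  the two cases from the letters alone.\<close>

lemma nf_tree_edge:
  assumes "e \<in> T"
  obtains "nf (terminal G e) = nf (fst e) @ [snd e]"
          "nf (fst e) = [] \<or> last (nf (fst e)) \<noteq> inv (snd e)"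
    | "nf (fst e) = nf (terminal G e) @ [inv (snd e)]"
proof -
  have e: "e \<in> E" using assms T_sub by blast
  note r = reverse_edge_facts[OF e]
  have g: "fst e \<in> carrier G" using e by (simp add: E_iff)
  let ?p = "tree_path (fst e)"
  note p = tree_path_props[OF g]
  show thesis
  proof (cases "?p \<noteq> [] \<and> last ?p = reverse_edge G e")
    case True
    then obtain q where q: "?p = q @ [reverse_edge G e]" by (metis append_butlast_last_id)
    then have "tree_path (terminal G e) = q"
      using p r by (intro tree_path_eqI) (auto simp: edge_path_append[OF T_sub] non_backtracking_append)
    then have "nf (fst e) = nf (terminal G e) @ [inv (snd e)]" by (simp add: nf_eq q r)
    then show thesis by (rule that(2))
  next
    case False
    have "?p = [] \<or> e \<noteq> reverse_edge G (last ?p)"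
    proof (rule ccontr)
      assume "\<not> ?thesis"
      moreover from this have "last ?p \<in> E" using edge_path_set[OF p(1)] T_sub by force
      ultimately show False using False reverse_edge_facts(2) by metis
    qed
    then have "tree_path (terminal G e) = ?p @ [e]"
      using p r assms non_backtracking_append[of ?p "[e]"]
      by (intro tree_path_eqI) (auto simp: edge_path_append[OF T_sub] non_backtracking_def[of G "[e]"])
    then have 1: "nf (terminal G e) = nf (fst e) @ [snd e]" by (simp add: nf_eq)
    have "nf (fst e) = [] \<or> last (nf (fst e)) \<noteq> inv (snd e)"
    proof (rule ccontr)
      assume "\<not> ?thesis"
      then have ne: "nf (fst e) \<noteq> []" and l: "last (nf (fst e)) = inv (snd e)" by simp_all
      have "?p \<noteq> []" using ne by (simp add: nf_eq)
      then obtain q f where q: "?p = q @ [f]" by (metis rev_exhaust)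
      then have f: "f \<in> T" "terminal G f = fst e" "snd f = inv (snd e)"
        using p l by (auto simp: edge_path_append[OF T_sub] nf_eq)
      then have "f \<in> E" using T_sub by blast
      have "fst f = terminal G (reverse_edge G f)" using reverse_edge_facts[OF \<open>f \<in> E\<close>] by simp
      also have "\<dots> = terminal G e"
        using f e by (simp add: reverse_edge_def terminal_def E_iff)
      finally have "f = reverse_edge G e" using f(3) by (simp add: reverse_edge_def prod_eq_iff)
      with False q show False by simp
    qed
    with 1 show thesis by (rule that(1))
  qed
qed

end

section \<open>Diagrams produced by the stacking recursion\<close>

locale stacking_flow = cayley_tree +
  fixes \<Phi> :: "'a edge \<Rightarrow> 'a edge list"
  assumes flow: "flow_function G A T \<Phi>"
begin

abbreviation R :: "'a list set" where "R \<equiv> stacking_relators G A T \<Phi>"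
abbreviation stack :: "'a edge \<Rightarrow> 'a diagram \<Rightarrow> bool" where "stack \<equiv> stacking G A T \<Phi>"

lemma flow_path: "e \<in> E \<Longrightarrow> edge_path G E (fst e) (\<Phi> e) (terminal G e)"
  and flow_tree: "e \<in> T \<Longrightarrow> \<Phi> e = [e]"
  and flow_wf: "wf (flow_less G A T \<Phi>)"
  using flow by (auto simp: flow_function_def)

lemma flow_nonempty: "e \<in> E \<Longrightarrow> \<Phi> e \<noteq> []"
  using flow_path[of e] reverse_edge_facts(7)[of e] by auto

lemma flow_less_step:
  "e \<in> E \<Longrightarrow> e \<notin> T \<Longrightarrow> e' \<in> set (\<Phi> e) \<Longrightarrow> e' \<notin> T \<Longrightarrow> (e', e) \<in> flow_less G A T \<Phi>"
  unfolding flow_less_def by blast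

text \<open>A path of length one with the label and the starting point of \<open>e\<close> is \<open>e\<close> itself, and outside of the
  tree $\Phi(e) = e$ would make $e < e$. Hence the labels of the flow function decide membership in
  the tree, which is how the algorithm recognizes degenerate edges.\<close>

lemma tree_iff_flow_label:
  assumes "e \<in> E"
  shows "e \<in> T \<longleftrightarrow> map snd (\<Phi> e) = [snd e]"
proof
  assume "map snd (\<Phi> e) = [snd e]"
  then obtain f where f: "\<Phi> e = [f]" "snd f = snd e" by (auto simp: map_eq_Cons_conv)
  with flow_path[OF assms] have "f = e" by (simp add: prod_eq_iff)
  show "e \<in> T"
  proof (rule ccontr)
    assume "e \<notin> T"
    then have "(e, e) \<in> flow_less G A T \<Phi>"
      using flow_less_step[OF assms] f \<open>f = e\<close> by simp
    then show False using flow_wf by auto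
  qed
qed (simp add: flow_tree)

text \<open>Noetherian induction: every edge of the path $\Phi(e)$ lies in the tree or is smaller than \<open>e\<close>.\<close>

lemma stacking_unique: "e \<in> E \<Longrightarrow> \<exists>!D. stack e D"
proof (induction e rule: wf_induct_rule[OF flow_wf])
  case (1 e)
  show ?case
  proof (cases "e \<in> T")
    case True
    then show ?thesis by (blast intro: stacking.degenerate elim: stacking.cases)
  next
    case False
    have sub: "e' \<in> E" if "e' \<in> set (\<Phi> e)" for e'
      using edge_path_set[OF flow_path[OF \<open>e \<in> E\<close>]] that by blast
    have ex: "\<exists>!D. stack e' D" if "e' \<in> set (\<Phi> e)" for e'
    proof (cases "e' \<in> T")
      case True
      then show ?thesis by (blast intro: stacking.degenerate elim: stacking.cases)
    next
      case False
      then show ?thesis using 1 flow_less_step \<open>e \<notin> T\<close> that sub by blast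
    qed
    define Ds where "Ds = map (\<lambda>e'. THE D. stack e' D) (\<Phi> e)"
    have Ds: "list_all2 stack (\<Phi> e) Ds"
      using theI'[OF ex] by (auto simp: Ds_def list_all2_map2 list_all2_same)
    have uniq: "Ds' = Ds" if "list_all2 stack (\<Phi> e) Ds'" for Ds'
    proof (rule nth_equalityI)
      show "length Ds' = length Ds" using that Ds by (simp add: list_all2_conv_all_nth)
      fix i assume "i < length Ds'"
      then have "stack (\<Phi> e ! i) (Ds' ! i)" "stack (\<Phi> e ! i) (Ds ! i)" "\<Phi> e ! i \<in> set (\<Phi> e)"
        using that Ds by (simp_all add: list_all2_conv_all_nth)
      then show "Ds' ! i = Ds ! i" using ex by blast
    qed
    have "e \<in> E - T" using 1 False by blast
    show ?thesis
    proof (rule ex1I)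
      show "stack e (attach_cell G (length (nf (fst e))) (length (\<Phi> e)) (snd e) (glue_along G T (\<Phi> e) Ds))"
        using stacking.recursive[OF \<open>e \<in> E - T\<close> Ds] .
      fix D assume "stack e D"
      then show "D = attach_cell G (length (nf (fst e))) (length (\<Phi> e)) (snd e) (glue_along G T (\<Phi> e) Ds)"
        by cases (use False uniq in auto)
    qed
  qed
qed

lemma stack_edge_diagram: "e \<in> E \<Longrightarrow> stack e (edge_diagram G A T \<Phi> e)"
  unfolding edge_diagram_def by (rule theI'[OF stacking_unique])

text \<open>The diagram \<open>D\<close> for \<open>e\<close>, an edge from \<open>g\<close> to \<open>h\<close> labeled \<open>a\<close>, has the boundary $y_g a y_h^{-1}$.\<close>

definition edge_strip :: "'a edge \<Rightarrow> 'a diagram \<Rightarrow> bool" where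
  "edge_strip e D \<longleftrightarrow> strip D (nf (fst e)) [snd e] (nf (terminal G e)) R"

lemma strip_glue_fold:
  "edge_path G E g es h \<Longrightarrow> list_all2 edge_strip es Ds \<Longrightarrow> strip D y v (nf g) R \<Longrightarrow>
    strip (foldl (\<lambda>D1 (e', D2). glue G (length (nf (fst e'))) D1 D2) D (zip es Ds))
      y (v @ map snd es) (nf h) R"
proof (induction es arbitrary: g Ds D v)
  case (Cons e es)
  obtain D2 Ds' where Ds: "Ds = D2 # Ds'" "edge_strip e D2" "list_all2 edge_strip es Ds'"
    using Cons.prems(2) by (auto simp: list_all2_Cons1)
  have "strip (glue G (length (nf (fst e))) D D2) y (v @ [snd e]) (nf (terminal G e)) R"
    using Cons.prems Ds(2) by (intro strip_glue) (auto simp: edge_strip_def)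
  then show ?case using Cons.IH[of "terminal G e" Ds'] Cons.prems Ds by fastforce
qed simp

lemma strip_glue_along:
  assumes "edge_path G E g es h" "list_all2 edge_strip es Ds" "es \<noteq> []"
  shows "strip (glue_along G T es Ds) (nf g) (map snd es) (nf h) R"
proof -
  obtain e es' D Ds' where *: "es = e # es'" "Ds = D # Ds'"
    using assms by (cases es; cases Ds) auto
  then show ?thesis
    using strip_glue_fold[of "terminal G e" es' h Ds' D "nf g" "[snd e]"] assms
    by (auto simp: edge_strip_def)
qed

text \<open>One of the two normal forms is the other one extended by a letter, and the longer one labels the
  segment.\<close>

lemma strip_tree_edge:
  assumes e: "e \<in> T"
  shows "edge_strip e (segment G (if length (nf (fst e)) < length (nf (terminal G e))
           then nf (terminal G e) else nf (fst e)))"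
proof -
  have "e \<in> E" using e T_sub by blast
  then have c: "fst e \<in> carrier G" "terminal G e \<in> carrier G" "snd e \<in> A"
    using reverse_edge_facts by (auto simp: E_iff)
  show ?thesis
    using e
  proof (cases rule: nf_tree_edge)
    case 1
    then show ?thesis
      using strip_segment(1)[OF nf_letters[OF c(1)] c(3)] by (simp add: edge_strip_def)
  next
    case 2
    then show ?thesis
      using strip_segment(2)[OF nf_letters[OF c(2)] A_inv[OF c(3)]] c(3) by (simp add: edge_strip_def)
  qed
qed

lemma stack_strip: "stack e D \<Longrightarrow> edge_strip e D"
proof (induction rule: stacking.induct)
  case (degenerate e y z)
  show ?case unfolding degenerate(2,3) by (rule strip_tree_edge[OF degenerate(1)])
next
  case (recursive e Ds)
  then have e: "e \<in> E" "e \<notin> T" "snd e \<in> A" by (auto simp: E_iff)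
  have "list_all2 edge_strip (\<Phi> e) Ds"
    using recursive(2) by (rule list_all2_mono) blast
  then have "strip (glue_along G T (\<Phi> e) Ds) (nf (fst e)) (map snd (\<Phi> e)) (nf (terminal G e)) R"
    using flow_path flow_nonempty e by (intro strip_glue_along) auto
  moreover have "map snd (\<Phi> e) @ [inv (snd e)] \<in> R"
    using stacking_relators.flow[of "fst e" "snd e" G A T \<Phi>] e by simp
  ultimately show ?case
    using strip_attach_cell[of _ _ "map snd (\<Phi> e)"] flow_nonempty e
    by (simp add: edge_strip_def)
qed

lemma inv_word_single: "inv_word G [a] = [inv a]"
  by (simp add: inv_word_def)

text \<open>The inverses of relators are relators, so mirror images are diagrams over the same presentation.\<close>

lemma oriented_diagram_strip:
  assumes "e \<in> E"
  shows "edge_strip e (oriented_diagram G A T \<Phi> c e)"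
proof (cases "c e")
  case True
  then show ?thesis using assms stack_edge_diagram stack_strip by (simp add: oriented_diagram_def)
next
  case False
  note r = reverse_edge_facts[OF assms]
  have "edge_strip (reverse_edge G e) (edge_diagram G A T \<Phi> (reverse_edge G e))"
    using r stack_edge_diagram stack_strip by blast
  then have "strip (mirror G (edge_diagram G A T \<Phi> (reverse_edge G e))) (nf (fst e))
      (inv_word G [inv (snd e)]) (nf (terminal G e)) R"
    using r stacking_relators.inverse by (intro strip_mirror) (auto simp: edge_strip_def)
  then show ?thesis
    using False assms by (simp add: oriented_diagram_def edge_strip_def inv_word_single E_iff)
qed

lemma word_path_path:
  assumes "set u \<subseteq> A" "set w \<subseteq> A"
  shows "edge_path G E (word_val G u) (map (\<lambda>i. (word_val G (u @ take i w), w ! i)) [0..<length w])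
    (word_val G (u @ w))"
  using assms
proof (induction w arbitrary: u)
  case (Cons a w)
  have "map (\<lambda>i. (word_val G (u @ take i (a # w)), (a # w) ! i)) [0..<length (a # w)] =
    (word_val G u, a) # map (\<lambda>i. (word_val G ((u @ [a]) @ take i w), w ! i)) [0..<length w]"
    by (simp add: upt_conv_Cons o_def flip: map_Suc_upt del: upt_Suc)
  moreover have "terminal G (word_val G u, a) = word_val G (u @ [a])"
    using Cons.prems by (simp add: terminal_def word_val_append)
  ultimately show ?case
    using Cons.IH[of "u @ [a]"] Cons.prems by (simp add: E_iff)
qed simp

lemma word_path_facts:
  assumes "w \<in> lists A"
  shows "edge_path G E \<one> (word_path G w) (word_val G w)" "map snd (word_path G w) = w"
    "word_path G w = [] \<longleftrightarrow> w = []"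
  using word_path_path[of "[]" w] assms by (auto simp: word_path_def o_def map_nth in_lists_conv_set)

lemma edge_diagram_van_kampen:
  assumes "e \<in> E"
  shows "van_kampen_diagram G A R (nf (fst e) @ [snd e] @ inv_word G (nf (terminal G e))) (edge_diagram G A T \<Phi> e)"
  using strip_van_kampen stack_strip[OF stack_edge_diagram[OF assms]] unfolding edge_strip_def by blast

lemma stacking_output_van_kampen:
  assumes w: "w \<in> lists A" "word_val G w = \<one>"
  shows "van_kampen_diagram G A R w (stacking_output G A T \<Phi> c w)"
proof (cases "w = []")
  case True
  then show ?thesis
    using spherical_empty
    by (simp add: stacking_output_def word_path_def van_kampen_diagram_def spherical_def)
next
  case False
  have "list_all2 edge_strip (word_path G w) (map (oriented_diagram G A T \<Phi> c) (word_path G w))"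
    using edge_path_set[OF word_path_facts(1)[OF w(1)]] oriented_diagram_strip
    by (auto simp: list_all2_map2 list_all2_same)
  then have "strip (stacking_output G A T \<Phi> c w) (nf \<one>) (map snd (word_path G w)) (nf \<one>) R"
    using word_path_facts[OF w(1)] False w(2) unfolding stacking_output_def
    by (intro strip_glue_along) auto
  then show ?thesis
    using strip_van_kampen word_path_facts(2)[OF w(1)] by (fastforce simp: inv_word_def)
qed

end

section \<open>Total recursive functions on tuples of natural numbers\<close>

definition recursive_fun :: "nat \<Rightarrow> (nat list \<Rightarrow> nat) \<Rightarrow> bool" where
  "recursive_fun n f \<longleftrightarrow> (\<exists>p. \<forall>xs. length xs = n \<longrightarrow> evaluates p xs (f xs))"

lemma recursive_fun_cong:
  "recursive_fun n f \<Longrightarrow> (\<And>xs. length xs = n \<Longrightarrow> f xs = g xs) \<Longrightarrow> recursive_fun n g"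
  unfolding recursive_fun_def by metis

lemma recursive_fun_proj: "i < n \<Longrightarrow> recursive_fun n (\<lambda>xs. xs ! i)"
  unfolding recursive_fun_def by (metis evaluates.proj)

lemma recursive_fun_comp:
  assumes "recursive_fun k g" "length fs = k" "\<And>f. f \<in> set fs \<Longrightarrow> recursive_fun n f"
  shows "recursive_fun n (\<lambda>xs. g (map (\<lambda>f. f xs) fs))"
proof -
  obtain p where p: "\<And>xs. length xs = k \<Longrightarrow> evaluates p xs (g xs)"
    using assms(1) by (auto simp: recursive_fun_def)
  have "\<exists>q. \<forall>xs. length xs = n \<longrightarrow> evaluates q xs (f xs)" if "f \<in> set fs" for f
    using assms(3)[OF that] by (simp add: recursive_fun_def)
  then obtain q where q: "\<And>f xs. f \<in> set fs \<Longrightarrow> length xs = n \<Longrightarrow> evaluates (q f) xs (f xs)"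
    by metis
  have "evaluates (Comp p (map q fs)) xs (g (map (\<lambda>f. f xs) fs))" if "length xs = n" for xs
    using that assms(2) q by (intro evaluates.comp[OF _ p]) (auto simp: list_all2_conv_all_nth)
  then show ?thesis unfolding recursive_fun_def by blast
qed

lemma recursive_fun_comp1:
  "recursive_fun 1 (\<lambda>xs. g (xs ! 0)) \<Longrightarrow> recursive_fun n f \<Longrightarrow> recursive_fun n (\<lambda>xs. g (f xs))"
  using recursive_fun_comp[of 1 "\<lambda>xs. g (xs ! 0)" "[f]" n] by simp

lemma recursive_fun_comp2:
  "recursive_fun 2 (\<lambda>xs. g (xs ! 0) (xs ! 1)) \<Longrightarrow> recursive_fun n f1 \<Longrightarrow> recursive_fun n f2 \<Longrightarrow>
    recursive_fun n (\<lambda>xs. g (f1 xs) (f2 xs))"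
  using recursive_fun_comp[of 2 "\<lambda>xs. g (xs ! 0) (xs ! 1)" "[f1, f2]" n] by auto

lemma recursive_fun_comp3:
  "recursive_fun 3 (\<lambda>xs. g (xs ! 0) (xs ! 1) (xs ! 2)) \<Longrightarrow> recursive_fun n f1 \<Longrightarrow> recursive_fun n f2 \<Longrightarrow>
    recursive_fun n f3 \<Longrightarrow> recursive_fun n (\<lambda>xs. g (f1 xs) (f2 xs) (f3 xs))"
  using recursive_fun_comp[of 3 "\<lambda>xs. g (xs ! 0) (xs ! 1) (xs ! 2)" "[f1, f2, f3]" n]
  by (auto simp: numeral_2_eq_2)

lemma recursive_fun_Suc: "recursive_fun n f \<Longrightarrow> recursive_fun n (\<lambda>xs. Suc (f xs))"
proof -
  have "evaluates Succ xs (Suc (xs ! 0))" if "length xs = 1" for xs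
    using that evaluates.succ[of "xs ! 0"] by (cases xs) auto
  then have "recursive_fun 1 (\<lambda>xs. Suc (xs ! 0))" unfolding recursive_fun_def by blast
  then show "recursive_fun n f \<Longrightarrow> recursive_fun n (\<lambda>xs. Suc (f xs))"
    by (rule recursive_fun_comp1)
qed

lemma recursive_fun_const: "recursive_fun n (\<lambda>xs. c)"
proof (induction c)
  case 0
  show ?case unfolding recursive_fun_def by (metis evaluates.zero)
next
  case (Suc c)
  then show ?case by (rule recursive_fun_Suc)
qed

lemma recursive_fun_rec:
  assumes "recursive_fun n f" "recursive_fun (Suc (Suc n)) g"
  shows "recursive_fun (Suc n) (\<lambda>xs. rec_nat (f (tl xs)) (\<lambda>k r. g (k # r # tl xs)) (hd xs))"
proof -
  obtain p q where p: "\<And>xs. length xs = n \<Longrightarrow> evaluates p xs (f xs)"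
    and q: "\<And>xs. length xs = Suc (Suc n) \<Longrightarrow> evaluates q xs (g xs)"
    using assms by (auto simp: recursive_fun_def)
  have "evaluates (PrimRec p q) (k # xs) (rec_nat (f xs) (\<lambda>k r. g (k # r # xs)) k)"
    if "length xs = n" for k xs
    by (induction k) (auto intro!: evaluates.prim0 p q that intro: evaluates.primS)
  then have "\<forall>xs. length xs = Suc n \<longrightarrow>
      evaluates (PrimRec p q) xs (rec_nat (f (tl xs)) (\<lambda>k r. g (k # r # tl xs)) (hd xs))"
    by (auto simp: length_Suc_conv)
  then show ?thesis unfolding recursive_fun_def by blast
qed

text \<open>Primitive recursion with a single parameter, in a form that applies by resolution to a goal
  which contains \<open>rec_nat\<close>.\<close>

lemma recursive_fun_rec1:
  assumes "recursive_fun 1 (\<lambda>xs. z (xs ! 0))" "recursive_fun 3 (\<lambda>xs. g (xs ! 2) (xs ! 0) (xs ! 1))"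
    "recursive_fun n k" "recursive_fun n x"
  shows "recursive_fun n (\<lambda>xs. rec_nat (z (x xs)) (g (x xs)) (k xs))"
proof -
  have "recursive_fun 2 (\<lambda>xs. rec_nat (z (tl xs ! 0)) (\<lambda>k r. g ((k # r # tl xs) ! 2) ((k # r # tl xs) ! 0) ((k # r # tl xs) ! 1)) (hd xs))"
    using recursive_fun_rec[of 1 "\<lambda>xs. z (xs ! 0)" "\<lambda>xs. g (xs ! 2) (xs ! 0) (xs ! 1)"] assms(1,2)
    by (simp add: numeral_2_eq_2 numeral_3_eq_3)
  then have "recursive_fun 2 (\<lambda>xs. rec_nat (z (xs ! 1)) (\<lambda>k r. g (xs ! 1) k r) (xs ! 0))"
    by (rule recursive_fun_cong) (auto simp: numeral_2_eq_2 length_Suc_conv)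
  then show ?thesis using assms(3,4) by (rule recursive_fun_comp2)
qed

named_theorems rec_intros

lemmas [rec_intros] = recursive_fun_proj recursive_fun_const recursive_fun_Suc

lemma recursive_fun_add [rec_intros]:
  assumes "recursive_fun n f" "recursive_fun n g"
  shows "recursive_fun n (\<lambda>xs. f xs + g xs)"
proof -
  have "recursive_fun n (\<lambda>xs. rec_nat (g xs) (\<lambda>k r. Suc r) (f xs))"
    by (intro recursive_fun_rec1[where z = "\<lambda>x. x" and g = "\<lambda>x k r. Suc r"] rec_intros assms) simp_all
  moreover have "rec_nat b (\<lambda>k r. Suc r) a = a + b" for a b by (induction a) auto
  ultimately show ?thesis by simp
qed

lemma recursive_fun_pred: "recursive_fun n f \<Longrightarrow> recursive_fun n (\<lambda>xs. f xs - 1)"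
proof -
  assume f: "recursive_fun n f"
  have "recursive_fun n (\<lambda>xs. rec_nat 0 (\<lambda>k r. k) (f xs))"
    by (intro recursive_fun_rec1[where x = "\<lambda>xs. 0" and z = "\<lambda>x. 0" and g = "\<lambda>x k r. k"] rec_intros f) simp_all
  moreover have "rec_nat 0 (\<lambda>k r. k) a = a - 1" for a :: nat by (cases a) auto
  ultimately show "recursive_fun n (\<lambda>xs. f xs - 1)" by simp
qed

lemma recursive_fun_diff [rec_intros]:
  assumes "recursive_fun n f" "recursive_fun n g"
  shows "recursive_fun n (\<lambda>xs. f xs - g xs)"
proof -
  have "recursive_fun n (\<lambda>xs. rec_nat (f xs) (\<lambda>k r. r - 1) (g xs))"
    by (intro recursive_fun_rec1[where z = "\<lambda>x. x" and g = "\<lambda>x k r. r - 1"] recursive_fun_pred rec_intros assms) simp_all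
  moreover have "rec_nat a (\<lambda>k r. r - 1) b = a - b" for a b :: nat by (induction b) auto
  ultimately show ?thesis by simp
qed

lemma recursive_fun_ifz [rec_intros]:
  assumes "recursive_fun n c" "recursive_fun n f" "recursive_fun n g"
  shows "recursive_fun n (\<lambda>xs. if c xs = 0 then f xs else g xs)"
proof -
  have 1: "recursive_fun 3 (\<lambda>xs. rec_nat (tl xs ! 0) (\<lambda>k r. (k # r # tl xs) ! 3) (hd xs))"
    using recursive_fun_rec[of 2 "\<lambda>xs. xs ! 0" "\<lambda>xs. xs ! 3"] recursive_fun_proj[of 0 2] recursive_fun_proj[of 3 4]
    by (simp add: numeral_3_eq_3 eval_nat_numeral)
  have "rec_nat a (\<lambda>k r. b) c = (if c = 0 then a else b)" for a b c :: nat by (cases c) auto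
  with 1 have "recursive_fun 3 (\<lambda>xs. if xs ! 0 = 0 then xs ! 1 else xs ! 2)"
    by (elim recursive_fun_cong) (auto simp: eval_nat_numeral length_Suc_conv)
  then show ?thesis using assms by (rule recursive_fun_comp3)
qed

lemma recursive_fun_eq [rec_intros]:
  assumes "recursive_fun n c" "recursive_fun n d" "recursive_fun n f" "recursive_fun n g"
  shows "recursive_fun n (\<lambda>xs. if c xs = d xs then f xs else g xs)"
proof -
  have "recursive_fun n (\<lambda>xs. if (c xs - d xs) + (d xs - c xs) = 0 then f xs else g xs)"
    by (intro rec_intros assms)
  then show ?thesis by (rule recursive_fun_cong) auto
qed

lemma recursive_fun_triangle [rec_intros]:
  assumes "recursive_fun n f" shows "recursive_fun n (\<lambda>xs. triangle (f xs))"
proof -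
  have "recursive_fun n (\<lambda>xs. rec_nat 0 (\<lambda>k r. r + Suc k) (f xs))"
    by (intro recursive_fun_rec1[where x = "\<lambda>xs. 0" and z = "\<lambda>x. 0" and g = "\<lambda>x k r. r + Suc k"] rec_intros assms) simp_all
  moreover have "rec_nat 0 (\<lambda>k r. r + Suc k) a = triangle a" for a by (induction a) auto
  ultimately show ?thesis by simp
qed

text \<open>The index of the diagonal on which \<open>n\<close> lies in the Cantor enumeration of pairs.\<close>

definition triangle_root :: "nat \<Rightarrow> nat" where
  "triangle_root = rec_nat 0 (\<lambda>k r. if triangle (Suc r) = Suc k then Suc r else r)"

lemma triangle_root_bounds: "triangle (triangle_root n) \<le> n \<and> n < triangle (Suc (triangle_root n))"
proof (induction n)
  case (Suc n)
  show ?case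
  proof (cases "triangle (Suc (triangle_root n)) = Suc n")
    case True
    then have "triangle_root (Suc n) = Suc (triangle_root n)" by (simp add: triangle_root_def)
    then show ?thesis using True by simp
  next
    case False
    then have "triangle_root (Suc n) = triangle_root n" by (simp add: triangle_root_def)
    then show ?thesis using Suc False by simp
  qed
qed (simp add: triangle_root_def)

lemma recursive_fun_triangle_root [rec_intros]:
  assumes "recursive_fun n f" shows "recursive_fun n (\<lambda>xs. triangle_root (f xs))"
  unfolding triangle_root_def
  by (intro recursive_fun_rec1[where x = "\<lambda>xs. 0" and z = "\<lambda>x. 0" and g = "\<lambda>x k r. if triangle (Suc r) = Suc k then Suc r else r"] rec_intros assms) simp_all

lemma prod_decode_eq:
  "prod_decode n = (n - triangle (triangle_root n), triangle_root n - (n - triangle (triangle_root n)))"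
proof -
  have "n - triangle (triangle_root n) \<le> triangle_root n"
    using triangle_root_bounds[of n] by (simp, arith)
  then have "prod_encode (n - triangle (triangle_root n), triangle_root n - (n - triangle (triangle_root n))) = n"
    using triangle_root_bounds[of n] by (simp add: prod_encode_def)
  then show ?thesis by (metis prod_encode_inverse)
qed

lemma recursive_fun_prod_encode [rec_intros]:
  assumes "recursive_fun n f" "recursive_fun n g"
  shows "recursive_fun n (\<lambda>xs. prod_encode (f xs, g xs))"
  unfolding prod_encode_def prod.case by (intro rec_intros assms)

lemma recursive_fun_fst_decode [rec_intros]:
  assumes "recursive_fun n f" shows "recursive_fun n (\<lambda>xs. fst (prod_decode (f xs)))"
  unfolding prod_decode_eq fst_conv by (intro rec_intros assms)

lemma recursive_fun_snd_decode [rec_intros]: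
  assumes "recursive_fun n f" shows "recursive_fun n (\<lambda>xs. snd (prod_decode (f xs)))"
  unfolding prod_decode_eq snd_conv by (intro rec_intros assms)

section \<open>Computable functions between encoded types\<close>

class enc =
  fixes enc :: "'a \<Rightarrow> nat"
  assumes enc_inj: "enc x = enc y \<Longrightarrow> x = y"

lemma enc_eq_iff [simp]: "enc x = enc y \<longleftrightarrow> x = y"
  using enc_inj by blast

instantiation nat :: enc
begin
definition enc_nat :: "nat \<Rightarrow> nat" where [simp]: "enc_nat n = n"
instance by standard simp
end

instantiation bool :: enc
begin
definition enc_bool :: "bool \<Rightarrow> nat" where [simp]: "enc_bool b = of_bool b"
instance by standard (simp add: of_bool_def split: if_splits)
end

instantiation prod :: (enc, enc) enc
begin
definition enc_prod :: "'a \<times> 'b \<Rightarrow> nat" where "enc_prod x = prod_encode (enc (fst x), enc (snd x))"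
instance by standard (auto simp: enc_prod_def prod_eq_iff dest: injD[OF inj_prod_encode])
end

instantiation list :: (enc) enc
begin
definition enc_list :: "'a list \<Rightarrow> nat" where "enc_list xs = list_encode (map enc xs)"
instance
proof
  fix x y :: "'a list" assume "enc x = enc y"
  then have "map enc x = map enc y" by (simp add: enc_list_def list_encode_eq)
  then show "x = y" by (rule map_injective) (simp add: inj_def)
qed
end

instantiation diagram :: (enc) enc
begin
definition enc_diagram :: "'a diagram \<Rightarrow> nat" where "enc_diagram D = enc (face_walks D)"
instance
  by standard (auto simp: enc_diagram_def face_walks_def intro: diagram.expand)
end

lemma enc_Nil [simp]: "enc [] = 0" and enc_Cons: "enc (x # xs) = Suc (prod_encode (enc x, enc xs))"
  by (simp_all add: enc_list_def)

lemma enc_Pair: "enc (a, b) = prod_encode (enc a, enc b)"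
  by (simp add: enc_prod_def)

text \<open>A function on encoded data is computed by a function on codes. The latter is total on all numbers,
  also on those that code nothing, so that a case distinction may evaluate both of its branches.\<close>

definition computable :: "('a::enc \<Rightarrow> 'b::enc) \<Rightarrow> bool" where
  "computable f \<longleftrightarrow> (\<exists>h. recursive_fun 1 (\<lambda>xs. h (xs ! 0)) \<and> (\<forall>x. h (enc x) = enc (f x)))"

lemma computableI: "recursive_fun 1 (\<lambda>xs. h (xs ! 0)) \<Longrightarrow> (\<And>x. h (enc x) = enc (f x)) \<Longrightarrow> computable f"
  unfolding computable_def by blast

lemma computableE:
  assumes "computable f"
  obtains h where "\<And>n g. recursive_fun n g \<Longrightarrow> recursive_fun n (\<lambda>xs. h (g xs))" "\<And>x. h (enc x) = enc (f x)"
  using assms recursive_fun_comp1 unfolding computable_def by metis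

named_theorems comp_intros

lemma computable_ident [comp_intros]: "computable (\<lambda>x. x)"
  by (rule computableI[of "\<lambda>n. n"]) (auto intro: rec_intros)

lemma computable_const [comp_intros]: "computable (\<lambda>x. c)"
  by (rule computableI[of "\<lambda>n. enc c"]) (auto intro: rec_intros)

lemma computable_compose:
  assumes "computable f" "computable g" shows "computable (\<lambda>x. f (g x))"
proof -
  obtain h where h: "\<And>n g. recursive_fun n g \<Longrightarrow> recursive_fun n (\<lambda>xs. h (g xs))" "\<And>x. h (enc x) = enc (f x)"
    using assms(1) by (rule computableE) blast
  obtain k where k: "\<And>n g. recursive_fun n g \<Longrightarrow> recursive_fun n (\<lambda>xs. k (g xs))" "\<And>x. k (enc x) = enc (g x)"
    using assms(2) by (rule computableE) blast
  show ?thesis by (rule computableI[of "\<lambda>n. h (k n)"]) (auto intro!: h(1) k(1) rec_intros simp: h(2) k(2))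
qed

lemma computable_Pair [comp_intros]:
  assumes "computable f" "computable g" shows "computable (\<lambda>x. (f x, g x))"
proof -
  obtain h where h: "\<And>n g. recursive_fun n g \<Longrightarrow> recursive_fun n (\<lambda>xs. h (g xs))" "\<And>x. h (enc x) = enc (f x)"
    using assms(1) by (rule computableE) blast
  obtain k where k: "\<And>n g. recursive_fun n g \<Longrightarrow> recursive_fun n (\<lambda>xs. k (g xs))" "\<And>x. k (enc x) = enc (g x)"
    using assms(2) by (rule computableE) blast
  show ?thesis by (rule computableI[of "\<lambda>n. prod_encode (h n, k n)"]) (auto intro!: h(1) k(1) rec_intros simp: h(2) k(2) enc_Pair)
qed

text \<open>The lifting lemmas turn a closure property of \<open>recursive_fun\<close> into one of \<open>computable\<close>.\<close>

lemma computable_lift1: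
  assumes "\<And>n g. recursive_fun n g \<Longrightarrow> recursive_fun n (\<lambda>xs. h (g xs))" "\<And>x. h (enc x) = enc (f x)" "computable g"
  shows "computable (\<lambda>x. f (g x))"
  by (rule computable_compose[OF _ assms(3)], rule computableI[of h]) (auto intro!: assms(1,2) rec_intros)

lemma computable_fst [comp_intros]: "computable f \<Longrightarrow> computable (\<lambda>x. fst (f x))"
  by (rule computable_lift1[of "\<lambda>n. fst (prod_decode n)"]) (auto intro: rec_intros simp: enc_prod_def)

lemma computable_snd [comp_intros]: "computable f \<Longrightarrow> computable (\<lambda>x. snd (f x))"
  by (rule computable_lift1[of "\<lambda>n. snd (prod_decode n)"]) (auto intro: rec_intros simp: enc_prod_def)

lemma computable_lift2:
  assumes "\<And>n g g'. recursive_fun n g \<Longrightarrow> recursive_fun n g' \<Longrightarrow> recursive_fun n (\<lambda>xs. h (g xs) (g' xs))"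
    "\<And>x y. h (enc x) (enc y) = enc (f x y)" "computable g" "computable g'"
  shows "computable (\<lambda>x. f (g x) (g' x))"
proof -
  have "computable (\<lambda>p. f (fst p) (snd p))"
    by (rule computableI[of "\<lambda>n. h (fst (prod_decode n)) (snd (prod_decode n))"])
      (auto intro!: assms(1) rec_intros simp: assms(2) enc_prod_def)
  from computable_compose[OF this computable_Pair[OF assms(3,4)]] show ?thesis by simp
qed

text \<open>The recursion runs on codes, so its values may be of any encoded type. The parameters of \<open>g\<close> are
  gathered in a tuple because \<open>computable\<close> speaks of functions of one argument.\<close>

lemma computable_rec_nat [comp_intros]:
  assumes "computable k" "computable z" "computable (\<lambda>p. g (fst p) (fst (snd p)) (snd (snd p)))"
  shows "computable (\<lambda>x. rec_nat (z x) (g x) (k x))"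
proof -
  obtain hk where hk: "\<And>n g. recursive_fun n g \<Longrightarrow> recursive_fun n (\<lambda>xs. hk (g xs))" "\<And>x. hk (enc x) = enc (k x)"
    using assms(1) by (rule computableE) blast
  obtain hz where hz: "\<And>n g. recursive_fun n g \<Longrightarrow> recursive_fun n (\<lambda>xs. hz (g xs))" "\<And>x. hz (enc x) = enc (z x)"
    using assms(2) by (rule computableE) blast
  obtain hg where hg: "\<And>n g. recursive_fun n g \<Longrightarrow> recursive_fun n (\<lambda>xs. hg (g xs))"
    "\<And>p. hg (enc p) = enc (g (fst p) (fst (snd p)) (snd (snd p)))"
    using assms(3) by (rule computableE) blast
  define H where "H x = rec_nat (hz x) (\<lambda>k r. hg (prod_encode (x, prod_encode (k, r)))) (hk x)" for x
  have "recursive_fun 1 (\<lambda>xs. H (xs ! 0))"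
    unfolding H_def
    by (intro recursive_fun_rec1[where z = hz and g = "\<lambda>x k r. hg (prod_encode (x, prod_encode (k, r)))"] hg(1) hz(1) hk(1) rec_intros) simp_all
  moreover have "H (enc x) = enc (rec_nat (z x) (g x) (k x))" for x
  proof -
    have "rec_nat (enc (z x)) (\<lambda>k r. hg (prod_encode (enc x, prod_encode (k, r)))) m = enc (rec_nat (z x) (g x) m)" for m
    proof (induction m)
      case (Suc m)
      then show ?case using hg(2)[of "(x, m, rec_nat (z x) (g x) m)"] by (simp add: enc_Pair)
    qed simp
    then show ?thesis by (simp add: H_def hz hk)
  qed
  ultimately show ?thesis by (rule computableI)
qed

lemma computable_if [comp_intros]:
  assumes "computable c" "computable f" "computable g"
  shows "computable (\<lambda>x. if c x then f x else g x)"
proof -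
  obtain h where h: "\<And>n g. recursive_fun n g \<Longrightarrow> recursive_fun n (\<lambda>xs. h (g xs))" "\<And>x. h (enc x) = enc (f x)"
    using assms(2) by (rule computableE) blast
  obtain k where k: "\<And>n g. recursive_fun n g \<Longrightarrow> recursive_fun n (\<lambda>xs. k (g xs))" "\<And>x. k (enc x) = enc (g x)"
    using assms(3) by (rule computableE) blast
  obtain l where l: "\<And>n g. recursive_fun n g \<Longrightarrow> recursive_fun n (\<lambda>xs. l (g xs))" "\<And>x. l (enc x) = enc (c x)"
    using assms(1) by (rule computableE) blast
  show ?thesis
    by (rule computableI[of "\<lambda>n. if l n = 0 then k n else h n"])
      (auto intro!: h(1) k(1) l(1) rec_intros simp: h(2) k(2) l(2))
qed

lemma computable_eq [comp_intros]:
  assumes "computable f" "computable g" shows "computable (\<lambda>x. f x = g x)"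
  by (rule computable_lift2[of "\<lambda>a b. if a = b then 1 else 0", OF _ _ assms]) (auto intro!: rec_intros)

lemma computable_Suc [comp_intros]: "computable f \<Longrightarrow> computable (\<lambda>x. Suc (f x))"
  by (rule computable_lift1[of Suc]) (auto intro: rec_intros)

lemma computable_add [comp_intros]:
  assumes "computable f" "computable g" shows "computable (\<lambda>x. f x + g x :: nat)"
  by (rule computable_lift2[of "(+)", OF _ _ assms]) (auto intro!: rec_intros)

lemma computable_diff [comp_intros]:
  assumes "computable f" "computable g" shows "computable (\<lambda>x. f x - g x :: nat)"
  by (rule computable_lift2[of "(-)", OF _ _ assms]) (auto intro!: rec_intros)

lemma computable_less [comp_intros]:
  assumes "computable f" "computable g" shows "computable (\<lambda>x. f x < (g x :: nat))"
proof (rule computable_lift2[of "\<lambda>a b. if b - a = 0 then 0 else 1", OF _ _ assms])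
  show "recursive_fun n (\<lambda>xs. if h xs - g xs = 0 then 0 else 1)"
    if "recursive_fun n g" "recursive_fun n h" for n g h
    by (intro rec_intros that)
qed auto

lemma computable_enc [comp_intros]: "computable f \<Longrightarrow> computable (\<lambda>x. enc (f x))"
  by (rule computable_lift1[of "\<lambda>n. n"]) auto

lemma computable_not [comp_intros]: "computable f \<Longrightarrow> computable (\<lambda>x. \<not> f x)"
  by (rule computable_lift1[of "\<lambda>n. if n = 0 then 1 else 0"]) (auto intro!: rec_intros)

lemma computable_conj [comp_intros]:
  assumes "computable f" "computable g" shows "computable (\<lambda>x. f x \<and> g x)"
  by (rule computable_lift2[of "\<lambda>a b. if a = 0 then 0 else b", OF _ _ assms]) (auto intro!: rec_intros)

lemma computable_disj [comp_intros]:
  assumes "computable f" "computable g" shows "computable (\<lambda>x. f x \<or> g x)"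
  by (rule computable_lift2[of "\<lambda>a b. if a = 0 then b else 1", OF _ _ assms]) (auto intro!: rec_intros)

lemma computable_Cons [comp_intros]:
  assumes "computable f" "computable g" shows "computable (\<lambda>x. f x # g x)"
  by (rule computable_lift2[of "\<lambda>a b. Suc (prod_encode (a, b))", OF _ _ assms]) (auto intro!: rec_intros simp: enc_Cons)

text \<open>For an empty list the branch for nonempty lists is evaluated on meaningless codes and discarded.\<close>

lemma computable_case_list [comp_intros]:
  assumes "computable l" "computable a" "computable (\<lambda>p. b (fst p) (fst (snd p)) (snd (snd p)))"
  shows "computable (\<lambda>x. case l x of [] \<Rightarrow> a x | y # ys \<Rightarrow> b x y ys)"
proof -
  obtain ha where ha: "\<And>n g. recursive_fun n g \<Longrightarrow> recursive_fun n (\<lambda>xs. ha (g xs))" "\<And>x. ha (enc x) = enc (a x)"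
    using assms(2) by (rule computableE) blast
  obtain hb where hb: "\<And>n g. recursive_fun n g \<Longrightarrow> recursive_fun n (\<lambda>xs. hb (g xs))"
    "\<And>p. hb (enc p) = enc (b (fst p) (fst (snd p)) (snd (snd p)))"
    using assms(3) by (rule computableE) blast
  obtain hl where hl: "\<And>n g. recursive_fun n g \<Longrightarrow> recursive_fun n (\<lambda>xs. hl (g xs))" "\<And>x. hl (enc x) = enc (l x)"
    using assms(1) by (rule computableE) blast
  define H where "H n = (if hl n = 0 then ha n else hb (prod_encode (n, hl n - 1)))" for n
  have "recursive_fun 1 (\<lambda>xs. H (xs ! 0))"
    unfolding H_def by (intro ha(1) hb(1) hl(1) rec_intros) simp_all
  moreover have "H (enc x) = enc (case l x of [] \<Rightarrow> a x | y # ys \<Rightarrow> b x y ys)" for x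
    using hb(2)[of "(x, hd (l x), tl (l x))"]
    by (auto simp: H_def ha hl enc_Cons enc_Pair split: list.split)
  ultimately show ?thesis by (rule computableI)
qed

lemma computable_Diagram [comp_intros]:
  assumes "computable f" "computable g" shows "computable (\<lambda>x. Diagram (f x) (g x))"
  by (rule computable_lift2[of "\<lambda>a b. Suc (prod_encode (a, b))", OF _ _ assms])
    (auto intro!: rec_intros simp: enc_diagram_def face_walks_def enc_Cons)

lemma computable_boundary [comp_intros]: "computable f \<Longrightarrow> computable (\<lambda>x. boundary (f x))"
  by (rule computable_lift1[of "\<lambda>n. fst (prod_decode (n - 1))"])
    (auto intro!: rec_intros simp: enc_diagram_def face_walks_def enc_Cons)

lemma computable_cells [comp_intros]: "computable f \<Longrightarrow> computable (\<lambda>x. cells (f x))"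
  by (rule computable_lift1[of "\<lambda>n. snd (prod_decode (n - 1))"])
    (auto intro!: rec_intros simp: enc_diagram_def face_walks_def enc_Cons)

section \<open>Computability on lists\<close>

lemma length_le_enc: "length xs \<le> enc xs"
proof (induction xs)
  case (Cons x xs)
  have "enc xs \<le> prod_encode (enc x, enc xs)" by (rule le_prod_encode_2)
  with Cons show ?case by (simp add: enc_Cons)
qed simp

text \<open>The code of a list is at least its length and can serve as the number of iterations: once the list
  is used up, further iterations have no effect.\<close>

lemma computable_foldl [comp_intros]:
  assumes l: "computable l" and z: "computable z" and g: "computable (\<lambda>p. g (fst p) (fst (snd p)) (snd (snd p)))"
  shows "computable (\<lambda>x. foldl (g x) (z x) (l x))"
proof -
  define st where "st x s = (case fst s of [] \<Rightarrow> s | y # ys \<Rightarrow> (ys, g x (snd s) y))" for x s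
  have g': "computable (\<lambda>x. g (f1 x) (f2 x) (f3 x))" if "computable f1" "computable f2" "computable f3"
    for f1 :: "'z::enc \<Rightarrow> _" and f2 f3
    using computable_compose[OF g computable_Pair[OF that(1) computable_Pair[OF that(2,3)]]] by simp
  have "computable (\<lambda>x. snd (rec_nat (l x, z x) (\<lambda>k s. st x s) (enc (l x))))"
    unfolding st_def by (intro comp_intros g' l z)
  moreover have "snd (rec_nat (xs, a) (\<lambda>k s. st x s) (enc xs)) = foldl (g x) a xs" for x xs a
  proof -
    have "rec_nat (xs, a) (\<lambda>k s. st x s) m = (drop m xs, foldl (g x) a (take m xs))" for m
    proof (induction m)
      case (Suc m)
      show ?case
      proof (cases "m < length xs")
        case True
        then show ?thesis
          using Suc by (simp add: st_def take_Suc_conv_app_nth flip: Cons_nth_drop_Suc)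
      qed (use Suc in \<open>simp add: st_def\<close>)
    qed simp
    then show ?thesis using length_le_enc[of xs] by simp
  qed
  ultimately show ?thesis by simp
qed

lemma computable_rev [comp_intros]:
  assumes "computable f" shows "computable (\<lambda>x. rev (f x))"
proof -
  have *: "rev xs = foldl (\<lambda>a y. y # a) [] xs" for xs :: "'z list"
    by (induction xs rule: rev_induct) auto
  show ?thesis unfolding * by (intro comp_intros assms)
qed

lemma computable_append [comp_intros]:
  assumes "computable f" "computable g" shows "computable (\<lambda>x. f x @ g x)"
proof -
  have *: "xs @ ys = foldl (\<lambda>a y. y # a) ys (rev xs)" for xs ys :: "'z list"
    by (induction xs) auto
  show ?thesis unfolding * by (intro comp_intros assms)
qed

lemma computable_length [comp_intros]:
  assumes "computable f" shows "computable (\<lambda>x. length (f x))"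
proof -
  have *: "length xs = foldl (\<lambda>n y. Suc n) 0 xs" for xs :: "'z list"
    by (induction xs rule: rev_induct) auto
  show ?thesis unfolding * by (intro comp_intros assms)
qed

lemma computable_foldr [comp_intros]:
  assumes "computable l" "computable z" "computable (\<lambda>p. g (fst p) (fst (snd p)) (snd (snd p)))"
  shows "computable (\<lambda>x. foldr (g x) (l x) (z x))"
proof -
  have g: "computable (\<lambda>p. g (fst p) (snd (snd p)) (fst (snd p)))"
    using computable_compose[OF assms(3), of "\<lambda>p. (fst p, snd (snd p), fst (snd p))"]
    by (simp add: comp_intros)
  show ?thesis unfolding foldr_conv_foldl by (intro comp_intros assms g)
qed

lemma computable_map [comp_intros]:
  assumes "computable l" "computable (\<lambda>p. g (fst p) (snd p))"
  shows "computable (\<lambda>x. map (g x) (l x))"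
proof -
  have *: "map g xs = foldr (\<lambda>y a. g y # a) xs []" for g :: "'z \<Rightarrow> 'w" and xs
    by (induction xs) auto
  have g: "computable (\<lambda>p. g (fst p) (fst (snd p)))"
    using computable_compose[OF assms(2), of "\<lambda>p. (fst p, fst (snd p))"] by (simp add: comp_intros)
  show ?thesis unfolding * by (intro comp_intros assms g)
qed

lemma computable_concat [comp_intros]:
  assumes "computable f" shows "computable (\<lambda>x. concat (f x))"
  unfolding concat_conv_foldr by (intro comp_intros assms)

lemma computable_drop [comp_intros]:
  assumes "computable n" "computable f" shows "computable (\<lambda>x. drop (n x) (f x))"
proof -
  have *: "drop n xs = rec_nat xs (\<lambda>k r. case r of [] \<Rightarrow> [] | y # ys \<Rightarrow> ys) n" for n and xs :: "'z list"
  proof (induction n)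
    case (Suc n)
    have "drop (Suc n) xs = tl (drop n xs)" by (simp add: drop_Suc tl_drop)
    then show ?case using Suc by (simp add: tl_def)
  qed simp
  show ?thesis unfolding * by (intro comp_intros assms)
qed

lemma computable_take [comp_intros]:
  assumes "computable n" "computable f" shows "computable (\<lambda>x. take (n x) (f x))"
proof -
  have *: "take n xs = rev (drop (length xs - n) (rev xs))" for n and xs :: "'z list"
    by (simp add: drop_rev) (metis diff_diff_cancel nat_le_linear take_all_iff diff_is_0_eq minus_nat.diff_0)
  show ?thesis unfolding * by (intro comp_intros assms)
qed

lemma computable_upt [comp_intros]:
  assumes "computable f" shows "computable (\<lambda>x. [0..<f x])"
proof -
  have *: "[0..<n] = rec_nat [] (\<lambda>k r. r @ [k]) n" for n by (induction n) auto
  show ?thesis unfolding * by (intro comp_intros assms)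
qed

lemma computable_zip [comp_intros]:
  assumes "computable f" "computable g" shows "computable (\<lambda>x. zip (f x) (g x))"
proof -
  have 1: "foldl (\<lambda>s x. case fst s of [] \<Rightarrow> s | y # ys \<Rightarrow> (ys, (x, y) # snd s)) (ys, zs) xs
      = (drop (length xs) ys, rev (zip xs ys) @ zs)" for xs :: "'z list" and ys :: "'w list" and zs
    by (induction xs arbitrary: ys zs) (auto split: list.split)
  have *: "zip xs ys = rev (snd (foldl (\<lambda>s x. case fst s of [] \<Rightarrow> s | y # ys \<Rightarrow> (ys, (x, y) # snd s)) (ys, []) xs))"
    for xs :: "'z list" and ys :: "'w list" using 1[of ys "[]" xs] by simp
  show ?thesis unfolding * by (intro comp_intros assms)
qed

lemma computable_finite_set:
  assumes "finite S" "computable f" shows "computable (\<lambda>x. f x \<in> S)"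
  using assms(1) by (induction S) (auto intro!: comp_intros assms(2))

text \<open>The values on a finite set are given by a table.\<close>

lemma computable_modify:
  assumes "finite S" "computable d" "computable f"
  shows "computable (\<lambda>x. if f x \<in> S then g (f x) else d x)"
  using assms(1)
proof (induction S)
  case (insert s S)
  have *: "(if f x \<in> insert s S then g (f x) else d x) =
    (if f x = s then g s else if f x \<in> S then g (f x) else d x)" for x
    by auto
  show ?case unfolding * by (intro comp_intros insert assms)
qed (simp add: assms)

section \<open>Programs and unbounded iteration\<close>

lemma enc_surj_nat: "surj (enc :: nat \<Rightarrow> nat)"
  by (simp add: surj_def)

lemma enc_surj_prod:
  assumes "surj (enc :: 'a::enc \<Rightarrow> nat)" "surj (enc :: 'b::enc \<Rightarrow> nat)"
  shows "surj (enc :: 'a \<times> 'b \<Rightarrow> nat)"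
  unfolding surj_def
proof
  fix n
  obtain x :: 'a and y :: 'b where "fst (prod_decode n) = enc x" "snd (prod_decode n) = enc y"
    using assms unfolding surj_def by metis
  then have "n = enc (x, y)" by (metis enc_Pair prod.collapse prod_decode_inverse)
  then show "\<exists>x :: 'a \<times> 'b. n = enc x" by blast
qed

lemma enc_surj_list:
  assumes "surj (enc :: 'a::enc \<Rightarrow> nat)"
  shows "surj (enc :: 'a list \<Rightarrow> nat)"
  unfolding surj_def
proof
  fix n
  obtain f :: "nat \<Rightarrow> 'a" where "\<And>n. enc (f n) = n"
    using assms unfolding surj_def by metis
  then have "enc (map f (list_decode n)) = n" by (simp add: enc_list_def o_def)
  then show "\<exists>x :: 'a list. n = enc x" by metis
qed

lemma evaluates_pairing:
  obtains q where "\<And>m n. evaluates q [m, n] (prod_encode (m, n))"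
proof -
  have "recursive_fun 2 (\<lambda>xs. prod_encode (xs ! 0, xs ! 1))" by (intro rec_intros) simp_all
  then obtain q where "\<And>xs. length xs = 2 \<Longrightarrow> evaluates q xs (prod_encode (xs ! 0, xs ! 1))"
    by (auto simp: recursive_fun_def)
  from this[of "[_, _]"] show thesis by (intro that) simp
qed

text \<open>A program that is known to halt on certain inputs only is made total by composing it with
  computable functions whose values are such inputs. If every number is a code, then this covers all
  numbers.\<close>

lemma computable_by_program:
  fixes f :: "'a::enc \<Rightarrow> 'b::enc" and args :: "('a \<Rightarrow> nat) list"
  assumes surj: "surj (enc :: 'a \<Rightarrow> nat)"
    and p: "\<And>x. evaluates p (map (\<lambda>c. c x) args) (enc (f x))"
    and c: "\<And>c. c \<in> set args \<Longrightarrow> computable c"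
  shows "computable f"
proof -
  define dec :: "nat \<Rightarrow> 'a" where "dec = inv_into UNIV enc"
  define h where "h n = enc (f (dec n))" for n
  have inv: "dec (enc x) = x" for x by (simp add: dec_def inv_f_f inj_def)
  have inv': "enc (dec n) = n" for n using surj by (simp add: dec_def surj_f_inv_f)
  have "\<exists>q. \<forall>x :: 'a. evaluates q [enc x] (c x)" if arg: "c \<in> set args" for c
  proof -
    obtain k where "recursive_fun 1 (\<lambda>xs. k (xs ! 0))" "\<And>x. k (enc x) = c x"
      using c[OF arg] by (auto simp: computable_def)
    then obtain q where q: "\<And>xs. length xs = 1 \<Longrightarrow> evaluates q xs (k (xs ! 0))"
      by (auto simp: recursive_fun_def)
    have "evaluates q [enc x] (c x)" for x
      using q[of "[enc x]"] \<open>k (enc x) = c x\<close> by simp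
    then show ?thesis by blast
  qed
  then obtain q where q: "\<And>c x. c \<in> set args \<Longrightarrow> evaluates (q c) [enc x] (c x)"
    by metis
  have "evaluates (Comp p (map q args)) [enc x] (enc (f x))" for x
    using q p by (intro evaluates.comp) (auto simp: list_all2_conv_all_nth)
  then have "evaluates (Comp p (map q args)) [n] (h n)" for n
    using inv' by (metis h_def)
  then have "evaluates (Comp p (map q args)) xs (h (xs ! 0))" if "length xs = 1" for xs
    using that by (cases xs) auto
  then have "recursive_fun 1 (\<lambda>xs. h (xs ! 0))" unfolding recursive_fun_def by blast
  then show ?thesis by (rule computableI) (simp add: h_def inv)
qed

lemma iterate_eq_rec_nat: "(f ^^ n) x = rec_nat x (\<lambda>k. f) n"
  by (induction n) auto

text \<open>The search for the first halting time is the only use of unbounded minimization. Halted states are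
  fixed, so any later time has the same output, and no bound on the running time has to be known.\<close>

lemma program_by_iteration:
  fixes init :: "'a::enc \<Rightarrow> 's::enc"
  assumes comp: "computable init" "computable step" "computable halted"
      "computable (\<lambda>p. out (fst p) (snd p))"
    and fix_halted: "\<And>s. halted s \<Longrightarrow> step s = s"
  obtains p where "\<And>x t. halted ((step ^^ t) (init x)) \<Longrightarrow> evaluates p [enc x] (enc (out x ((step ^^ t) (init x))))"
proof -
  define run where "run t x = (step ^^ t) (init x)" for t x
  have "computable (\<lambda>q. rec_nat (init (snd q)) (\<lambda>k. step) (fst q))"
    by (intro comp_intros computable_compose[OF comp(1)] computable_compose[OF comp(2)])
  then have run: "computable (\<lambda>q. run (fst q) (snd q))"
    by (simp add: run_def iterate_eq_rec_nat)
  have "computable (\<lambda>q. if halted (run (fst q) (snd q)) then 0 else Suc 0)"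
    by (intro computable_if computable_const computable_compose[OF comp(3)] run)
  then obtain h where h1: "recursive_fun 1 (\<lambda>xs. h (xs ! 0))"
    and "\<forall>q. h (enc q) = enc (if halted (run (fst q) (snd q)) then 0 else Suc 0)"
    unfolding computable_def by metis
  then have h: "h (enc q) = enc (if halted (run (fst q) (snd q)) then 0 else Suc 0)" for q
    by blast
  from h1 have "recursive_fun 2 (\<lambda>xs. h (prod_encode (xs ! 0, xs ! 1)))"
    by (rule recursive_fun_comp1) (intro rec_intros, simp_all)
  then obtain ph where ph: "\<And>xs. length xs = 2 \<Longrightarrow> evaluates ph xs (h (prod_encode (xs ! 0, xs ! 1)))"
    by (auto simp: recursive_fun_def)
  have ph': "evaluates ph [t, enc x] (if halted (run t x) then 0 else Suc 0)" for t x
    using ph[of "[t, enc x]"] h[of "(t, x)"] by (simp add: enc_Pair split: if_splits)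
  have "computable (\<lambda>q. out (snd q) (run (fst q) (snd q)))"
    using computable_compose[OF comp(4) computable_Pair[OF computable_snd[OF computable_ident] run]] by simp
  then obtain k where k1: "recursive_fun 1 (\<lambda>xs. k (xs ! 0))"
    and k: "\<And>q. k (enc q) = enc (out (snd q) (run (fst q) (snd q)))"
    unfolding computable_def by blast
  from k1 have "recursive_fun 2 (\<lambda>xs. k (prod_encode (xs ! 0, xs ! 1)))"
    by (rule recursive_fun_comp1) (intro rec_intros, simp_all)
  then obtain pk where pk: "\<And>xs. length xs = 2 \<Longrightarrow> evaluates pk xs (k (prod_encode (xs ! 0, xs ! 1)))"
    by (auto simp: recursive_fun_def)
  have pk': "evaluates pk [t, enc x] (enc (out x (run t x)))" for t x
    using pk[of "[t, enc x]"] k[of "(t, x)"] by (simp add: enc_Pair)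
  have "evaluates (Comp pk [Mu ph, Proj 0]) [enc x] (enc (out x (run t x)))" if "halted (run t x)" for x t
  proof -
    define t0 where "t0 = (LEAST t. halted (run t x))"
    have t0: "halted (run t0 x)" using that unfolding t0_def by (rule LeastI)
    have "t0 \<le> t" using that unfolding t0_def by (rule Least_le)
    have less: "\<not> halted (run m x)" if "m < t0" for m using that unfolding t0_def by (rule not_less_Least)
    have "evaluates ph (t0 # [enc x]) 0" using ph'[of t0 x] t0 by simp
    moreover have "\<forall>m<t0. \<exists>y. evaluates ph (m # [enc x]) (Suc y)"
      using ph'[of _ x] less by (metis (full_types))
    ultimately have "evaluates (Mu ph) [enc x] t0" by (rule evaluates.mu)
    moreover have "evaluates (Proj 0) [enc x] ([enc x] ! 0)" by (rule evaluates.proj) simp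
    ultimately have "evaluates (Comp pk [Mu ph, Proj 0]) [enc x] (enc (out x (run t0 x)))"
      by (intro evaluates.comp[OF _ pk']) simp
    moreover have "(step ^^ j) (run t0 x) = run t0 x" for j
      by (induction j) (simp_all add: fix_halted[OF t0])
    then have "run t x = run t0 x"
      using \<open>t0 \<le> t\<close> unfolding run_def by (metis funpow_add le_add_diff_inverse2 o_apply)
    ultimately show ?thesis by simp
  qed
  then show thesis by (intro that) (simp add: run_def)
qed

section \<open>A machine for the stacking recursion\<close>

lemma computable_Let [comp_intros]:
  assumes "computable f" "computable (\<lambda>p. g (fst p) (snd p))"
  shows "computable (\<lambda>x. let y = f x in g x y)"
  using computable_compose[OF assms(2) computable_Pair[OF computable_ident assms(1)]] by (simp add: Let_def)

lemma computable_max [comp_intros]: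
  assumes "computable f" "computable g" shows "computable (\<lambda>x. max (f x) (g x) :: nat)"
proof -
  have *: "max a b = (if a < b then b else a)" for a b :: nat by simp
  show ?thesis unfolding * by (intro comp_intros assms)
qed

text \<open>The operations on diagrams take a structure as an argument, of which they use the inversion of
  letters. In this structure on numbers the inversion is the involution \<open>\<iota>\<close>, so that the very same
  operations can be applied to diagrams whose letters are numbers.\<close>

definition letter_structure :: "(nat \<Rightarrow> nat) \<Rightarrow> nat monoid" where
  "letter_structure \<iota> = \<lparr>carrier = UNIV, monoid.mult = (\<lambda>x y. if y = \<iota> x then 0 else 1), one = 0\<rparr>"

lemma letter_structure_inv:
  assumes "\<And>x. \<iota> (\<iota> x) = x"
  shows "inv\<^bsub>letter_structure \<iota>\<^esub> x = \<iota> x"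
  unfolding m_inv_def letter_structure_def
  by (rule the_equality) (auto simp: assms split: if_splits)

type_synonym machine_state = "nat list \<times> (nat \<times> nat) list \<times> (nat list \<times> nat diagram) list"

text \<open>\<open>\<phi> y a\<close> is to be the label of the path $\Phi(e)$ for the edge labeled \<open>a\<close> at the vertex with normal
  form \<open>y\<close>, and \<open>ch y a\<close> says whether this edge has the chosen orientation.\<close>

locale letter_machine =
  fixes \<iota> :: "nat \<Rightarrow> nat" and \<phi> :: "nat list \<Rightarrow> nat \<Rightarrow> nat list" and ch :: "nat list \<Rightarrow> nat \<Rightarrow> bool"
  assumes \<iota>_invol: "\<And>x. \<iota> (\<iota> x) = x"
    and \<iota>_comp: "computable \<iota>"
    and \<phi>_comp: "computable (\<lambda>p. \<phi> (fst p) (snd p))"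
    and ch_comp: "computable (\<lambda>p. ch (fst p) (snd p))"
begin

definition "H = letter_structure \<iota>"

lemma inv_H [simp]: "inv\<^bsub>H\<^esub> x = \<iota> x"
  unfolding H_def by (rule letter_structure_inv) (rule \<iota>_invol)

lemma computable_inv [comp_intros]: "computable f \<Longrightarrow> computable (\<lambda>x. \<iota> (f x))"
  by (rule computable_compose[OF \<iota>_comp])

lemma computable_flow [comp_intros]: "computable f \<Longrightarrow> computable g \<Longrightarrow> computable (\<lambda>x. \<phi> (f x) (g x))"
  using computable_compose[OF \<phi>_comp computable_Pair] by simp

lemma computable_choice [comp_intros]: "computable f \<Longrightarrow> computable g \<Longrightarrow> computable (\<lambda>x. ch (f x) (g x))"
  using computable_compose[OF ch_comp computable_Pair] by simp

lemma computable_opposite [comp_intros]: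
  assumes "computable f" shows "computable (\<lambda>x. opposite H (f x))"
proof -
  have *: "opposite H d = (fst d, \<not> fst (snd d), \<iota> (snd (snd d)))" for d
    by (cases d) (simp add: opposite_def)
  show ?thesis unfolding * by (intro comp_intros assms[THEN computable_compose])
qed

lemma computable_face_walks [comp_intros]: "computable f \<Longrightarrow> computable (\<lambda>x. face_walks (f x))"
  unfolding face_walks_def by (intro comp_intros)

lemma computable_fresh [comp_intros]: "computable f \<Longrightarrow> computable (\<lambda>x. fresh (f x))"
  unfolding fresh_def by (intro comp_intros)

lemma computable_mirror [comp_intros]: "computable f \<Longrightarrow> computable (\<lambda>x. mirror H (f x))"
  unfolding mirror_def by (intro comp_intros)

lemma computable_segment [comp_intros]:
  assumes "computable f" shows "computable (\<lambda>x. segment H (f x))"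
proof -
  have *: "map (\<lambda>i. (i, True, x ! i)) [0..<length x] =
    map (\<lambda>q. (fst q, True, snd q)) (zip [0..<length x] x)" for x :: "nat list"
    by (rule nth_equalityI) auto
  show ?thesis unfolding segment_def * by (intro comp_intros assms[THEN computable_compose])
qed

lemma computable_map_darts:
  assumes "computable k" "computable f"
  shows "computable (\<lambda>x. map_darts (\<lambda>(k', b, a). (k x + k', b, a)) (f x))"
proof -
  have *: "(\<lambda>(k', b, a). (k + k', b, a)) = (\<lambda>d. (k + fst d, snd d))" for k :: nat
    by auto
  show ?thesis unfolding map_darts_def * by (intro comp_intros assms[THEN computable_compose])
qed

lemma map_of_foldr:
  "(case map_of zs d of None \<Rightarrow> c | Some v \<Rightarrow> v) = foldr (\<lambda>kv acc. if d = fst kv then snd kv else acc) zs c"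
  by (induction zs) auto

text \<open>The partial function in the definition of \<open>glue\<close> is not encoded data; looking up a dart in the list of
  pairs is.\<close>

lemma glue_by_lookup:
  "glue G n D D' =
     (let m = length (boundary D) - n;
          D'' = map_darts (\<lambda>(k, b, a). (fresh D + k, b, a)) D';
          p = rev (map (opposite G) (drop m (boundary D)));
          p' = take n (boundary D'');
          zs = zip p' p @ zip (map (opposite G) p') (map (opposite G) p)
      in Diagram
        (take m (boundary D) @
          map (\<lambda>d. foldr (\<lambda>kv acc. if d = fst kv then snd kv else acc) zs d) (drop n (boundary D'')))
        (cells D @
          map (map (\<lambda>d. foldr (\<lambda>kv acc. if d = fst kv then snd kv else acc) zs d)) (cells D'')))"
  unfolding glue_def Let_def map_of_foldr ..

lemma computable_glue [comp_intros]:
  assumes "computable n" "computable f" "computable g"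
  shows "computable (\<lambda>x. glue H (n x) (f x) (g x))"
  unfolding glue_by_lookup by (intro comp_intros computable_map_darts assms[THEN computable_compose])

lemma computable_attach_cell [comp_intros]:
  assumes "computable n" "computable l" "computable a" "computable f"
  shows "computable (\<lambda>x. attach_cell H (n x) (l x) (a x) (f x))"
  unfolding attach_cell_def by (intro comp_intros assms[THEN computable_compose])

text \<open>For an edge of the tree labeled \<open>a\<close> that starts at the vertex with normal form \<open>y\<close>, this is the
  normal form of its end.\<close>

definition next_nf :: "nat list \<Rightarrow> nat \<Rightarrow> nat list" where
  "next_nf y a = (case rev y of [] \<Rightarrow> [a] | b # r \<Rightarrow> if b = \<iota> a then rev r else y @ [a])"

definition glue_data :: "(nat list \<times> nat diagram) list \<Rightarrow> nat diagram" where
  "glue_data ps = (case ps of [] \<Rightarrow> Diagram [] []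
     | q # qs \<Rightarrow> foldl (\<lambda>D p. glue H (length (fst p)) D (snd p)) (snd q) qs)"

definition attach_data :: "nat \<Rightarrow> nat \<Rightarrow> (nat list \<times> nat diagram) list \<Rightarrow> nat list \<times> nat diagram" where
  "attach_data l a ps =
     (let y = (case ps of [] \<Rightarrow> [] | q # qs \<Rightarrow> fst q) in (y, attach_cell H (length y) l a (glue_data ps)))"

definition walk_data :: "nat list \<Rightarrow> nat \<Rightarrow> nat list \<times> nat diagram" where
  "walk_data y a = (y, segment H (if length y < length (next_nf y a) then next_nf y a else y))"

text \<open>The state consists of the normal form \<open>y\<close> of the current vertex, a list of pending operations and a
  stack of finished diagrams, each with the normal form of the vertex where its edge starts. The
  operation numbers mean:

  \<^item> 0: traverse the edge labeled \<open>a\<close> and push its diagram. For an edge of the tree, which is recognized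
    by its flow label, the diagram is a segment; for other edges the path given by the flow function
    is traversed first.

  \<^item> 1: drop the topmost diagram. 2: replace it by its mirror image, which belongs to an edge that
    starts at the current vertex.

  \<^item> 3: traverse the edge labeled \<open>a\<close> and push the diagram for its chosen orientation. If this is the
    reverse one, then the machine goes to the other end and back again for the diagram, and once more
    to the other end.

  \<^item> \<open>l + 4\<close>: glue the topmost \<open>l\<close> diagrams and attach the cell whose new edge is labeled \<open>a\<close>.\<close>

definition execute :: "nat list \<Rightarrow> (nat \<times> nat) list \<Rightarrow> (nat list \<times> nat diagram) list \<Rightarrow> nat \<Rightarrow> nat \<Rightarrow> machine_state" where
  "execute y ctrl ps i a =
    (if i = 0 then
       (if \<phi> y a = [a] then (next_nf y a, ctrl, walk_data y a # ps)
        else (y, map (\<lambda>b. (0, b)) (\<phi> y a) @ (length (\<phi> y a) + 4, a) # ctrl, ps))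
     else if i = 1 then (y, ctrl, drop 1 ps)
     else if i = 2 then (y, ctrl, case ps of [] \<Rightarrow> [] | q # qs \<Rightarrow> (y, mirror H (snd q)) # qs)
     else if i = 3 then
       (y, (if ch y a then [(0, a)] else [(0, a), (1, 0), (0, \<iota> a), (2, 0), (0, a), (1, 0)]) @ ctrl, ps)
     else (y, ctrl, attach_data (i - 4) a (rev (take (i - 4) ps)) # drop (i - 4) ps))"

definition step :: "machine_state \<Rightarrow> machine_state" where
  "step s = (case fst (snd s) of [] \<Rightarrow> s
     | op # ctrl \<Rightarrow> execute (fst s) ctrl (snd (snd s)) (fst op) (snd op))"

definition halted :: "machine_state \<Rightarrow> bool" where
  "halted s \<longleftrightarrow> fst (snd s) = []"

lemma step_halted: "halted s \<Longrightarrow> step s = s"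
  by (simp add: halted_def step_def)

lemma computable_next_nf [comp_intros]:
  assumes "computable f" "computable g" shows "computable (\<lambda>x. next_nf (f x) (g x))"
  unfolding next_nf_def by (intro comp_intros assms[THEN computable_compose])

lemma computable_glue_data [comp_intros]: "computable f \<Longrightarrow> computable (\<lambda>x. glue_data (f x))"
  unfolding glue_data_def by (intro comp_intros)

lemma computable_attach_data [comp_intros]:
  assumes "computable l" "computable a" "computable f"
  shows "computable (\<lambda>x. attach_data (l x) (a x) (f x))"
  unfolding attach_data_def by (intro comp_intros assms[THEN computable_compose])

lemma computable_walk_data [comp_intros]:
  assumes "computable f" "computable g" shows "computable (\<lambda>x. walk_data (f x) (g x))"
  unfolding walk_data_def by (intro comp_intros assms[THEN computable_compose])

lemma computable_execute [comp_intros]: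
  assumes "computable y" "computable c" "computable ps" "computable i" "computable a"
  shows "computable (\<lambda>x. execute (y x) (c x) (ps x) (i x) (a x))"
  unfolding execute_def by (intro comp_intros assms[THEN computable_compose])

lemma computable_step: "computable step"
  unfolding step_def[abs_def] by (intro comp_intros)

lemma computable_halted: "computable halted"
  unfolding halted_def[abs_def] by (intro comp_intros)

definition reaches :: "machine_state \<Rightarrow> machine_state \<Rightarrow> bool" where
  "reaches s s' \<longleftrightarrow> (\<exists>t. (step ^^ t) s = s')"

lemma reaches_refl: "reaches s s"
  unfolding reaches_def by (metis funpow_0)

lemma reaches_trans: "reaches s s' \<Longrightarrow> reaches s' s'' \<Longrightarrow> reaches s s''"
  unfolding reaches_def by (metis funpow_add o_apply)

lemma reaches_step: "reaches (step s) s' \<Longrightarrow> reaches s s'"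
  unfolding reaches_def by (metis funpow_Suc_right o_apply)

end

section \<open>Diagrams with numbered letters\<close>

locale stacking_machine = stacking_flow + letter_machine +
  fixes \<nu> :: "'a \<Rightarrow> nat"
  assumes \<nu>_inj: "inj_on \<nu> A"
    and \<iota>_letter: "\<And>a. a \<in> A \<Longrightarrow> \<iota> (\<nu> a) = \<nu> (inv a)"
    and \<phi>_flow: "\<And>w a. set w \<subseteq> A \<Longrightarrow> a \<in> A \<Longrightarrow>
      \<phi> (map \<nu> w) (\<nu> a) = map \<nu> (map snd (\<Phi> (word_val G w, a)))"
begin

lemma \<nu>_eq_iff: "a \<in> A \<Longrightarrow> b \<in> A \<Longrightarrow> \<nu> a = \<nu> b \<longleftrightarrow> a = b"
  using \<nu>_inj by (meson inj_onD)

lemma map_\<nu>_eq_iff: "set u \<subseteq> A \<Longrightarrow> set v \<subseteq> A \<Longrightarrow> map \<nu> u = map \<nu> v \<longleftrightarrow> u = v"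
  using \<nu>_inj by (metis inj_on_map_eq_map inj_on_subset Un_least)

definition num_dart :: "'a dart \<Rightarrow> nat dart" where
  "num_dart d = (fst d, fst (snd d), \<nu> (label d))"

text \<open>Numbering the letters of a diagram; by the lemmas below it commutes with all operations that the
  recursion uses, because \<open>\<nu>\<close> is injective on letters and turns inversion into \<open>\<iota>\<close>.\<close>

definition num_diagram :: "'a diagram \<Rightarrow> nat diagram" where
  "num_diagram D = Diagram (map num_dart (boundary D)) (map (map num_dart) (cells D))"

lemma enc_num_diagram: "enc (num_diagram D) = diagram_code \<nu> D"
proof -
  have "enc (num_dart d) = dart_code \<nu> d" for d
    by (cases d) (simp add: num_dart_def dart_code_def enc_Pair label_def)
  moreover have "face_walks (num_diagram D) = map (map num_dart) (face_walks D)"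
    by (simp add: face_walks_def num_diagram_def)
  ultimately show ?thesis
    by (simp add: enc_diagram_def diagram_code_def enc_list_def o_def)
qed

lemma num_dart_simps [simp]: "fst (num_dart d) = fst d"
  by (simp add: num_dart_def)

lemma num_dart_inj: "label d \<in> A \<Longrightarrow> label d' \<in> A \<Longrightarrow> num_dart d = num_dart d' \<longleftrightarrow> d = d'"
  by (auto simp: num_dart_def label_def \<nu>_eq_iff prod_eq_iff)

lemma num_opposite: "label d \<in> A \<Longrightarrow> opposite H (num_dart d) = num_dart (opp d)"
  by (cases d) (simp add: num_dart_def opposite_def label_def \<iota>_letter)

lemma num_opposite_map: "label ` set p \<subseteq> A \<Longrightarrow> map (opposite H) (map num_dart p) = map num_dart (map opp p)"
  by (induction p) (auto simp: num_opposite)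

lemma num_mirror:
  assumes "label ` darts D \<subseteq> A"
  shows "num_diagram (mirror G D) = mirror H (num_diagram D)"
proof -
  have *: "label ` set p \<subseteq> A" if "p = boundary D \<or> p \<in> set (cells D)" for p
    using assms that by (auto simp: darts_eq)
  show ?thesis
  proof -
    have "rev (map (opposite H) (map num_dart p)) = map num_dart (rev (map opp p))"
      if "p = boundary D \<or> p \<in> set (cells D)" for p
      using num_opposite_map[OF *[OF that]] by (simp add: rev_map)
    then show ?thesis by (simp add: num_diagram_def mirror_def)
  qed
qed

lemma num_segment:
  assumes "set x \<subseteq> A" shows "num_diagram (segment G x) = segment H (map \<nu> x)"
proof -
  define p where "p = map (\<lambda>i. (i, True, x ! i)) [0..<length x]"
  have p': "map (\<lambda>i. (i, True, map \<nu> x ! i)) [0..<length (map \<nu> x)] = map num_dart p"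
    by (simp add: p_def num_dart_def label_def)
  have "label ` set p \<subseteq> A" using assms by (auto simp: p_def label_def)
  then have "map (opposite H) (map num_dart p) = map num_dart (map opp p)"
    by (rule num_opposite_map)
  then show ?thesis
    unfolding segment_def p' Let_def by (simp add: num_diagram_def rev_map flip: p_def)
qed

lemma num_fresh: "fresh (num_diagram D) = fresh D"
proof -
  have "foldr (\<lambda>d m. max (Suc (fst d)) m) (map num_dart xs) 0 = foldr (\<lambda>d m. max (Suc (fst d)) m) xs 0" for xs
    by (induction xs) auto
  moreover have "concat (face_walks (num_diagram D)) = map num_dart (concat (face_walks D))"
    by (simp add: face_walks_def num_diagram_def map_concat)
  ultimately show ?thesis by (simp add: fresh_def)
qed

lemma num_attach_cell:
  assumes "label ` darts D \<subseteq> A" "a \<in> A"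
  shows "num_diagram (attach_cell G n l a D) = attach_cell H n l (\<nu> a) (num_diagram D)"
proof -
  have "(fresh D, True, \<nu> a) = num_dart (fresh D, True, a)"
    by (simp add: num_dart_def label_def)
  moreover have "opposite H (num_dart (fresh D, True, a)) = num_dart (opp (fresh D, True, a))"
    using assms by (intro num_opposite) (simp add: label_def)
  moreover have "boundary (num_diagram D) = map num_dart (boundary D)"
    "cells (num_diagram D) = map (map num_dart) (cells D)"
    by (simp_all add: num_diagram_def)
  ultimately show ?thesis
    unfolding attach_cell_def Let_def num_fresh
    by (simp add: take_map drop_map) (simp add: num_diagram_def take_map drop_map)
qed

lemma num_lookup:
  assumes "label d \<in> A" "\<And>kv. kv \<in> set zs \<Longrightarrow> label (fst kv) \<in> A"
  shows "(case map_of (map (map_prod num_dart num_dart) zs) (num_dart d) of None \<Rightarrow> num_dart d | Some d' \<Rightarrow> d')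
    = num_dart (case map_of zs d of None \<Rightarrow> d | Some d' \<Rightarrow> d')"
  using assms
proof (induction zs)
  case (Cons kv zs)
  obtain k v where kv: "kv = (k, v)" by (cases kv)
  then have "label k \<in> A" using Cons.prems(2)[of kv] by simp
  then show ?case using Cons kv num_dart_inj[OF \<open>label d \<in> A\<close>, of k] by auto
qed simp

lemma num_glue:
  assumes D: "label ` darts D \<subseteq> A" "label ` darts D' \<subseteq> A"
  shows "num_diagram (glue G n D D') = glue H n (num_diagram D) (num_diagram D')"
proof -
  define m where "m = length (boundary D) - n"
  define sh :: "'a dart \<Rightarrow> 'a dart" where "sh = (\<lambda>(k, b, a). (fresh D + k, b, a))"
  define sh' :: "nat dart \<Rightarrow> nat dart" where "sh' = (\<lambda>(k, b, a). (fresh D + k, b, a))"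
  define D'' where "D'' = map_darts sh D'"
  define p where "p = rev (map opp (drop m (boundary D)))"
  define p' where "p' = take n (boundary D'')"
  define zs where "zs = zip p' p @ zip (map opp p') (map opp p)"
  define s where "s = (\<lambda>d. case map_of zs d of None \<Rightarrow> d | Some d' \<Rightarrow> d')"
  define zs' where "zs' = zip (map num_dart p') (map num_dart p) @ zip (map num_dart (map opp p')) (map num_dart (map opp p))"
  define s' where "s' = (\<lambda>d. case map_of zs' d of None \<Rightarrow> d | Some d' \<Rightarrow> d')"
  have sh_label: "label (sh d) = label d" and sh_num: "sh' (num_dart d) = num_dart (sh d)" for d
    by (auto simp: sh_def sh'_def num_dart_def label_def split: prod.splits)
  have bD: "label ` set (boundary D) \<subseteq> A" and bD': "label ` set (boundary D') \<subseteq> A"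
    and cD': "\<And>c. c \<in> set (cells D') \<Longrightarrow> label ` set c \<subseteq> A"
    using D by (simp_all add: darts_eq image_Un) blast
  have bD'': "label ` set (boundary D'') \<subseteq> A" and cD'': "\<And>c. c \<in> set (cells D'') \<Longrightarrow> label ` set c \<subseteq> A"
  proof -
    have sh: "label ` set (map sh ds) = label ` set ds" for ds
      by (simp add: image_image sh_label)
    have D'': "boundary D'' = map sh (boundary D')" "cells D'' = map (map sh) (cells D')"
      by (simp_all add: D''_def map_darts_def)
    show "label ` set (boundary D'') \<subseteq> A" using bD' unfolding D'' sh .
    fix c assume "c \<in> set (cells D'')"
    then obtain c' where "c' \<in> set (cells D')" "c = map sh c'" by (auto simp: D'')
    then show "label ` set c \<subseteq> A" using cD' sh by metis
  qed
  have q: "label ` set (drop m (boundary D)) \<subseteq> A"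
    using bD set_drop_subset[of m "boundary D"] by blast
  then have p: "label ` set p \<subseteq> A" by (auto simp: p_def)
  have p'A: "label ` set p' \<subseteq> A"
    using bD'' set_take_subset[of n "boundary D''"] unfolding p'_def by blast
  have num_D'': "map_darts sh' (num_diagram D') = num_diagram D''"
    by (simp add: D''_def map_darts_def num_diagram_def sh_num)
  have num_b: "boundary (num_diagram X) = map num_dart (boundary X)"
    "cells (num_diagram X) = map (map num_dart) (cells X)" for X
    by (simp_all add: num_diagram_def)
  have num_p: "rev (map (opposite H) (map num_dart (drop m (boundary D)))) = map num_dart p"
    using num_opposite_map[OF q] by (simp add: p_def rev_map)
  have "zs' = map (map_prod num_dart num_dart) zs"
    by (simp add: zs'_def zs_def zip_map_map map_prod_def split_beta)
  moreover have "label (fst kv) \<in> A" if "kv \<in> set zs" for kv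
  proof -
    have "(fst kv, snd kv) \<in> set (zip p' p) \<or> (fst kv, snd kv) \<in> set (zip (map opp p') (map opp p))"
      using that by (simp add: zs_def)
    then have "fst kv \<in> set p' \<or> fst kv \<in> set (map opp p')"
      using set_zip_leftD by metis
    then show ?thesis
    proof
      assume "fst kv \<in> set p'"
      then show ?thesis using p'A by blast
    next
      assume "fst kv \<in> set (map opp p')"
      then obtain d where "d \<in> set p'" "fst kv = opp d" by auto
      then show ?thesis using p'A by auto
    qed
  qed
  ultimately have s': "s' (num_dart d) = num_dart (s d)" if "label d \<in> A" for d
    using num_lookup[of d zs] that by (simp add: s'_def s_def)
  then have s'_map: "map s' (map num_dart ds) = map num_dart (map s ds)" if "label ` set ds \<subseteq> A" for ds
    using that by auto
  have G: "glue G n D D' = Diagram (take m (boundary D) @ map s (drop n (boundary D''))) (cells D @ map (map s) (cells D''))"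
    unfolding glue_def Let_def m_def[symmetric] sh_def[symmetric] D''_def[symmetric] p'_def[symmetric]
      p_def[symmetric] zs_def[symmetric] s_def[symmetric] ..
  have m': "length (map num_dart (boundary D)) - n = m" by (simp add: m_def)
  have "glue H n (num_diagram D) (num_diagram D') =
    Diagram (map num_dart (take m (boundary D)) @ map s' (map num_dart (drop n (boundary D''))))
      (map (map num_dart) (cells D) @ map (map s') (map (map num_dart) (cells D'')))"
    unfolding glue_def Let_def num_fresh sh'_def[symmetric] num_D'' num_b m' take_map drop_map
      p'_def[symmetric] num_p num_opposite_map[OF p'A] num_opposite_map[OF p] zs'_def[symmetric] s'_def[symmetric] ..
  also have "\<dots> = num_diagram (glue G n D D')"
  proof -
    have "label ` set (drop n (boundary D'')) \<subseteq> A"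
      using bD'' set_drop_subset[of n "boundary D''"] by blast
    moreover have "map (map s') (map (map num_dart) (cells D'')) = map (map num_dart) (map (map s) (cells D''))"
      using s'_map[OF cD''] by simp
    ultimately show ?thesis by (simp add: G num_diagram_def s'_map del: map_map)
  qed
  finally show ?thesis ..
qed

end

section \<open>Correctness of the machine\<close>

context stacking_machine
begin

abbreviation num_nf :: "'a \<Rightarrow> nat list" where "num_nf g \<equiv> map \<nu> (nf g)"

lemma edge_strip_labels: "edge_strip e D \<Longrightarrow> label ` darts D \<subseteq> A"
  using grown_from_spherical by (auto simp: edge_strip_def strip_def spherical_def)

lemma next_nf_tree_edge:
  assumes "e \<in> T"
  shows "next_nf (num_nf (fst e)) (\<nu> (snd e)) = num_nf (terminal G e)"
proof -
  have e: "e \<in> E" using assms T_sub by blast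
  then have c: "fst e \<in> carrier G" "snd e \<in> A" by (auto simp: E_iff)
  note l = nf_letters[OF c(1)]
  show ?thesis
    using assms
  proof (cases rule: nf_tree_edge)
    case 1
    show ?thesis
    proof (cases "nf (fst e)" rule: rev_cases)
      case (snoc u b)
      then have "b \<in> A" "b \<noteq> inv (snd e)" using 1 l by auto
      then show ?thesis using 1 snoc c \<nu>_eq_iff[of b "inv (snd e)"] by (simp add: next_nf_def \<iota>_letter)
    qed (use 1 in \<open>simp add: next_nf_def\<close>)
  next
    case 2
    then show ?thesis using c by (simp add: next_nf_def \<iota>_letter rev_map[symmetric])
  qed
qed

lemma flow_label_nf:
  assumes "e \<in> E"
  shows "\<phi> (num_nf (fst e)) (\<nu> (snd e)) = map \<nu> (map snd (\<Phi> e))"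
  using \<phi>_flow[of "nf (fst e)" "snd e"] nf_letters[of "fst e"] word_val_nf[of "fst e"] assms
  by (simp add: E_iff)

lemma tree_edge_by_flow_label:
  assumes "e \<in> E"
  shows "\<phi> (num_nf (fst e)) (\<nu> (snd e)) = [\<nu> (snd e)] \<longleftrightarrow> e \<in> T"
proof -
  have "set (map snd (\<Phi> e)) \<subseteq> A" "snd e \<in> A"
    using edge_path_set[OF flow_path[OF assms]] assms by (auto simp: cayley_edges_def)
  then show ?thesis
    using tree_iff_flow_label[OF assms] flow_label_nf[OF assms] map_\<nu>_eq_iff[of "map snd (\<Phi> e)" "[snd e]"]
    by simp
qed

text \<open>If operation \<open>op\<close> pushes the right diagram for each single edge, then a sequence of them traverses a
  path and leaves the diagrams on the stack in reverse order.\<close>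

lemma reaches_path:
  assumes "\<And>e D ctrl ps. (e, D) \<in> set (zip es Ds) \<Longrightarrow>
      reaches (num_nf (fst e), (op, \<nu> (snd e)) # ctrl, ps)
        (num_nf (terminal G e), ctrl, (num_nf (fst e), num_diagram D) # ps)"
    and "edge_path G E g es h" "length es = length Ds"
  shows "reaches (num_nf g, map (\<lambda>e. (op, \<nu> (snd e))) es @ ctrl, ps)
    (num_nf h, ctrl, rev (zip (map (\<lambda>e. num_nf (fst e)) es) (map num_diagram Ds)) @ ps)"
  using assms
proof (induction es arbitrary: g Ds ps)
  case Nil
  then show ?case by (simp add: reaches_refl)
next
  case (Cons e es)
  obtain D Ds' where Ds: "Ds = D # Ds'" using Cons.prems(3) by (cases Ds) auto
  have "reaches (num_nf g, (op, \<nu> (snd e)) # (map (\<lambda>e. (op, \<nu> (snd e))) es @ ctrl), ps)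
    (num_nf (terminal G e), map (\<lambda>e. (op, \<nu> (snd e))) es @ ctrl, (num_nf (fst e), num_diagram D) # ps)"
    using Cons.prems(1)[of e D] Cons.prems(2) by (simp add: Ds)
  moreover have "reaches (num_nf (terminal G e), map (\<lambda>e. (op, \<nu> (snd e))) es @ ctrl, (num_nf (fst e), num_diagram D) # ps)
    (num_nf h, ctrl, rev (zip (map (\<lambda>e. num_nf (fst e)) es) (map num_diagram Ds')) @ (num_nf (fst e), num_diagram D) # ps)"
    using Cons.prems by (intro Cons.IH) (auto simp: Ds)
  ultimately show ?case by (auto simp: Ds intro: reaches_trans)
qed

lemma glue_data_fold:
  assumes "edge_path G E g es h" "list_all2 edge_strip es Ds" "strip D y v (nf g) R"
  shows "foldl (\<lambda>D p. glue H (length (fst p)) D (snd p)) (num_diagram D)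
      (zip (map (\<lambda>e. num_nf (fst e)) es) (map num_diagram Ds)) =
    num_diagram (foldl (\<lambda>D1 (e', D2). glue G (length (nf (fst e'))) D1 D2) D (zip es Ds))"
  using assms
proof (induction es arbitrary: g Ds D v)
  case (Cons e es)
  obtain D2 Ds' where Ds: "Ds = D2 # Ds'" "edge_strip e D2" "list_all2 edge_strip es Ds'"
    using Cons.prems(2) by (auto simp: list_all2_Cons1)
  have "label ` darts D \<subseteq> A"
    using Cons.prems(3) grown_from_spherical by (auto simp: strip_def spherical_def)
  then have "glue H (length (nf (fst e))) (num_diagram D) (num_diagram D2) =
      num_diagram (glue G (length (nf (fst e))) D D2)"
    using edge_strip_labels[OF Ds(2)] by (rule num_glue[symmetric])
  moreover have "strip (glue G (length (nf (fst e))) D D2) y (v @ [snd e]) (nf (terminal G e)) R"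
    using Cons.prems Ds(2) by (intro strip_glue) (auto simp: edge_strip_def)
  ultimately show ?case using Cons.IH[of "terminal G e" Ds'] Cons.prems(1) Ds by simp
qed simp

lemma glue_data_along:
  assumes "edge_path G E g es h" "list_all2 edge_strip es Ds"
  shows "glue_data (zip (map (\<lambda>e. num_nf (fst e)) es) (map num_diagram Ds)) = num_diagram (glue_along G T es Ds)"
proof (cases es)
  case Nil
  then show ?thesis by (simp add: glue_data_def num_diagram_def)
next
  case (Cons e es')
  then obtain D Ds' where *: "Ds = D # Ds'" using assms by (cases Ds) auto
  then show ?thesis
    using glue_data_fold[of "terminal G e" es' h Ds' D "nf g" "[snd e]"] assms Cons
    by (auto simp: edge_strip_def glue_data_def)
qed

lemma step_operation:
  "step (y, (i, a) # ctrl, ps) = execute y ctrl ps i a"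
  by (simp add: step_def)

text \<open>Induction over the recursion, which is at the same time the proof that the machine halts.\<close>

lemma reaches_edge:
  "stack e D \<Longrightarrow> reaches (num_nf (fst e), (0, \<nu> (snd e)) # ctrl, ps)
    (num_nf (terminal G e), ctrl, (num_nf (fst e), num_diagram D) # ps)"
proof (induction arbitrary: ctrl ps rule: stacking.induct)
  case (degenerate e y z)
  then have e: "e \<in> E" using T_sub by blast
  then have c: "fst e \<in> carrier G" "terminal G e \<in> carrier G"
    using reverse_edge_facts by (auto simp: E_iff)
  have "num_diagram (segment G (if length y < length z then z else y)) =
      segment H (if length (map \<nu> y) < length (map \<nu> z) then map \<nu> z else map \<nu> y)"
    using degenerate nf_letters[OF c(1)] nf_letters[OF c(2)] by (simp add: num_segment)
  then have "step (num_nf (fst e), (0, \<nu> (snd e)) # ctrl, ps) =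
      (num_nf (terminal G e), ctrl, (num_nf (fst e), num_diagram (segment G (if length y < length z then z else y))) # ps)"
    using tree_edge_by_flow_label[OF e] next_nf_tree_edge[OF degenerate(1)] degenerate
    by (simp add: step_operation execute_def walk_data_def)
  then show ?case using reaches_step reaches_refl by metis
next
  case (recursive e Ds)
  then have e: "e \<in> E" "e \<notin> T" "snd e \<in> A" by (auto simp: E_iff)
  let ?l = "length (\<Phi> e)" and ?y = "num_nf (fst e)"
  let ?data = "zip (map (\<lambda>e. num_nf (fst e)) (\<Phi> e)) (map num_diagram Ds)"
  note path = flow_path[OF e(1)]
  have len: "length (\<Phi> e) = length Ds" using recursive(2) by (rule list_all2_lengthD)
  have strips: "list_all2 edge_strip (\<Phi> e) Ds"
    using recursive(2) by (rule list_all2_mono) (auto intro: stack_strip)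
  have lab: "label ` darts (glue_along G T (\<Phi> e) Ds) \<subseteq> A"
    using strip_glue_along[OF path strips flow_nonempty[OF e(1)]] grown_from_spherical
    by (auto simp: strip_def spherical_def)
  have "step (?y, (0, \<nu> (snd e)) # ctrl, ps) =
      (?y, map (\<lambda>e. (0, \<nu> (snd e))) (\<Phi> e) @ (?l + 4, \<nu> (snd e)) # ctrl, ps)"
    using tree_edge_by_flow_label[OF e(1)] flow_label_nf[OF e(1)] e(2)
    by (simp add: step_operation execute_def o_def)
  then have 1: "reaches (?y, (0, \<nu> (snd e)) # ctrl, ps)
      (?y, map (\<lambda>e. (0, \<nu> (snd e))) (\<Phi> e) @ (?l + 4, \<nu> (snd e)) # ctrl, ps)"
    using reaches_step reaches_refl by metis
  have 2: "reaches (?y, map (\<lambda>e. (0, \<nu> (snd e))) (\<Phi> e) @ (?l + 4, \<nu> (snd e)) # ctrl, ps)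
      (num_nf (terminal G e), (?l + 4, \<nu> (snd e)) # ctrl, rev ?data @ ps)"
  proof (rule reaches_path[OF _ path len])
    show "reaches (num_nf (fst e'), (0, \<nu> (snd e')) # c, qs) (num_nf (terminal G e'), c, (num_nf (fst e'), num_diagram D') # qs)"
      if "(e', D') \<in> set (zip (\<Phi> e) Ds)" for e' D' c qs
      using recursive(2) that unfolding list_all2_iff by blast
  qed
  have "step (num_nf (terminal G e), (?l + 4, \<nu> (snd e)) # ctrl, rev ?data @ ps) =
      (num_nf (terminal G e), ctrl, attach_data ?l (\<nu> (snd e)) ?data # ps)"
    using len by (simp add: step_operation execute_def)
  then have 3: "reaches (num_nf (terminal G e), (?l + 4, \<nu> (snd e)) # ctrl, rev ?data @ ps)
      (num_nf (terminal G e), ctrl, attach_data ?l (\<nu> (snd e)) ?data # ps)"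
    using reaches_step reaches_refl by metis
  have 4: "attach_data ?l (\<nu> (snd e)) ?data = (?y, num_diagram
      (attach_cell G (length (nf (fst e))) ?l (snd e) (glue_along G T (\<Phi> e) Ds)))"
  proof -
    obtain f es where f: "\<Phi> e = f # es" using flow_nonempty[OF e(1)] by (cases "\<Phi> e") auto
    then have "fst f = fst e" using path by simp
    moreover obtain D' Ds' where "Ds = D' # Ds'" using len f by (cases Ds) auto
    ultimately have "(case ?data of [] \<Rightarrow> [] | q # qs \<Rightarrow> fst q) = ?y" using f by simp
    then show ?thesis
      unfolding attach_data_def Let_def glue_data_along[OF path strips]
      using num_attach_cell[OF lab e(3)] by simp
  qed
  from reaches_trans[OF reaches_trans[OF 1 2] 3] show ?case unfolding 4 .
qed

lemma reaches_edge_diagram: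
  assumes "e \<in> E" "y = num_nf (fst e)" "a = \<nu> (snd e)" "z = num_nf (terminal G e)"
  shows "reaches (y, (0, a) # ctrl, ps) (z, ctrl, (y, num_diagram (edge_diagram G A T \<Phi> e)) # ps)"
  using reaches_edge[OF stack_edge_diagram[OF assms(1)]] assms by simp

lemma step_drop: "step (y, (1, a) # ctrl, q # ps) = (y, ctrl, ps)"
  and step_mirror: "step (y, (2, a) # ctrl, q # ps) = (y, ctrl, (y, mirror H (snd q)) # ps)"
  and step_choice: "step (y, (3, a) # ctrl, ps) =
    (y, (if ch y a then [(0, a)] else [(0, a), (1, 0), (0, \<iota> a), (2, 0), (0, a), (1, 0)]) @ ctrl, ps)"
  by (simp_all add: step_operation execute_def)

lemma reaches_oriented_diagram:
  assumes e: "e \<in> E" and c: "ch (num_nf (fst e)) (\<nu> (snd e)) = c e"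
  shows "reaches (num_nf (fst e), (3, \<nu> (snd e)) # ctrl, ps)
    (num_nf (terminal G e), ctrl, (num_nf (fst e), num_diagram (oriented_diagram G A T \<Phi> c e)) # ps)"
proof (cases "c e")
  case True
  have "reaches (num_nf (fst e), (0, \<nu> (snd e)) # ctrl, ps)
      (num_nf (terminal G e), ctrl, (num_nf (fst e), num_diagram (edge_diagram G A T \<Phi> e)) # ps)"
    using e by (intro reaches_edge_diagram) auto
  then show ?thesis
    by - (rule reaches_step, simp add: True c step_choice oriented_diagram_def)
next
  case False
  let ?a = "\<nu> (snd e)" and ?y = "num_nf (fst e)" and ?z = "num_nf (terminal G e)"
  let ?r = "reverse_edge G e"
  let ?D = "edge_diagram G A T \<Phi>"
  note r = reverse_edge_facts[OF e]
  have forward: "reaches (?y, (0, ?a) # ctrl', qs) (?z, ctrl', (?y, num_diagram (?D e)) # qs)" for ctrl' qs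
    using e by (intro reaches_edge_diagram) auto
  have backward: "reaches (?z, (0, \<iota> ?a) # ctrl', qs) (?y, ctrl', (?z, num_diagram (?D ?r)) # qs)" for ctrl' qs
    using r e \<iota>_letter[of "snd e"] by (intro reaches_edge_diagram) (auto simp: E_iff)
  have "label ` darts (?D ?r) \<subseteq> A"
    using edge_strip_labels stack_strip stack_edge_diagram r(1) by blast
  then have m: "mirror H (num_diagram (?D ?r)) = num_diagram (mirror G (?D ?r))"
    by (rule num_mirror[symmetric])
  have "reaches (?y, (0, ?a) # (1, 0) # (0, \<iota> ?a) # (2, 0) # (0, ?a) # (1, 0) # ctrl, ps)
      (?z, ctrl, (?y, num_diagram (mirror G (?D ?r))) # ps)"
    by (rule reaches_trans[OF forward reaches_step], unfold step_drop,
        rule reaches_trans[OF backward reaches_step], unfold step_mirror snd_conv m,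
        rule reaches_trans[OF forward reaches_step], unfold step_drop, rule reaches_refl)
  then show ?thesis
    by - (rule reaches_step, simp add: False c step_choice oriented_diagram_def)
qed

lemma reaches_halted:
  assumes "reaches s s'" "halted s'"
  obtains t where "(step ^^ t) s = s'" "halted ((step ^^ t) s)"
  using assms unfolding reaches_def by blast

lemma program_stacking_output:
  assumes ch: "\<And>w a. set w \<subseteq> A \<Longrightarrow> a \<in> A \<Longrightarrow> ch (map \<nu> w) (\<nu> a) = c (word_val G w, a)"
  shows "\<exists>p. \<forall>w\<in>lists A. evaluates p [word_code \<nu> w] (diagram_code \<nu> (stacking_output G A T \<Phi> c w))"
proof -
  define init :: "nat list \<Rightarrow> machine_state" where "init x = ([], map (\<lambda>b. (3, b)) x, [])" for x
  define out :: "machine_state \<Rightarrow> nat diagram" where "out s = glue_data (rev (snd (snd s)))" for s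
  have init: "computable init"
    unfolding init_def[abs_def] by (intro comp_intros)
  have out: "computable (\<lambda>p. out (snd p))"
    unfolding out_def by (intro comp_intros)
  obtain p where p: "\<And>x t. halted ((step ^^ t) (init x)) \<Longrightarrow> evaluates p [enc x] (enc (out ((step ^^ t) (init x))))"
    using program_by_iteration[OF init computable_step computable_halted out step_halted] by blast
  have "evaluates p [word_code \<nu> w] (diagram_code \<nu> (stacking_output G A T \<Phi> c w))" if w: "w \<in> lists A" for w
  proof -
    let ?es = "word_path G w"
    let ?Ds = "map (oriented_diagram G A T \<Phi> c) ?es"
    let ?data = "zip (map (\<lambda>e. num_nf (fst e)) ?es) (map num_diagram ?Ds)"
    note wp = word_path_facts[OF w]
    have es: "set ?es \<subseteq> E" using edge_path_set[OF wp(1)] .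
    have "reaches (num_nf \<one>, map (\<lambda>e. (3, \<nu> (snd e))) ?es @ [], []) (num_nf (word_val G w), [], rev ?data @ [])"
    proof (rule reaches_path[OF _ wp(1)])
      fix e D ctrl ps assume "(e, D) \<in> set (zip ?es ?Ds)"
      then have e: "e \<in> E" "D = oriented_diagram G A T \<Phi> c e"
        using es by (auto simp: zip_map2 zip_same_conv_map dest: set_zip_leftD)
      have "ch (num_nf (fst e)) (\<nu> (snd e)) = c e"
        using ch[of "nf (fst e)" "snd e"] nf_letters[of "fst e"] word_val_nf[of "fst e"] e(1) by (simp add: E_iff)
      then show "reaches (num_nf (fst e), (3, \<nu> (snd e)) # ctrl, ps)
        (num_nf (terminal G e), ctrl, (num_nf (fst e), num_diagram D) # ps)"
        using reaches_oriented_diagram e by simp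
    qed simp
    moreover have "map (\<lambda>e. (3 :: nat, \<nu> (snd e))) es = map (\<lambda>b. (3, b)) (map \<nu> (map snd es))"
      for es :: "'a edge list" by simp
    from this[of ?es] have "map (\<lambda>e. (3 :: nat, \<nu> (snd e))) ?es = map (\<lambda>b. (3, b)) (map \<nu> w)"
      unfolding wp(2) .
    ultimately have "reaches (init (map \<nu> w)) (num_nf (word_val G w), [], rev ?data)"
      by (simp add: init_def del: map_map)
    moreover have "halted (num_nf (word_val G w), [], rev ?data)" by (simp add: halted_def)
    ultimately obtain t where t: "(step ^^ t) (init (map \<nu> w)) = (num_nf (word_val G w), [], rev ?data)"
      "halted ((step ^^ t) (init (map \<nu> w)))"
      by (rule reaches_halted)
    have "list_all2 edge_strip ?es ?Ds"
      using es oriented_diagram_strip by (auto simp: list_all2_map2 list_all2_same)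
    from glue_data_along[OF wp(1) this]
    have "out (num_nf (word_val G w), [], rev ?data) = num_diagram (stacking_output G A T \<Phi> c w)"
      unfolding out_def stacking_output_def by (simp del: map_map)
    moreover have "enc (map \<nu> w) = word_code \<nu> w" by (simp add: enc_list_def word_code_def o_def)
    ultimately show ?thesis using p[OF t(2)] t(1) by (simp add: enc_num_diagram)
  qed
  then show ?thesis by blast
qed

text \<open>An edge and its reverse carry inverse letters, of which the smaller one is chosen. An involutive
  letter gives no preference; then the normal forms of the two ends, which differ, are compared.\<close>

definition letter_choice :: "'a edge \<Rightarrow> bool" where
  "letter_choice e \<longleftrightarrow>
    (if \<nu> (snd e) = \<nu> (inv (snd e)) then enc (num_nf (fst e)) < enc (num_nf (terminal G e))
     else \<nu> (snd e) < \<nu> (inv (snd e)))"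

lemma letter_choice_orientation: "orientation_choice G A letter_choice"
  unfolding orientation_choice_def
proof
  fix e assume e: "e \<in> E"
  note r = reverse_edge_facts[OF e]
  have a: "snd e \<in> A" "fst e \<in> carrier G" using e by (auto simp: E_iff)
  have "num_nf (fst e) \<noteq> num_nf (terminal G e)"
    using r(5,7) a(2) nf_letters word_val_nf map_\<nu>_eq_iff by metis
  then have "enc (num_nf (fst e)) < enc (num_nf (terminal G e)) \<or>
      enc (num_nf (terminal G e)) < enc (num_nf (fst e))"
    using enc_eq_iff nat_neq_iff by blast
  then show "letter_choice (reverse_edge G e) \<longleftrightarrow> \<not> letter_choice e"
    using r a by (cases "\<nu> (snd e) = \<nu> (inv (snd e))") (auto simp: letter_choice_def)
qed

text \<open>The machine traverses the word \<open>w\<close> and then twice the letter \<open>a\<close>; the two topmost entries of the stack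
  then show the normal forms of the end and of the start of the edge in question.\<close>

lemma letter_choice_recursive: "recursive_choice \<nu> G A letter_choice"
proof -
  define init :: "nat list \<times> nat \<Rightarrow> machine_state"
    where "init x = ([], map (\<lambda>b. (0, b)) (fst x @ [snd x, snd x]), [])" for x
  define out :: "nat list \<times> nat \<Rightarrow> machine_state \<Rightarrow> bool"
    where "out x s = (if snd x = \<iota> (snd x)
      then (case snd (snd s) of [] \<Rightarrow> False | q # qs \<Rightarrow>
        (case qs of [] \<Rightarrow> False | q' # qs' \<Rightarrow> enc (fst q') < enc (fst q)))
      else snd x < \<iota> (snd x))" for x s
  have init: "computable init" unfolding init_def[abs_def] by (intro comp_intros)
  have out: "computable (\<lambda>p. out (fst p) (snd p))"
    unfolding out_def by (intro comp_intros)
  obtain p where p: "\<And>x t. halted ((step ^^ t) (init x)) \<Longrightarrow>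
      evaluates p [enc x] (enc (out x ((step ^^ t) (init x))))"
    using program_by_iteration[OF init computable_step computable_halted out step_halted] by blast
  obtain q where q: "\<And>m n. evaluates q [m, n] (prod_encode (m, n))"
    using evaluates_pairing by blast
  have "evaluates (Comp p [q]) [word_code \<nu> w, \<nu> a] (if letter_choice (word_val G w, a) then 1 else 0)"
    if w: "w \<in> lists A" and a: "a \<in> A" for w a
  proof -
    let ?g = "word_val G w" and ?u = "w @ [a, a]"
    have u: "?u \<in> lists A" using w a by simp
    let ?es = "word_path G ?u"
    let ?Ds = "map (edge_diagram G A T \<Phi>) ?es"
    let ?data = "zip (map (\<lambda>e. num_nf (fst e)) ?es) (map num_diagram ?Ds)"
    note wp = word_path_facts[OF u]
    have es: "set ?es \<subseteq> E" using edge_path_set[OF wp(1)] .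
    have "reaches (num_nf \<one>, map (\<lambda>e. (0, \<nu> (snd e))) ?es @ [], []) (num_nf (word_val G ?u), [], rev ?data @ [])"
    proof (rule reaches_path[OF _ wp(1)])
      fix e D ctrl ps assume "(e, D) \<in> set (zip ?es ?Ds)"
      then have "e \<in> E" "D = edge_diagram G A T \<Phi> e"
        using es by (auto simp: zip_map2 zip_same_conv_map dest: set_zip_leftD)
      then show "reaches (num_nf (fst e), (0, \<nu> (snd e)) # ctrl, ps)
        (num_nf (terminal G e), ctrl, (num_nf (fst e), num_diagram D) # ps)"
        using reaches_edge_diagram by simp
    qed simp
    moreover have "map (\<lambda>e. (0 :: nat, \<nu> (snd e))) es = map (\<lambda>b. (0, b)) (map \<nu> (map snd es))"
      for es :: "'a edge list" by simp
    from this[of ?es] have "map (\<lambda>e. (0 :: nat, \<nu> (snd e))) ?es = map (\<lambda>b. (0, b)) (map \<nu> ?u)"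
      unfolding wp(2) .
    ultimately have "reaches (init (map \<nu> w, \<nu> a)) (num_nf (word_val G ?u), [], rev ?data)"
      by (simp add: init_def del: map_map)
    moreover have "halted (num_nf (word_val G ?u), [], rev ?data)" by (simp add: halted_def)
    ultimately obtain t where t: "(step ^^ t) (init (map \<nu> w, \<nu> a)) = (num_nf (word_val G ?u), [], rev ?data)"
      "halted ((step ^^ t) (init (map \<nu> w, \<nu> a)))"
      by (rule reaches_halted)
    have "?es = word_path G w @ [(?g, a), (word_val G (w @ [a]), a)]"
      by (simp add: word_path_def nth_append take_Suc_conv_app_nth)
    moreover have "word_val G (w @ [a]) = ?g \<otimes> a"
      using w a by (subst word_val_append) auto
    ultimately obtain D1 D2 ds where "rev ?data = (num_nf (?g \<otimes> a), D2) # (num_nf ?g, D1) # ds"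
      by simp
    then have "out (map \<nu> w, \<nu> a) (num_nf (word_val G ?u), [], rev ?data) = letter_choice (?g, a)"
      by (simp add: out_def letter_choice_def terminal_def \<iota>_letter[OF a])
    then have "evaluates p [enc (map \<nu> w, \<nu> a)] (if letter_choice (?g, a) then 1 else 0)"
      using p[OF t(2)] t(1) by (simp add: of_bool_def)
    moreover have "enc (map \<nu> w, \<nu> a) = prod_encode (word_code \<nu> w, \<nu> a)"
      by (simp add: enc_Pair enc_list_def word_code_def o_def)
    ultimately show ?thesis
      using q by (intro evaluates.comp[of _ _ "[prod_encode (word_code \<nu> w, \<nu> a)]"]) simp_all
  qed
  then show ?thesis unfolding recursive_choice_def by blast
qed

end

section \<open>The stacking algorithm\<close>

lemma foldr_find:
  assumes "\<And>u. u \<in> set us \<Longrightarrow> P u \<Longrightarrow> u = v" "v \<in> set us" "P v"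
  shows "foldr (\<lambda>u acc. if P u then u else acc) us z = v"
  using assms
proof (induction us)
  case (Cons u us)
  have unfold: "foldr (\<lambda>u acc. if P u then u else acc) (u # us) z =
      (if P u then u else foldr (\<lambda>u acc. if P u then u else acc) us z)"
    by (simp only: foldr.simps o_apply)
  show ?case
  proof (cases "P u")
    case True
    have "u = v" by (rule Cons.prems(1)) (simp, fact)
    then show ?thesis unfolding unfold if_P[OF True] .
  next
    case False
    then have "u \<noteq> v" using Cons.prems(3) by metis
    then have "v \<in> set us" using Cons.prems(2) by simp
    then show ?thesis
      unfolding unfold if_not_P[OF False] using Cons.prems by (intro Cons.IH) simp_all
  qed
qed simp

context stacking_flow
begin

lemma letter_inverse_table:
  assumes \<nu>: "inj_on \<nu> A"
  obtains \<iota> where "\<And>x. \<iota> (\<iota> x) = x" "computable \<iota>" "\<And>a. a \<in> A \<Longrightarrow> \<iota> (\<nu> a) = \<nu> (inv a)"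
proof -
  define \<iota> where "\<iota> n = (if n \<in> \<nu> ` A then \<nu> (inv (inv_into A \<nu> n)) else n)" for n
  have l: "\<iota> (\<nu> a) = \<nu> (inv a)" if "a \<in> A" for a
    using that \<nu> by (simp add: \<iota>_def)
  have "\<iota> (\<iota> x) = x" for x
  proof (cases "x \<in> \<nu> ` A")
    case True
    then obtain a where "a \<in> A" "x = \<nu> a" by blast
    then show ?thesis using l[of a] l[of "inv a"] by simp
  next
    case False
    then have "\<iota> x = x" unfolding \<iota>_def by simp
    then show ?thesis by simp
  qed
  moreover have "computable \<iota>"
    unfolding \<iota>_def[abs_def] using A_finite by (intro computable_modify comp_intros) simp
  ultimately show thesis using that l by blast
qed

text \<open>Programs for the flow function and for orientations are specified on codes of words over \<open>A\<close> only.
  All other inputs are mapped to such codes, computably, since \<open>A\<close> is finite.\<close>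

lemma total_word_function:
  assumes \<nu>: "inj_on \<nu> A" and a0: "a0 \<in> A"
  obtains w' :: "nat list \<Rightarrow> 'a list" and a' :: "nat \<Rightarrow> 'a"
  where "\<And>x. w' x \<in> lists A" "\<And>n. a' n \<in> A"
    "\<And>w. w \<in> lists A \<Longrightarrow> w' (map \<nu> w) = w" "\<And>a. a \<in> A \<Longrightarrow> a' (\<nu> a) = a"
    "computable (\<lambda>x. word_code \<nu> (w' x))" "computable (\<lambda>n. \<nu> (a' n))"
proof -
  define a' where "a' n = (if n \<in> \<nu> ` A then inv_into A \<nu> n else a0)" for n
  define w' where "w' x = (if foldr (\<lambda>n acc. n \<in> \<nu> ` A \<and> acc) x True then map a' x else [])" for x
  have a'A: "a' n \<in> A" for n using a0 by (auto simp: a'_def inv_into_into)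
  have a'\<nu>: "a' (\<nu> a) = a" if "a \<in> A" for a using that \<nu> by (simp add: a'_def)
  have all: "foldr (\<lambda>n acc. n \<in> \<nu> ` A \<and> acc) x True \<longleftrightarrow> set x \<subseteq> \<nu> ` A" for x
    by (induction x) auto
  have fin: "finite (\<nu> ` A)" using A_finite by simp
  have ca: "computable (\<lambda>n. \<nu> (a' n))"
  proof -
    have *: "\<nu> (a' n) = (if n \<in> \<nu> ` A then n else \<nu> a0)" for n
      by (auto simp: a'_def f_inv_into_f)
    show ?thesis unfolding * using fin by (intro comp_intros computable_finite_set)
  qed
  have cw: "computable (\<lambda>x. word_code \<nu> (w' x))"
  proof -
    have *: "word_code \<nu> (w' x) = enc (if foldr (\<lambda>n acc. n \<in> \<nu> ` A \<and> acc) x True then map (\<lambda>n. \<nu> (a' n)) x else [])" for x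
      by (simp add: w'_def word_code_def enc_list_def o_def)
    show ?thesis unfolding * using fin
      by (intro comp_intros computable_finite_set computable_compose[OF ca])
  qed
  show thesis
  proof (rule that[OF _ a'A _ a'\<nu> cw ca])
    show "w' x \<in> lists A" for x using a'A by (auto simp: w'_def)
    show "w' (map \<nu> w) = w" if "w \<in> lists A" for w
    proof -
      have "set (map \<nu> w) \<subseteq> \<nu> ` A" using that by auto
      moreover have "map a' (map \<nu> w) = w" using that a'\<nu> by (induction w) auto
      ultimately show ?thesis unfolding w'_def all by simp
    qed
  qed
qed

lemma enc_surj_word: "surj (enc :: nat list \<Rightarrow> nat)"
  by (intro enc_surj_list enc_surj_nat)

text \<open>Boundedness leaves finitely many candidates for the label of $\Phi(e)$, and a decision procedure for
  the graph $S_\Phi$ finds the one that is right.\<close>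

lemma computable_flow_labels:
  assumes \<nu>: "inj_on \<nu> A" and rec: "recursive_flow_set \<nu> A (flow_set G A \<Phi>)"
    and k: "\<And>e. e \<in> E \<Longrightarrow> length (\<Phi> e) \<le> k"
  obtains \<phi> where "computable (\<lambda>p. \<phi> (fst p) (snd p))"
    "\<And>w a. set w \<subseteq> A \<Longrightarrow> a \<in> A \<Longrightarrow> \<phi> (map \<nu> w) (\<nu> a) = map \<nu> (map snd (\<Phi> (word_val G w, a)))"
proof (cases "A = {}")
  case True
  show thesis by (rule that[of "\<lambda>_ _. []"]) (simp_all only: computable_const True empty_iff)
next
  case False
  then obtain a0 where "a0 \<in> A" by blast
  let ?S = "flow_set G A \<Phi>"
  obtain w' :: "nat list \<Rightarrow> 'a list" and a' :: "nat \<Rightarrow> 'a"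
    where w'A: "\<And>x. w' x \<in> lists A" and a'A: "\<And>n. a' n \<in> A"
    and w'\<nu>: "\<And>w. w \<in> lists A \<Longrightarrow> w' (map \<nu> w) = w" and a'\<nu>: "\<And>a. a \<in> A \<Longrightarrow> a' (\<nu> a) = a"
    and cw: "computable (\<lambda>x. word_code \<nu> (w' x))" and ca: "computable (\<lambda>n. \<nu> (a' n))"
    using total_word_function[OF \<nu> \<open>a0 \<in> A\<close>] by metis
  obtain p where p: "\<And>w a u. w \<in> lists A \<Longrightarrow> a \<in> A \<Longrightarrow> u \<in> lists A \<Longrightarrow>
      evaluates p [word_code \<nu> w, \<nu> a, word_code \<nu> u] (if (w, a, u) \<in> ?S then 1 else 0)"
    using rec unfolding recursive_flow_set_def by blast
  define P where "P x \<longleftrightarrow> (w' (fst x), a' (fst (snd x)), w' (snd (snd x))) \<in> ?S" for x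
  have "computable P"
  proof (rule computable_by_program)
    show "surj (enc :: nat list \<times> nat \<times> nat list \<Rightarrow> nat)"
      by (intro enc_surj_prod enc_surj_word enc_surj_nat)
    show "evaluates p (map (\<lambda>c. c x) [\<lambda>x. word_code \<nu> (w' (fst x)), \<lambda>x. \<nu> (a' (fst (snd x))),
        \<lambda>x. word_code \<nu> (w' (snd (snd x)))]) (enc (P x))" for x
      using p[OF w'A a'A w'A] by (simp add: P_def of_bool_def)
    show "computable c" if "c \<in> set [\<lambda>x. word_code \<nu> (w' (fst x)), \<lambda>x. \<nu> (a' (fst (snd x))),
        \<lambda>x. word_code \<nu> (w' (snd (snd x)))]" for c :: "nat list \<times> nat \<times> nat list \<Rightarrow> nat"
      using that by (auto intro!: computable_compose[OF cw] computable_compose[OF ca] comp_intros)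
  qed
  obtain us where us: "set us = {u. set u \<subseteq> \<nu> ` A \<and> length u \<le> k}"
    using finite_list[OF finite_lists_length_le[of "\<nu> ` A" k]] A_finite by auto
  define \<phi> where "\<phi> x n = foldr (\<lambda>u acc. if P (x, n, u) then u else acc) us []" for x n
  have "computable (\<lambda>q. \<phi> (fst q) (snd q))"
    unfolding \<phi>_def by (intro comp_intros computable_compose[OF \<open>computable P\<close>])
  moreover have "\<phi> (map \<nu> w) (\<nu> a) = map \<nu> (map snd (\<Phi> (word_val G w, a)))"
    if w: "set w \<subseteq> A" and a: "a \<in> A" for w a
    unfolding \<phi>_def
  proof (rule foldr_find)
    let ?e = "(word_val G w, a)"
    let ?v = "map snd (\<Phi> ?e)"
    have e: "?e \<in> E" using w a by (simp add: E_iff)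
    have "set ?v \<subseteq> A"
      using edge_path_set[OF flow_path[OF e]] by (auto simp: cayley_edges_def)
    then have v: "?v \<in> lists A" by (simp only: lists_eq_set mem_Collect_eq)
    have wl: "w \<in> lists A" using w by auto
    have S: "(w, a, u) \<in> ?S \<longleftrightarrow> u = ?v" for u
      using wl a by (auto simp: flow_set_def)
    have P: "P (map \<nu> w, \<nu> a, map \<nu> u) \<longleftrightarrow> u = ?v" if "u \<in> lists A" for u
      using that wl a by (simp add: P_def w'\<nu> a'\<nu> S)
    show "P (map \<nu> w, \<nu> a, map \<nu> ?v)" using P[OF v] by simp
    show "map \<nu> ?v \<in> set us"
    proof -
      have "set (map \<nu> ?v) \<subseteq> \<nu> ` A" using \<open>set ?v \<subseteq> A\<close> by (simp only: set_map image_mono)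
      then show ?thesis using k[OF e] by (simp add: us)
    qed
    show "u = map \<nu> ?v" if "u \<in> set us" "P (map \<nu> w, \<nu> a, u)" for u
    proof -
      have "u \<in> lists (\<nu> ` A)" using that(1) by (auto simp: us)
      then obtain u' where "u' \<in> lists A" "u = map \<nu> u'" by (auto simp: lists_image)
      then show ?thesis using that(2) P by simp
    qed
  qed
  ultimately show thesis using that by blast
qed

lemma computable_orientation_choice:
  assumes \<nu>: "inj_on \<nu> A" and rec: "recursive_choice \<nu> G A c"
  obtains ch where "computable (\<lambda>p. ch (fst p) (snd p))"
    "\<And>w a. set w \<subseteq> A \<Longrightarrow> a \<in> A \<Longrightarrow> ch (map \<nu> w) (\<nu> a) = c (word_val G w, a)"
proof (cases "A = {}")
  case True
  show thesis by (rule that[of "\<lambda>_ _. False"]) (simp_all only: computable_const True empty_iff)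
next
  case False
  then obtain a0 where "a0 \<in> A" by blast
  obtain w' :: "nat list \<Rightarrow> 'a list" and a' :: "nat \<Rightarrow> 'a"
    where w'A: "\<And>x. w' x \<in> lists A" and a'A: "\<And>n. a' n \<in> A"
    and w'\<nu>: "\<And>w. w \<in> lists A \<Longrightarrow> w' (map \<nu> w) = w" and a'\<nu>: "\<And>a. a \<in> A \<Longrightarrow> a' (\<nu> a) = a"
    and cw: "computable (\<lambda>x. word_code \<nu> (w' x))" and ca: "computable (\<lambda>n. \<nu> (a' n))"
    using total_word_function[OF \<nu> \<open>a0 \<in> A\<close>] by metis
  obtain p where p: "\<And>w a. w \<in> lists A \<Longrightarrow> a \<in> A \<Longrightarrow>
      evaluates p [word_code \<nu> w, \<nu> a] (if c (word_val G w, a) then 1 else 0)"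
    using rec unfolding recursive_choice_def by blast
  define ch where "ch x n = c (word_val G (w' x), a' n)" for x n
  have "computable (\<lambda>q. ch (fst q) (snd q))"
  proof (rule computable_by_program)
    show "surj (enc :: nat list \<times> nat \<Rightarrow> nat)"
      by (intro enc_surj_prod enc_surj_word enc_surj_nat)
    show "evaluates p (map (\<lambda>c. c x) [\<lambda>x. word_code \<nu> (w' (fst x)), \<lambda>x. \<nu> (a' (snd x))])
        (enc (ch (fst x) (snd x)))" for x
      using p[OF w'A a'A] by (simp add: ch_def of_bool_def)
    show "computable c" if "c \<in> set [\<lambda>x. word_code \<nu> (w' (fst x)), \<lambda>x. \<nu> (a' (snd x))]"
      for c :: "nat list \<times> nat \<Rightarrow> nat"
      using that by (auto intro!: computable_compose[OF cw] computable_compose[OF ca] comp_intros)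
  qed
  moreover have "ch (map \<nu> w) (\<nu> a) = c (word_val G w, a)" if "set w \<subseteq> A" "a \<in> A" for w a
  proof -
    have "w \<in> lists A" using that(1) by auto
    then show ?thesis using that(2) w'\<nu> a'\<nu> by (simp add: ch_def)
  qed
  ultimately show thesis using that by blast
qed

end

theorem proposition3p5:
  fixes G :: "('g, 'm) monoid_scheme" and A :: "'g set" and T :: "'g edge set"
    and \<Phi> :: "'g edge \<Rightarrow> 'g edge list" and \<nu> :: "'g \<Rightarrow> nat"
  assumes "group G"
    and "symmetric_generating_set G A"
    and "algorithmically_stackable G A"
    and "maximal_tree G A T"
    and "bounded_flow_function G A T \<Phi>"
    and "inj_on \<nu> A"
    and "recursive_flow_set \<nu> A (flow_set G A \<Phi>)"
  shows "(\<forall>e\<in>cayley_edges G A.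
            (\<exists>!D. stacking G A T \<Phi> e D) \<and>
            van_kampen_diagram G A (stacking_relators G A T \<Phi>)
              (normal_form G T (fst e) @ [snd e] @ inv_word G (normal_form G T (terminal G e)))
              (edge_diagram G A T \<Phi> e)) \<and>
         (\<exists>c. orientation_choice G A c \<and> recursive_choice \<nu> G A c) \<and>
         (\<forall>c. orientation_choice G A c \<longrightarrow>
            (\<forall>w\<in>lists A. word_val G w = \<one>\<^bsub>G\<^esub> \<longrightarrow>
               van_kampen_diagram G A (stacking_relators G A T \<Phi>) w
                 (stacking_output G A T \<Phi> c w)) \<and>
            (recursive_choice \<nu> G A c \<longrightarrow>
               (\<exists>p. \<forall>w\<in>lists A. word_val G w = \<one>\<^bsub>G\<^esub> \<longrightarrow>
                  evaluates p [word_code \<nu> w] (diagram_code \<nu> (stacking_output G A T \<Phi> c w)))))"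
proof -
  interpret group G by fact
  interpret stacking_flow G A T \<Phi>
    by unfold_locales (use assms in \<open>auto simp: bounded_flow_function_def\<close>)
  obtain k where k: "\<And>e. e \<in> E \<Longrightarrow> length (\<Phi> e) \<le> k"
    using assms(5) unfolding bounded_flow_function_def by blast
  obtain \<iota> where \<iota>: "\<And>x. \<iota> (\<iota> x) = x" "computable \<iota>" "\<And>a. a \<in> A \<Longrightarrow> \<iota> (\<nu> a) = \<nu> (inv\<^bsub>G\<^esub> a)"
    using letter_inverse_table[OF assms(6)] by metis
  obtain \<phi> where \<phi>: "computable (\<lambda>p. \<phi> (fst p) (snd p))"
    "\<And>w a. set w \<subseteq> A \<Longrightarrow> a \<in> A \<Longrightarrow> \<phi> (map \<nu> w) (\<nu> a) = map \<nu> (map snd (\<Phi> (word_val G w, a)))"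
    using computable_flow_labels[OF assms(6,7) k] by metis
  have machine: "stacking_machine G A T \<Phi> \<iota> \<phi> ch \<nu>" if "computable (\<lambda>p. ch (fst p) (snd p))" for ch
    by unfold_locales (use \<iota> \<phi> that assms(6) in auto)
  have "\<exists>c. orientation_choice G A c \<and> recursive_choice \<nu> G A c"
  proof -
    interpret stacking_machine G A T \<Phi> \<iota> \<phi> "\<lambda>_ _. False" \<nu>
      by (rule machine) (rule computable_const)
    show ?thesis using letter_choice_orientation letter_choice_recursive by blast
  qed
  moreover have "\<exists>p. \<forall>w\<in>lists A. word_val G w = \<one>\<^bsub>G\<^esub> \<longrightarrow>
      evaluates p [word_code \<nu> w] (diagram_code \<nu> (stacking_output G A T \<Phi> c w))"
    if c: "recursive_choice \<nu> G A c" for c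
  proof -
    obtain ch where ch: "computable (\<lambda>p. ch (fst p) (snd p))"
      "\<And>w a. set w \<subseteq> A \<Longrightarrow> a \<in> A \<Longrightarrow> ch (map \<nu> w) (\<nu> a) = c (word_val G w, a)"
      using computable_orientation_choice[OF assms(6) c] by metis
    interpret stacking_machine G A T \<Phi> \<iota> \<phi> ch \<nu>
      by (rule machine) (rule ch(1))
    show ?thesis using program_stacking_output[of c] ch(2) by blast
  qed
  ultimately show ?thesis
    using stacking_unique edge_diagram_van_kampen stacking_output_van_kampen by blast
qed

end
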